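(* Let $H$ be a Hilbert space and $X$ a Banach space over the same field $\mathbb{K}\in\{\mathbb{R},\mathbb{C}\}$ (possibly infinite-dimensional). Let $T:X\to H$ and $S:H\to X$ be bounded linear operators. Then $\tau_\infty(T)=\|T\|_N$ and $\tau_\infty(S)=\|S\|_N$ (as elements of $[0,+\infty]$).
   Context: For a Banach space $X$ with dual $X^*$ and dual unit ball $B_{X^*}$, and an integer $k\ge 1$, the algebraic tensor power $X^{\otimes k}$ carries the injective norm $\|z\|_{\varepsilon_k(X)}=\sup\{|(\lambda_1\otimes\cdots\otimes\lambda_k)(z)| : \lambda_1,\dots,\lambda_k\in B_{X^*}\}$ and the projective norm $\|z\|_{\pi_k(X)}=\inf\{\sum_{i=1}^m \|x_i^{(1)}\|_X\cdots\|x_i^{(k)}\|_X : m\in\mathbb{N},\ z=\sum_{i=1}^m x_i^{(1)}\otimes\cdots\otimes x_i^{(k)}\}$. For a bounded operator $T:X\to Y$ between Banach spaces, $\tau_k(T)=\left(\sup_{z\in X^{\otimes k},\,z\neq 0}\frac{\|T^{\otimes k}z\|_{\pi_k(Y)}}{\|z\|_{\varepsilon_k(X)}}\right)^{1/k}\in[0,+\infty]$, with the supremum over the algebraic tensor power, and $\tau_\infty(T)=\lim_{k\to\infty}\tau_k(T)\in[0,+\infty]$. The nuclear norm is $\|T\|_N=\inf\sum_{i=1}^\infty\|x_i^*\|_{X^*}\|y_i\|_Y$, the infimum over all representations $T(\cdot)=\sum_{i=1}^\infty x_i^*(\cdot)y_i$ with $x_i^*\in X^*$, $y_i\in Y$ and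 $\sum_i\|x_i^*\|\|y_i\|<\infty$; $\|T\|_N=+\infty$ if there is no such representation. *)

theory Defs
  imports "HOL-Analysis.Analysis" "HOL-Library.Function_Algebras"
begin

text \<open>
  The instances of the following class are, up to isometric isomorphism, exactly the real
  numbers (with trivial conjugation) and the complex numbers; see \<open>rc_field_cases\<close>.
\<close>

class rc_field = real_normed_field +
  fixes kconj :: "'a \<Rightarrow> 'a"
  assumes kconj_add: "kconj (x + y) = kconj x + kconj y"
    and mult_kconj_scaleR: "x * kconj x = (norm x)\<^sup>2 *\<^sub>R 1"

instantiation real :: rc_field
begin
definition kconj_real :: "real \<Rightarrow> real" where "kconj_real x = x"
instance by standard (auto simp: kconj_real_def power2_eq_square)
end

instantiation complex :: rc_field
begin
definition kconj_complex :: "complex \<Rightarrow> complex" where "kconj_complex = cnj"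
instance
proof
  fix x y :: complex
  show "kconj (x + y) = kconj x + kconj y" by (simp add: kconj_complex_def)
  show "x * kconj x = (norm x)\<^sup>2 *\<^sub>R 1"
    using complex_norm_square[of x] by (simp add: kconj_complex_def scaleR_conv_of_real)
qed
end

lemma mult_kconj: "x * kconj x = of_real ((norm x)\<^sup>2)"
  by (simp add: mult_kconj_scaleR of_real_def)

lemma kconj_of_real: "kconj (of_real r :: 'k::rc_field) = of_real r"
proof (cases "r = 0")
  case True
  have "kconj (0::'k) = kconj 0 + kconj 0" using kconj_add[of "0::'k" 0] by simp
  then show ?thesis using True by simp
next
  case False
  have "of_real r * kconj (of_real r :: 'k) = of_real r * of_real r"
    using mult_kconj[of "of_real r :: 'k"] by (simp add: power2_eq_square)
  then show ?thesis using False by simp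
qed

lemma rc_field_cases:
  "(bij (of_real :: real \<Rightarrow> 'k::rc_field) \<and> (\<forall>x::'k. kconj x = x)) \<or>
   (\<exists>g :: complex \<Rightarrow> 'k. bij g \<and> (\<forall>z w. g (z + w) = g z + g w) \<and> (\<forall>z w. g (z * w) = g z * g w) \<and>
      (\<forall>r. g (of_real r) = of_real r) \<and> (\<forall>z. norm (g z) = norm z) \<and> (\<forall>z. g (cnj z) = kconj (g z)))"
proof -
  have quad: "\<exists>t d. (x - of_real t)\<^sup>2 = of_real d" for x :: 'k
  proof -
    define t where "t = (norm (1 + x))\<^sup>2 - 1 - (norm x)\<^sup>2"
    have "(1 + x) * (1 + kconj x) = of_real ((norm (1 + x))\<^sup>2)"
      using mult_kconj[of "1 + x"] kconj_of_real[of 1, where 'k='k] by (simp add: kconj_add)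
    then have "kconj x + x = of_real t"
      using mult_kconj[of x] by (simp add: t_def algebra_simps)
    then have "x * (of_real t - x) = of_real ((norm x)\<^sup>2)"
      using mult_kconj[of x] by (metis add_diff_cancel_right')
    then have "(x - of_real (t/2))\<^sup>2 = of_real ((t/2)\<^sup>2 - (norm x)\<^sup>2)"
      by (simp add: power2_eq_square field_simps)
    then show ?thesis by blast
  qed
  have root: "(\<exists>r. x = of_real r) \<or> (\<exists>a b i. b \<noteq> 0 \<and> i\<^sup>2 = -1 \<and> x = of_real a + of_real b * i)" for x :: 'k
  proof -
    obtain t d where td: "(x - of_real t)\<^sup>2 = of_real d" using quad by blast
    show ?thesis
    proof (cases "d \<ge> 0")
      case True
      then have "(x - of_real t)\<^sup>2 = (of_real (sqrt d))\<^sup>2"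
        using td by (simp flip: of_real_power)
      then have "x - of_real t = of_real (sqrt d) \<or> x - of_real t = of_real (- sqrt d)"
        by (auto simp: power2_eq_iff)
      then have "x = of_real (t + sqrt d) \<or> x = of_real (t - sqrt d)"
        by (auto simp: algebra_simps)
      then show ?thesis by blast
    next
      case False
      define s where "s = sqrt (- d)"
      have s: "s \<noteq> 0" "s\<^sup>2 = - d" using False by (auto simp: s_def)
      have "((x - of_real t) / of_real s)\<^sup>2 = of_real (d / s\<^sup>2)"
        by (simp add: power_divide td)
      also have "d / s\<^sup>2 = -1" using s False by simp
      finally have "((x - of_real t) / of_real s)\<^sup>2 = -1" by simp
      moreover have "x = of_real t + of_real s * ((x - of_real t) / of_real s)" using s by simp
      ultimately show ?thesis using s by blast
    qed
  qed
  show ?thesis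
  proof (cases "\<exists>i::'k. i\<^sup>2 = -1")
    case False
    then have "\<exists>r. x = of_real r" for x :: 'k using root[of x] by blast
    then show ?thesis
      by (metis bijI inj_of_real surj_def kconj_of_real)
  next
    case True
    then obtain i :: 'k where i: "i\<^sup>2 = -1" by blast
    then have ii: "i * i = -1" by (simp add: power2_eq_square)
    define g where "g z = of_real (Re z) + of_real (Im z) * i" for z
    have g_add: "g (z + w) = g z + g w" for z w by (simp add: g_def algebra_simps)
    have g_mult: "g (z * w) = g z * g w" for z w
    proof -
      have "g z * g w = of_real (Re z * Re w) + of_real (Re z * Im w + Im z * Re w) * i
          + of_real (Im z * Im w) * (i * i)"
        by (simp add: g_def algebra_simps)
      then show ?thesis by (simp add: g_def ii algebra_simps)
    qed
    have g_real: "g (of_real r) = of_real r" for r by (simp add: g_def)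
    have i_norm: "norm i = 1"
      using i by (metis norm_power norm_minus_cancel norm_one norm_ge_zero power2_eq_1_iff
          neg_0_le_iff_le not_one_le_zero)
    have i_conj: "kconj i = - i"
    proof -
      have "i * kconj i = i * (- i)" using mult_kconj[of i] i_norm ii by simp
      moreover have "i \<noteq> 0" using i by auto
      ultimately show ?thesis by (metis mult_cancel_left)
    qed
    have conj_bi: "kconj (of_real b * i) = - (of_real b * i)" for b
    proof (cases "b = 0")
      case True
      then show ?thesis using kconj_of_real[of 0, where 'k='k] by simp
    next
      case False
      have "(of_real b * i) * kconj (of_real b * i) = of_real (b\<^sup>2)"
        using mult_kconj[of "of_real b * i"] i_norm by (simp add: norm_mult)
      also have "\<dots> = - of_real (b\<^sup>2) * (i * i)" by (simp add: ii)
      also have "\<dots> = (of_real b * i) * (- (of_real b * i))"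
        by (simp add: power2_eq_square algebra_simps)
      finally show ?thesis using False i by (metis mult_cancel_left mult_eq_0_iff of_real_eq_0_iff
            power_zero_numeral neg_equal_0_iff_equal zero_neq_one)
    qed
    have g_conj: "g (cnj z) = kconj (g z)" for z
      by (simp add: g_def kconj_add kconj_of_real conj_bi)
    have g_norm: "norm (g z) = norm z" for z
    proof -
      have "of_real ((norm (g z))\<^sup>2) = g z * g (cnj z)" by (simp add: mult_kconj g_conj)
      also have "\<dots> = g (z * cnj z)" by (simp add: g_mult)
      also have "\<dots> = of_real ((norm z)\<^sup>2)" by (metis complex_norm_square g_real)
      finally have "(norm (g z))\<^sup>2 = (norm z)\<^sup>2" by (simp only: of_real_eq_iff)
      then show ?thesis by simp
    qed
    have g_inj: "inj g"
    proof (rule injI)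
      fix z w assume "g z = g w"
      moreover have "g z = g (z - w) + g w" by (simp flip: g_add)
      ultimately have "g (z - w) = 0" by simp
      then show "z = w" using g_norm[of "z - w"] by simp
    qed
    have g_surj: "\<exists>z. x = g z" for x
    proof -
      consider r where "x = of_real r" | a b j where "j\<^sup>2 = -1" "x = of_real a + of_real b * j"
        using root[of x] by blast
      then show ?thesis
      proof cases
        case 1
        then show ?thesis using g_real by metis
      next
        case 2
        then have "j = i \<or> j = - i" using i by (metis power2_eq_iff)
        then have "x = g (Complex a b) \<or> x = g (Complex a (- b))"
          using 2 by (auto simp: g_def)
        then show ?thesis by blast
      qed
    qed
    have "bij g" using g_inj g_surj by (auto simp: bij_def surj_def)
    then show ?thesis using g_add g_mult g_real g_norm g_conj by blast
  qed
qed

text \<open>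
  The class \<open>banach\<close> supplies the norm, completeness and the underlying real vector space;
  the scalar multiplication by the field is a parameter extending the real one.
\<close>

locale banach_over = vector_space scale
  for scale :: "'k::rc_field \<Rightarrow> 'a::banach \<Rightarrow> 'a" +
  assumes norm_scale: "norm (scale c x) = norm c * norm x"
    and scale_of_real: "scale (of_real r) x = r *\<^sub>R x"

locale hilbert_over = banach_over scale
  for scale :: "'k::rc_field \<Rightarrow> 'a::banach \<Rightarrow> 'a" +
  fixes ip :: "'a \<Rightarrow> 'a \<Rightarrow> 'k"
  assumes ip_linear: "Vector_Spaces.linear scale (*) (\<lambda>x. ip x y)"
    and ip_conj: "ip y x = kconj (ip x y)"
    and ip_norm: "ip x x = of_real ((norm x)\<^sup>2)"

lemma banach_over_scaleR: "banach_over ((*\<^sub>R) :: real \<Rightarrow> 'a::banach \<Rightarrow> 'a)"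
  by unfold_locales (auto simp: algebra_simps)

lemma hilbert_over_inner: "hilbert_over (*\<^sub>R) ((\<bullet>) :: 'a::{real_inner, banach} \<Rightarrow> 'a \<Rightarrow> real)"
  by unfold_locales
    (auto simp: algebra_simps inner_commute kconj_real_def power2_norm_eq_inner)

definition bounded_operator ::
  "('k::rc_field \<Rightarrow> 'a::banach \<Rightarrow> 'a) \<Rightarrow> ('k \<Rightarrow> 'b::real_normed_vector \<Rightarrow> 'b) \<Rightarrow> ('a \<Rightarrow> 'b) \<Rightarrow> bool"
  where "bounded_operator s1 s2 T \<longleftrightarrow> Vector_Spaces.linear s1 s2 T \<and> bounded_linear T"

definition dual_space :: "('k::rc_field \<Rightarrow> 'a::banach \<Rightarrow> 'a) \<Rightarrow> ('a \<Rightarrow> 'k) set"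
  where "dual_space s = {f. bounded_operator s (*) f}"

definition dual_ball :: "('k::rc_field \<Rightarrow> 'a::banach \<Rightarrow> 'a) \<Rightarrow> ('a \<Rightarrow> 'k) set"
  where "dual_ball s = {f \<in> dual_space s. onorm f \<le> 1}"

text \<open>
  A \<open>k\<close>-tuple of vectors is a list of length \<open>k\<close>; values at lists of other lengths are irrelevant.
\<close>

definition multilinear ::
  "('k::field \<Rightarrow> 'a::ab_group_add \<Rightarrow> 'a) \<Rightarrow> ('k \<Rightarrow> 'b::ab_group_add \<Rightarrow> 'b) \<Rightarrow> nat \<Rightarrow> ('a list \<Rightarrow> 'b) \<Rightarrow> bool"
  where "multilinear s1 s2 k \<phi> \<longleftrightarrow>
    (\<forall>xs i. length xs = k \<and> i < k \<longrightarrow> Vector_Spaces.linear s1 s2 (\<lambda>v. \<phi> (xs[i := v])))"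

text \<open>
  The \<open>k\<close>-th algebraic tensor power is realised inside the space of functionals on
  \<open>k\<close>-linear forms: the elementary tensor of \<open>xs\<close> is evaluation at \<open>xs\<close>, and the tensor power is
  the linear span of the elementary tensors. Functionals are extended by \<open>0\<close> to non-multilinear
  arguments, so that equality of tensors is equality in HOL. The universal property is
  \<open>tensor_universal\<close> below.
\<close>

type_synonym ('k, 'a) tensor = "('a list \<Rightarrow> 'k) \<Rightarrow> 'k"

definition tensor_scale :: "'k::field \<Rightarrow> ('k, 'a) tensor \<Rightarrow> ('k, 'a) tensor"
  where "tensor_scale c z = (\<lambda>\<phi>. c * z \<phi>)"

definition elem_tensor :: "('k::field \<Rightarrow> 'a::ab_group_add \<Rightarrow> 'a) \<Rightarrow> 'a list \<Rightarrow> ('k, 'a) tensor"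
  where "elem_tensor s xs = (\<lambda>\<phi>. if multilinear s (*) (length xs) \<phi> then \<phi> xs else 0)"

definition tensor_power :: "('k::field \<Rightarrow> 'a::ab_group_add \<Rightarrow> 'a) \<Rightarrow> nat \<Rightarrow> ('k, 'a) tensor set"
  where "tensor_power s k = module.span tensor_scale (elem_tensor s ` {xs. length xs = k})"

text \<open>
  In this model \<open>\<lambda>\<^sub>1 \<otimes> \<dots> \<otimes> \<lambda>\<^sub>k\<close> is evaluation at the product form, and \<open>T \<otimes> \<dots> \<otimes> T\<close> is
  precomposition with the pullback of forms along \<open>T\<close>; compare \<open>tensor_functional_elem\<close> and
  \<open>tensor_map_elem\<close>.
\<close>

definition tensor_functional :: "nat \<Rightarrow> (nat \<Rightarrow> 'a \<Rightarrow> 'k) \<Rightarrow> ('k::field, 'a) tensor \<Rightarrow> 'k"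
  where "tensor_functional k l z = z (\<lambda>xs. \<Prod>i<k. l i (xs ! i))"

definition tensor_map ::
  "('k::field \<Rightarrow> 'b::ab_group_add \<Rightarrow> 'b) \<Rightarrow> nat \<Rightarrow> ('a \<Rightarrow> 'b) \<Rightarrow> ('k, 'a) tensor \<Rightarrow> ('k, 'b) tensor"
  where "tensor_map s2 k T z = (\<lambda>\<phi>. if multilinear s2 (*) k \<phi> then z (\<lambda>xs. \<phi> (map T xs)) else 0)"

lemma vector_space_mult: "vector_space ((*) :: 'k::field \<Rightarrow> 'k \<Rightarrow> 'k)"
  by standard (auto simp: algebra_simps)

lemma vector_space_tensor: "vector_space (tensor_scale :: 'k::field \<Rightarrow> ('k, 'a) tensor \<Rightarrow> _)"
  by standard (auto simp: tensor_scale_def algebra_simps fun_eq_iff)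

lemma multilinear_compose:
  fixes f :: "'a::ab_group_add list \<Rightarrow> 'b::ab_group_add"
  assumes "multilinear s1 s2 k f" and "Vector_Spaces.linear s2 s3 l"
  shows "multilinear s1 s3 k (\<lambda>xs. l (f xs))"
  unfolding multilinear_def
proof (intro allI impI)
  fix xs :: "'a list" and i assume "length xs = k \<and> i < k"
  then have "Vector_Spaces.linear s1 s2 (\<lambda>v. f (xs[i := v]))"
    using assms(1) by (auto simp: multilinear_def)
  from Vector_Spaces.linear_compose[OF this assms(2)]
  show "Vector_Spaces.linear s1 s3 (\<lambda>v. l (f (xs[i := v])))" by (simp add: o_def)
qed

lemma multilinear_map:
  fixes T :: "'a::ab_group_add \<Rightarrow> 'b::ab_group_add"
  assumes "multilinear s2 s3 k f" and "Vector_Spaces.linear s1 s2 T"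
  shows "multilinear s1 s3 k (\<lambda>xs. f (map T xs))"
  unfolding multilinear_def
proof (intro allI impI)
  fix xs :: "'a list" and i assume "length xs = k \<and> i < k"
  then have "Vector_Spaces.linear s2 s3 (\<lambda>v. f ((map T xs)[i := v]))"
    using assms(1) by (auto simp: multilinear_def)
  from Vector_Spaces.linear_compose[OF assms(2) this]
  show "Vector_Spaces.linear s1 s3 (\<lambda>v. f (map T (xs[i := v])))" by (simp add: o_def map_update)
qed

lemma multilinear_prod:
  fixes l :: "nat \<Rightarrow> 'a::ab_group_add \<Rightarrow> 'k::field"
  assumes "\<And>i. i < k \<Longrightarrow> Vector_Spaces.linear s (*) (l i)"
  shows "multilinear s (*) k (\<lambda>xs. \<Prod>i<k. l i (xs ! i))"
  unfolding multilinear_def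
proof (intro allI impI)
  fix xs :: "'a list" and i assume i: "length xs = k \<and> i < k"
  interpret li: Vector_Spaces.linear s "(*)" "l i" using assms i by blast
  have eq: "(\<Prod>j<k. l j (xs[i := v] ! j)) = l i v * (\<Prod>j\<in>{..<k} - {i}. l j (xs ! j))" for v
  proof -
    have "(\<Prod>j<k. l j (xs[i := v] ! j))
        = l i (xs[i := v] ! i) * (\<Prod>j\<in>{..<k} - {i}. l j (xs[i := v] ! j))"
      using i by (intro prod.remove) auto
    also have "\<dots> = l i v * (\<Prod>j\<in>{..<k} - {i}. l j (xs ! j))"
      using i by (auto intro!: prod.cong)
    finally show ?thesis .
  qed
  show "Vector_Spaces.linear s (*) (\<lambda>v. \<Prod>j<k. l j (xs[i := v] ! j))"
    unfolding eq by unfold_locales (auto simp: li.add li.scale algebra_simps)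
qed

lemma tensor_functional_elem:
  assumes "length xs = k" and "\<And>i. i < k \<Longrightarrow> Vector_Spaces.linear s (*) (l i)"
  shows "tensor_functional k l (elem_tensor s xs) = (\<Prod>i<k. l i (xs ! i))"
  using assms(1) multilinear_prod[OF assms(2)]
  by (auto simp: tensor_functional_def elem_tensor_def)

lemma linear_tensor_functional: "Vector_Spaces.linear tensor_scale (*) (tensor_functional k l)"
  by (intro_locales; (intro vector_space_tensor[unfolded vector_space_def]
        vector_space_mult[unfolded vector_space_def])?; unfold_locales)
    (auto simp: tensor_functional_def tensor_scale_def algebra_simps)

lemma tensor_map_elem:
  assumes "length xs = k" and "Vector_Spaces.linear s1 s2 T"
  shows "tensor_map s2 k T (elem_tensor s1 xs) = elem_tensor s2 (map T xs)"
  using assms(1) multilinear_map[OF _ assms(2)]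
  by (fastforce simp: tensor_map_def elem_tensor_def)

lemma linear_tensor_map: "Vector_Spaces.linear tensor_scale tensor_scale (tensor_map s2 k T)"
  by (intro_locales; (intro vector_space_tensor[unfolded vector_space_def])?; unfold_locales)
    (auto simp: tensor_map_def tensor_scale_def algebra_simps fun_eq_iff)

lemma multilinear_elem_tensor:
  fixes s :: "'k::field \<Rightarrow> 'a::ab_group_add \<Rightarrow> 'a"
  assumes "vector_space s"
  shows "multilinear s tensor_scale k (elem_tensor s)"
  unfolding multilinear_def
proof (intro allI impI)
  fix xs :: "'a list" and i assume i: "length xs = k \<and> i < k"
  interpret vs1: vector_space s by fact
  interpret vs2: vector_space "tensor_scale :: _ \<Rightarrow> (_, _) tensor \<Rightarrow> _" by (rule vector_space_tensor)
  have "\<phi> (xs[i := v + w]) = \<phi> (xs[i := v]) + \<phi> (xs[i := w]) \<and> \<phi> (xs[i := s c v]) = c * \<phi> (xs[i := v])"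
    if "multilinear s (*) k \<phi>" for \<phi> v w c
  proof -
    interpret l: Vector_Spaces.linear s "(*)" "\<lambda>v. \<phi> (xs[i := v])"
      using that i by (auto simp: multilinear_def)
    show ?thesis using l.add l.scale by blast
  qed
  then show "Vector_Spaces.linear s tensor_scale (\<lambda>v. elem_tensor s (xs[i := v]))"
    using i by unfold_locales (auto simp: elem_tensor_def tensor_scale_def fun_eq_iff)
qed

lemma tensor_universal:
  fixes s :: "'k::field \<Rightarrow> 'a::ab_group_add \<Rightarrow> 'a" and sV :: "'k \<Rightarrow> 'v::ab_group_add \<Rightarrow> 'v"
  assumes "vector_space sV" and f: "multilinear s sV k f"
  shows "\<exists>F. Vector_Spaces.linear tensor_scale sV F \<and> (\<forall>xs. length xs = k \<longrightarrow> F (elem_tensor s xs) = f xs)"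
proof -
  interpret vt: vector_space "tensor_scale :: 'k \<Rightarrow> ('k, 'a) tensor \<Rightarrow> _" by (rule vector_space_tensor)
  interpret vV: vector_space sV by fact
  interpret p: vector_space_pair "tensor_scale :: 'k \<Rightarrow> ('k, 'a) tensor \<Rightarrow> _" sV by unfold_locales
  interpret vk: vector_space "(*) :: 'k \<Rightarrow> _" by (rule vector_space_mult)
  interpret q: vector_space_pair sV "(*) :: 'k \<Rightarrow> _" by unfold_locales
  let ?E = "elem_tensor s ` {xs. length xs = k}"
  obtain B where B: "B \<subseteq> ?E" "vt.independent B" "?E \<subseteq> vt.span B"
    using vt.maximal_independent_subset[of ?E] by metis
  have "\<forall>b\<in>B. \<exists>xs. length xs = k \<and> elem_tensor s xs = b" using B(1) by auto
  then obtain h where h: "\<And>b. b \<in> B \<Longrightarrow> length (h b) = k" "\<And>b. b \<in> B \<Longrightarrow> elem_tensor s (h b) = b"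
    by metis
  obtain F where F: "Vector_Spaces.linear tensor_scale sV F" "\<And>b. b \<in> B \<Longrightarrow> F b = f (h b)"
    using p.linear_independent_extend[OF B(2), of "\<lambda>b. f (h b)"] by blast
  interpret F: Vector_Spaces.linear "tensor_scale :: 'k \<Rightarrow> ('k, 'a) tensor \<Rightarrow> _" sV F by fact
  have "F (elem_tensor s xs) = f xs" if xs: "length xs = k" for xs
  proof (rule ccontr)
    assume "F (elem_tensor s xs) \<noteq> f xs"
    then have d: "F (elem_tensor s xs) - f xs \<noteq> 0" (is "?d \<noteq> 0") by simp
    have "vV.independent {?d}" using d by simp
    then obtain l where l: "Vector_Spaces.linear sV (*) l" "l ?d = 1"
      using q.linear_independent_extend[of "{?d}" "\<lambda>_. 1"] by auto
    interpret l: Vector_Spaces.linear sV "(*)" l by fact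
    have m: "multilinear s (*) k (\<lambda>xs. l (f xs))" (is "multilinear _ _ _ ?\<phi>")
      using multilinear_compose[OF f l(1)] .
    have ev: "elem_tensor s ys ?\<phi> = l (f ys)" if "length ys = k" for ys
      using m that by (simp add: elem_tensor_def)
    have "elem_tensor s xs \<in> vt.span B" using B(3) xs by auto
    then obtain A r where A: "finite A" "A \<subseteq> B" "elem_tensor s xs = (\<Sum>b\<in>A. tensor_scale (r b) b)"
      by (auto simp: vt.span_explicit)
    have sum_apply: "(\<Sum>b\<in>A. tensor_scale (r b) b) ?\<phi> = (\<Sum>b\<in>A. r b * b ?\<phi>)"
      using A(1) by (induction A rule: finite_induct) (auto simp: tensor_scale_def)
    have "l (f xs) = (\<Sum>b\<in>A. r b * b ?\<phi>)" using ev[OF xs] A(3) sum_apply by metis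
    also have "\<dots> = (\<Sum>b\<in>A. r b * l (f (h b)))"
      using A(2) h ev by (intro sum.cong refl) (metis subsetD)
    also have "\<dots> = l (F (elem_tensor s xs))"
    proof -
      have "F (elem_tensor s xs) = (\<Sum>b\<in>A. sV (r b) (f (h b)))"
        using A(2,3) F(2) by (auto simp: F.sum F.scale intro!: sum.cong)
      then show ?thesis by (simp add: l.sum l.scale)
    qed
    finally have "l ?d = 0" by (simp add: l.diff)
    then show False using l(2) by simp
  qed
  then show ?thesis using F(1) by blast
qed

definition injective_norm :: "('k::rc_field \<Rightarrow> 'a::banach \<Rightarrow> 'a) \<Rightarrow> nat \<Rightarrow> ('k, 'a) tensor \<Rightarrow> ennreal"
  where "injective_norm s k z =
    (SUP l \<in> {l :: nat \<Rightarrow> 'a \<Rightarrow> 'k. \<forall>i<k. l i \<in> dual_ball s}. ennreal (norm (tensor_functional k l z)))"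

definition projective_norm :: "('k::rc_field \<Rightarrow> 'a::banach \<Rightarrow> 'a) \<Rightarrow> nat \<Rightarrow> ('k, 'a) tensor \<Rightarrow> ennreal"
  where "projective_norm s k z =
    (INF (m, x) \<in> {(m, x :: nat \<Rightarrow> 'a list).
        (\<forall>i<m. length (x i) = k) \<and> z = (\<Sum>i<m. elem_tensor s (x i))}.
      ennreal (\<Sum>i<m. \<Prod>j<k. norm (x i ! j)))"

definition ennreal_root :: "nat \<Rightarrow> ennreal \<Rightarrow> ennreal"
  where "ennreal_root k a = (if a = top then top else ennreal (root k (enn2real a)))"

definition tau ::
  "('k::rc_field \<Rightarrow> 'a::banach \<Rightarrow> 'a) \<Rightarrow> ('k \<Rightarrow> 'b::banach \<Rightarrow> 'b) \<Rightarrow> ('a \<Rightarrow> 'b) \<Rightarrow> nat \<Rightarrow> ennreal"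
  where "tau s1 s2 T k = ennreal_root k
    (SUP z \<in> tensor_power s1 k - {0}. projective_norm s2 k (tensor_map s2 k T z) / injective_norm s1 k z)"

definition tau_infinity ::
  "('k::rc_field \<Rightarrow> 'a::banach \<Rightarrow> 'a) \<Rightarrow> ('k \<Rightarrow> 'b::banach \<Rightarrow> 'b) \<Rightarrow> ('a \<Rightarrow> 'b) \<Rightarrow> ennreal"
  where "tau_infinity s1 s2 T = lim (tau s1 s2 T)"

definition nuclear_representation ::
  "('k::rc_field \<Rightarrow> 'a::banach \<Rightarrow> 'a) \<Rightarrow> ('k \<Rightarrow> 'b::banach \<Rightarrow> 'b) \<Rightarrow> ('a \<Rightarrow> 'b) \<Rightarrow>
    (nat \<Rightarrow> 'a \<Rightarrow> 'k) \<Rightarrow> (nat \<Rightarrow> 'b) \<Rightarrow> bool"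
  where "nuclear_representation s1 s2 T f y \<longleftrightarrow>
    (\<forall>i. f i \<in> dual_space s1) \<and> summable (\<lambda>i. onorm (f i) * norm (y i)) \<and>
    (\<forall>x. (\<lambda>i. s2 (f i x) (y i)) sums T x)"

text \<open>The infimum of the empty set is \<open>top\<close> in \<^typ>\<open>ennreal\<close>.\<close>

definition nuclear_norm ::
  "('k::rc_field \<Rightarrow> 'a::banach \<Rightarrow> 'a) \<Rightarrow> ('k \<Rightarrow> 'b::banach \<Rightarrow> 'b) \<Rightarrow> ('a \<Rightarrow> 'b) \<Rightarrow> ennreal"
  where "nuclear_norm s1 s2 T =
    (INF (f, y) \<in> {(f, y). nuclear_representation s1 s2 T f y}. ennreal (\<Sum>i. onorm (f i) * norm (y i)))"

end

theory Submission
  imports Defs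
begin

text \<open>
  Let \<open>\<gamma>(T)\<close> be the supremum of \<open>\<bar>\<Sum>\<^sub>i g\<^sub>i (T x\<^sub>i)\<bar>\<close> over finite systems of vectors and functionals that are
  weakly 2-summable with constant 1. To see that \<open>\<gamma>(T)\<close> is a lower bound for the limit of
  \<open>\<tau>\<^sub>k(T)\<close>, test on \<open>z = \<Sum>\<^sub>w \<epsilon>\<^sub>w x\<^bsub>w(1)\<^esub> \<otimes> \<dots> \<otimes> x\<^bsub>w(k)\<^esub>\<close> with independent random signs and pair the image with
  the form having the same signs and the \<open>g\<^sub>i\<close>: the mean of the pairing is \<open>(\<Sum>\<^sub>i g\<^sub>i (T x\<^sub>i))\<^sup>k\<close>, while a
  net of fixed mesh \<open>\<rho>\<close> and subgaussian tails bound the mean square of both norms by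
  \<open>O(k) (1 - \<rho>)\<close> to the power \<open>-2k\<close>. The nuclear norm is an upper bound for every \<open>\<tau>\<^sub>k\<close>, by multilinear
  expansion of a representation.

  It remains to bound the nuclear norm by \<open>\<gamma>\<close> when one of the spaces is a Hilbert space. For the
  compressions to the span of a finite orthonormal system this is trace duality (Hahn--Banach).
  Since the squares of the compressed trace norms are superadditive over orthogonal systems, almost
  all of the norm is carried by one finite system, and iterating this splits the operator into
  a nuclear series.
\<close>

section \<open>The scalar field\<close>

text \<open>The mesh \<rho> stays fixed while k grows. A fixed net V gives \<open>card V ^ k\<close>
  test tuples; the logarithm of this number is linear in k, so it costs a factor that the k-th root
  erases. The loss \<open>(1 - \<rho>) ^ (2 * k)\<close> survives the root as the constant
  \<open>(1 - \<rho>)\<^sup>2\<close>, which disappears when \<rho> tends to 0 afterwards. Each sign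
  pattern gets one weight that majorizes the squares of both norms, so the resulting inequality is
  linear in the weight and can be averaged.

  Existence of the limit is not presupposed: a bound C on \<open>tau\<close> for infinitely many k
  already yields a nuclear norm of at most C.

  The obstacle in the last stage is infinite dimension. Trace duality on a finite orthonormal system
  represents a compression only, and the representations for growing systems need not be compatible.
  Hence the differences of consecutive systems are represented separately, and superadditivity makes
  all costs but the first small.\<close>

definition kre :: "'k::rc_field \<Rightarrow> real"
  where "kre x = ((norm (1 + x))\<^sup>2 - 1 - (norm x)\<^sup>2) / 2"

text \<open>Polarization: expanding (1 + x)(1 + \<open>kconj x\<close>) isolates x +
  \<open>kconj x\<close>. Thus \<open>kre\<close> is the real part, obtained from norms alone
  because the class provides no coordinates.\<close>

lemma add_kconj: "x + kconj x = of_real (2 * kre x)" for x :: "'k::rc_field"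
proof -
  have "(1 + x) * (1 + kconj x) = of_real ((norm (1 + x))\<^sup>2)"
    using mult_kconj[of "1 + x"] kconj_of_real[of 1, where 'k='k] by (simp add: kconj_add)
  moreover have "x * kconj x = of_real ((norm x)\<^sup>2)" by (rule mult_kconj)
  ultimately have "x + kconj x = of_real ((norm (1 + x))\<^sup>2 - 1 - (norm x)\<^sup>2)"
    unfolding of_real_diff of_real_1 by (simp add: algebra_simps)
  then show ?thesis by (simp add: kre_def)
qed

lemma kconj_zero [simp]: "kconj (0::'k::rc_field) = 0"
  using kconj_of_real[of 0, where 'k='k] by simp

text \<open>The class assumes only additivity of the conjugation; multiplicativity comes from |xy|^2
  = |x|^2 |y|^2 after cancelling the nonzero factor xy.\<close>

lemma kconj_mult: "kconj (x * y) = kconj x * kconj y" for x :: "'k::rc_field"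
proof (cases "x * y = 0")
  case False
  have "(x * y) * kconj (x * y) = (x * kconj x) * (y * kconj y)"
    by (simp add: mult_kconj norm_mult power_mult_distrib)
  also have "\<dots> = (x * y) * (kconj x * kconj y)" by simp
  finally show ?thesis using False by (metis mult_cancel_left)
qed auto

lemma norm_kconj [simp]: "norm (kconj x) = norm x" for x :: "'k::rc_field"
proof (cases "x = 0")
  case False
  have "norm x * norm (kconj x) = norm x * norm x"
    using arg_cong[OF mult_kconj[of x], of norm]
    by (simp add: norm_mult norm_power power2_eq_square del: of_real_power)
  then show ?thesis using False by simp
qed simp

lemma kre_eqI: "x + kconj x = of_real (2 * r) \<Longrightarrow> kre x = r" for x :: "'k::rc_field"
  unfolding add_kconj of_real_eq_iff by simp

lemma kre_add: "kre (x + y) = kre x + kre y" for x :: "'k::rc_field"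
proof (rule kre_eqI)
  have "x + y + kconj (x + y) = (x + kconj x) + (y + kconj y)" by (simp add: kconj_add)
  then show "x + y + kconj (x + y) = of_real (2 * (kre x + kre y))" by (simp add: add_kconj)
qed

lemma kre_zero [simp]: "kre (0::'k::rc_field) = 0"
  by (simp add: kre_def)

lemma kre_sum: "kre (sum f A) = (\<Sum>a\<in>A. kre (f a :: 'k::rc_field))"
  by (induction A rule: infinite_finite_induct) (auto simp: kre_add)

lemma kre_scale: "kre (of_real r * x) = r * kre x" for x :: "'k::rc_field"
proof (rule kre_eqI)
  have "of_real r * x + kconj (of_real r * x) = of_real r * (x + kconj x)"
    by (simp add: kconj_mult kconj_of_real algebra_simps)
  then show "of_real r * x + kconj (of_real r * x) = of_real (2 * (r * kre x))"
    by (simp add: add_kconj)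
qed

lemma kre_of_real [simp]: "kre (of_real r :: 'k::rc_field) = r"
  by (rule kre_eqI) (simp add: kconj_of_real)

lemma abs_kre_le: "\<bar>kre x\<bar> \<le> norm x" for x :: "'k::rc_field"
proof -
  have "norm (x + kconj x) = 2 * \<bar>kre x\<bar>" unfolding add_kconj by (subst norm_of_real) simp
  then show ?thesis using norm_triangle_ineq[of x "kconj x"] by simp
qed

lemma rotate_to_norm: "\<exists>c. norm c = 1 \<and> c * x = of_real (norm x)" for x :: "'k::rc_field"
proof (cases "x = 0")
  case True
  then show ?thesis by (intro exI[of _ 1]) simp
next
  case False
  have "kconj x / of_real (norm x) * x = of_real (norm x)"
    using mult_kconj[of x] False by (simp add: power2_eq_square mult.commute)
  then show ?thesis using False by (intro exI[of _ "kconj x / of_real (norm x)"]) (simp add: norm_divide)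
qed

text \<open>Taking j = 0 in the real case lets the complexification below treat both fields by one
  construction.\<close>

lemma rc_field_imaginary:
  "\<exists>j::'k::rc_field. (j = 0 \<or> j * j = -1) \<and> kconj j = - j \<and>
     (\<forall>x. \<exists>a b. x = of_real a + of_real b * j)"
  using rc_field_cases[where 'k='k]
proof (elim disjE conjE exE)
  assume "bij (of_real :: real \<Rightarrow> 'k)"
  then have "\<exists>a. x = of_real a" for x :: 'k by (metis bij_pointE)
  then show ?thesis by (intro exI[of _ 0]) simp
next
  fix g :: "complex \<Rightarrow> 'k"
  assume g: "bij g" "\<forall>z w. g (z + w) = g z + g w" "\<forall>z w. g (z * w) = g z * g w"
    "\<forall>r. g (of_real r) = of_real r" "\<forall>z. norm (g z) = norm z" "\<forall>z. g (cnj z) = kconj (g z)"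
  have m: "g (- z) = - g z" for z
  proof -
    have "g (of_real (-1) * z) = of_real (-1) * g z" using g(3,4) by metis
    then show ?thesis by simp
  qed
  have "g \<i> * g \<i> = g (- of_real 1)" using g(3) by (metis i_squared of_real_1)
  also have "\<dots> = -1" using m[of "of_real 1"] g(4)[rule_format, of 1] by simp
  finally have "g \<i> * g \<i> = -1" .
  moreover have "kconj (g \<i>) = - g \<i>" using g(6)[rule_format, of \<i>] m by simp
  moreover have "\<exists>a b. x = of_real a + of_real b * g \<i>" for x
  proof -
    obtain z where z: "x = g z" using g(1) by (metis bij_pointE)
    have "z = of_real (Re z) + of_real (Im z) * \<i>" by (simp add: complex_eq_iff)
    then have "x = of_real (Re z) + of_real (Im z) * g \<i>" using z g(2,3,4) by metis
    then show ?thesis by blast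
  qed
  ultimately show ?thesis by blast
qed

text \<open>The unit ball is a continuous image of the closed unit ball of the reals or of the
  complex plane, hence compact and totally bounded.\<close>

lemma rc_field_finite_net:
  assumes "\<rho> > 0"
  shows "\<exists>G::'k::rc_field set. finite G \<and> (\<forall>x. norm x \<le> 1 \<longrightarrow> (\<exists>y\<in>G. norm (x - y) \<le> \<rho>))"
proof -
  have "compact (cball (0::'k) 1)"
    using rc_field_cases[where 'k='k]
  proof (elim disjE conjE exE)
    assume b: "bij (of_real :: real \<Rightarrow> 'k)"
    have "cball (0::'k) 1 = of_real ` cball 0 1"
    proof (intro equalityI subsetI)
      fix x :: 'k assume x: "x \<in> cball 0 1"
      obtain r where "x = of_real r" using b by (metis bij_pointE)
      then show "x \<in> of_real ` cball 0 1" using x by auto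
    qed auto
    then show ?thesis by (simp add: compact_continuous_image continuous_intros)
  next
    fix g :: "complex \<Rightarrow> 'k"
    assume g: "bij g" "\<forall>z w. g (z + w) = g z + g w" "\<forall>z. norm (g z) = norm z"
    have "g z = g (z - w) + g w" for z w by (simp flip: g(2)[rule_format])
    then have d: "dist (g z) (g w) = dist z w" for z w
      using g(3) by (metis dist_norm add_diff_cancel_right')
    have "continuous_on (cball 0 1) g"
      unfolding continuous_on_iff d by blast
    moreover have "cball (0::'k) 1 = g ` cball 0 1"
    proof (intro equalityI subsetI)
      fix x :: 'k assume x: "x \<in> cball 0 1"
      obtain r where "x = g r" using g(1) by (metis bij_pointE)
      then show "x \<in> g ` cball 0 1" using x g(3) by auto
    qed (use g(3) in auto)
    ultimately show ?thesis by (simp add: compact_continuous_image)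
  qed
  then obtain G where G: "finite G" "cball (0::'k) 1 \<subseteq> (\<Union>x\<in>G. ball x \<rho>)"
    using assms by (metis compact_eq_totally_bounded)
  show ?thesis
  proof (intro exI conjI allI impI)
    show "finite G" by fact
    fix x :: 'k assume "norm x \<le> 1"
    then have "x \<in> cball 0 1" by simp
    then obtain y where "y \<in> G" "x \<in> ball y \<rho>" using G(2) by blast
    then show "\<exists>y\<in>G. norm (x - y) \<le> \<rho>"
      by (intro bexI[of _ y]) (auto simp: dist_norm norm_minus_commute)
  qed
qed

section \<open>The Hahn--Banach theorem\<close>

text \<open>Real scaling is a parameter because the extension theorem is applied to spaces of
  vector-valued functions whose scaling is itself passed as a term.\<close>

locale rs_space =
  fixes rs :: "real \<Rightarrow> 'v::ab_group_add \<Rightarrow> 'v"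
  assumes rs_right: "rs r (x + y) = rs r x + rs r y"
    and rs_left: "rs (r + t) x = rs r x + rs t x"
    and rs_assoc: "rs r (rs t x) = rs (r * t) x"
    and rs_one [simp]: "rs 1 x = x"
begin

lemma rs_zero [simp]: "rs r 0 = 0" "rs 0 x = 0"
  using rs_right[of r 0 0] rs_left[of 0 0 x] by auto

lemma rs_minus: "rs r (- x) = - rs r x"
  using rs_right[of r x "- x"] by (simp add: eq_neg_iff_add_eq_0 add.commute)

lemma rs_minus_one [simp]: "rs (- r) x = - rs r x"
  using rs_left[of r "- r" x] by (simp add: eq_neg_iff_add_eq_0 add.commute)

definition sublin :: "('v \<Rightarrow> real) \<Rightarrow> bool"
  where "sublin q \<longleftrightarrow> (\<forall>x y. q (x + y) \<le> q x + q y) \<and> (\<forall>t x. t \<ge> 0 \<longrightarrow> q (rs t x) = t * q x)"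

lemma sublin_0: "sublin q \<Longrightarrow> q 0 = 0"
  using rs_zero(2)[of 0] unfolding sublin_def by (metis mult_zero_left order_refl)

lemma sublin_minus: "sublin q \<Longrightarrow> - q (- x) \<le> q x"
proof -
  assume q: "sublin q"
  then have "q (x + - x) \<le> q x + q (- x)" unfolding sublin_def by blast
  then show ?thesis using sublin_0[OF q] by simp
qed

lemma sublinI_mono:
  assumes "\<And>x y. q (x + y) \<le> q x + q y" and "\<And>t x. t > 0 \<Longrightarrow> q (rs t x) \<le> t * q x" and "q 0 = 0"
  shows "sublin q"
  unfolding sublin_def
proof (intro conjI allI impI)
  fix t :: real and x assume "t \<ge> 0"
  show "q (rs t x) = t * q x"
  proof (cases "t = 0")
    case False
    then have "q (rs (1/t) (rs t x)) \<le> (1/t) * q (rs t x)" using \<open>t \<ge> 0\<close> by (intro assms) auto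
    then have "t * q x \<le> q (rs t x)" using False \<open>t \<ge> 0\<close> by (simp add: rs_assoc field_simps)
    then show ?thesis using assms(2)[of t x] False \<open>t \<ge> 0\<close> by simp
  qed (use assms in simp)
qed (use assms in auto)

text \<open>The infimal convolution of q with g over W lies below q everywhere and below g on W; the
  assumption \<open>- q (- w) \<le> g w\<close> keeps it bounded from below. Only positive multiples
  have to stay in W, so W may be a ray as well as a subspace.\<close>

lemma infimal_sublin:
  assumes q: "sublin q" and W0: "0 \<in> W" and Wa: "\<And>v w. v \<in> W \<Longrightarrow> w \<in> W \<Longrightarrow> v + w \<in> W"
    and Ws: "\<And>t w. t > 0 \<Longrightarrow> w \<in> W \<Longrightarrow> rs t w \<in> W"
    and g: "\<And>w. w \<in> W \<Longrightarrow> - q (- w) \<le> g w" and ga: "\<And>v w. v \<in> W \<Longrightarrow> w \<in> W \<Longrightarrow> g (v + w) = g v + g w"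
    and gs: "\<And>t w. t > 0 \<Longrightarrow> w \<in> W \<Longrightarrow> g (rs t w) = t * g w"
  defines "h \<equiv> \<lambda>x. INF w\<in>W. q (x - w) + g w"
  shows "sublin h" "h x \<le> q x" "w \<in> W \<Longrightarrow> h x \<le> q (x - w) + g w"
proof -
  have g0: "g 0 = 0" using ga[OF W0 W0] by simp
  have bdd: "bdd_below ((\<lambda>w. q (x - w) + g w) ` W)" for x
  proof (intro bdd_belowI2)
    fix w assume w: "w \<in> W"
    have "q ((x - w) + - x) \<le> q (x - w) + q (- x)" using q unfolding sublin_def by blast
    then have "q (- w) \<le> q (x - w) + q (- x)" by simp
    then show "- q (- x) \<le> q (x - w) + g w" using g[OF w] by simp
  qed
  show le: "h x \<le> q (x - w) + g w" if "w \<in> W" for x w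
    unfolding h_def using bdd that by (intro cINF_lower) auto
  show hq: "h x \<le> q x" for x using le[OF W0, of x] g0 by simp
  have ge: "c \<le> h x" if "\<And>w. w \<in> W \<Longrightarrow> c \<le> q (x - w) + g w" for c x
    unfolding h_def using W0 that by (intro cINF_greatest) auto
  show "sublin h"
  proof (rule sublinI_mono)
    fix x y
    have *: "h (x + y) \<le> (q (x - v) + g v) + (q (y - w) + g w)" if "v \<in> W" "w \<in> W" for v w
    proof -
      have "h (x + y) \<le> q ((x + y) - (v + w)) + g (v + w)" using that Wa by (intro le) auto
      also have "q ((x + y) - (v + w)) \<le> q (x - v) + q (y - w)"
        using q unfolding sublin_def by (metis add_diff_add)
      finally show ?thesis using ga that by simp
    qed
    have "h (x + y) - h y \<le> h x"
    proof (rule ge)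
      fix v assume v: "v \<in> W"
      have "h (x + y) - (q (x - v) + g v) \<le> h y"
      proof (rule ge)
        fix w assume "w \<in> W"
        then show "h (x + y) - (q (x - v) + g v) \<le> q (y - w) + g w" using *[OF v, of w] by simp
      qed
      then show "h (x + y) - h y \<le> q (x - v) + g v" by simp
    qed
    then show "h (x + y) \<le> h x + h y" by simp
  next
    fix t :: real and x assume t: "t > 0"
    have "h (rs t x) / t \<le> h x"
    proof (rule ge)
      fix w assume w: "w \<in> W"
      have "h (rs t x) \<le> q (rs t x - rs t w) + g (rs t w)" using w Ws t by (intro le) auto
      also have "rs t x - rs t w = rs t (x - w)" using rs_right[of t x "- w"] by (simp add: rs_minus)
      also have "q (rs t (x - w)) = t * q (x - w)" using q t unfolding sublin_def by simp
      finally have "h (rs t x) \<le> (q (x - w) + g w) * t" using gs[OF t w] by (simp add: algebra_simps)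
      then show "h (rs t x) / t \<le> q (x - w) + g w" using t by (simp add: divide_le_eq)
    qed
    then show "h (rs t x) \<le> t * h x" using t by (simp add: divide_le_eq mult.commute)
  next
    have "0 \<le> h 0"
    proof (rule ge)
      fix w assume "w \<in> W" then show "0 \<le> q (0 - w) + g w" using g[of w] by simp
    qed
    then show "h 0 = 0" using hq[of 0] sublin_0[OF q] by simp
  qed
qed

text \<open>Lowering q along the ray through \<open>- y\<close> gives a sublinear functional below
  q, which by minimality is q itself. Its defining bound then reads q(x) \<le> q(x + y) - q(y), the
  converse of subadditivity.\<close>

lemma minimal_sublin_linear:
  assumes q: "sublin q" and min: "\<And>h. sublin h \<Longrightarrow> h \<le> q \<Longrightarrow> h = q"
  shows "q (x + y) = q x + q y" "q (rs t x) = t * q x"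
proof -
  have add: "q (x + y) = q x + q y" for x y
  proof -
    define W where "W = {rs t (- y) |t. t \<ge> 0}"
    have WE: thesis if "w \<in> W" "\<And>t. t \<ge> 0 \<Longrightarrow> w = rs t (- y) \<Longrightarrow> thesis" for w thesis
      using that unfolding W_def by auto
    define g where "g w = - q (- w)" for w
    have qrs: "q (rs t v) = t * q v" if "t \<ge> 0" for t v using q that unfolding sublin_def by auto
    have gW: "g (rs t (- y)) = - t * q y" if "t \<ge> 0" for t
      unfolding g_def using qrs[OF that, of y] by (simp add: rs_minus)
    define h where "h = (\<lambda>x. INF w\<in>W. q (x - w) + g w)"
    have h: "sublin h" "h \<le> q" "h x \<le> q (x - (- y)) + g (- y)"
    proof -
      have a1: "0 \<in> W" unfolding W_def by (intro CollectI exI[of _ 0]) simp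
      have a2: "v + w \<in> W" if vw: "v \<in> W" "w \<in> W" for v w
      proof -
        obtain a where a: "a \<ge> 0" "v = rs a (- y)" by (rule WE[OF vw(1)])
        obtain b where b: "b \<ge> 0" "w = rs b (- y)" by (rule WE[OF vw(2)])
        show ?thesis unfolding W_def using a b rs_left[of a b "- y"]
          by (intro CollectI exI[of _ "a + b"]) auto
      qed
      have a3: "rs t w \<in> W" if vw: "t > 0" "w \<in> W" for t w
      proof -
        obtain a where "a \<ge> 0" "w = rs a (- y)" by (rule WE[OF vw(2)])
        then show ?thesis unfolding W_def using vw rs_assoc[of t a "- y"]
          by (intro CollectI exI[of _ "t * a"]) auto
      qed
      have a4: "g (v + w) = g v + g w" if vw: "v \<in> W" "w \<in> W" for v w
      proof -
        obtain a where a: "a \<ge> 0" "v = rs a (- y)" by (rule WE[OF vw(1)])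
        obtain b where b: "b \<ge> 0" "w = rs b (- y)" by (rule WE[OF vw(2)])
        have "g (v + w) = g (rs (a + b) (- y))" by (simp only: a b rs_left)
        also have "\<dots> = - (a + b) * q y" using a b by (intro gW) simp
        also have "\<dots> = g v + g w" unfolding a b gW[OF a(1)] gW[OF b(1)] by (simp add: algebra_simps)
        finally show ?thesis .
      qed
      have a5: "g (rs t w) = t * g w" if vw: "t > 0" "w \<in> W" for t w
      proof -
        obtain a where a: "a \<ge> 0" "w = rs a (- y)" by (rule WE[OF vw(2)])
        have "g (rs t w) = g (rs (t * a) (- y))" by (simp only: a rs_assoc)
        also have "\<dots> = - (t * a) * q y" using a vw by (intro gW) simp
        also have "\<dots> = t * g w" unfolding a gW[OF a(1)] by simp
        finally show ?thesis .
      qed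
      have mem: "- y \<in> W" unfolding W_def using rs_one[of "- y"] by (intro CollectI exI[of _ 1]) auto
      note L = infimal_sublin[of q W g, OF q a1 a2 a3 _ a4 a5, folded h_def, folded fun_cong[OF h_def]]
      show "sublin h" by (rule L(1)) (auto simp: g_def)
      show "h \<le> q" by (rule le_funI, rule L(2)) (auto simp: g_def)
      show "h x \<le> q (x - (- y)) + g (- y)" by (rule L(3)) (auto simp: g_def mem)
    qed
    then have "h = q" using min by blast
    then have "q x \<le> q (x + y) - q y" using h(3) by (simp add: g_def)
    moreover have "q (x + y) \<le> q x + q y" using q unfolding sublin_def by blast
    ultimately show ?thesis by simp
  qed
  then show "q (x + y) = q x + q y" .
  have "q (- z) = - q z" for z using add[of z "- z"] sublin_0[OF q] by simp
  moreover have "q (rs \<bar>t\<bar> x) = \<bar>t\<bar> * q x" using q unfolding sublin_def by simp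
  ultimately show "q (rs t x) = t * q x"
    by (cases "t \<ge> 0") (auto simp: abs_if not_le)
qed

text \<open>Zorn's lemma for the reversed order. A nonempty chain is bounded by its pointwise
  infimum; this is finite since every member satisfies \<open>- p (- x) \<le> q x\<close>, and
  subadditive since two members always have a common smaller one.\<close>

lemma exists_minimal_sublin:
  assumes p: "sublin p"
  obtains q where "sublin q" "q \<le> p" "\<And>h. sublin h \<Longrightarrow> h \<le> q \<Longrightarrow> h = q"
proof -
  define A where "A = {q. sublin q \<and> q \<le> p}"
  have "\<exists>m\<in>A. \<forall>a\<in>A. a \<le> m \<longrightarrow> a = m"
  proof (rule predicate_Zorn[of A "\<lambda>a b. b \<le> a"])
    show "partial_order_on A (relation_of (\<lambda>a b. b \<le> a) A)"
      by (rule partial_order_on_relation_ofI) auto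
  next
    fix C assume C: "C \<in> Chains (relation_of (\<lambda>a b. b \<le> a) A)"
    then have sub: "q \<in> A" if "q \<in> C" for q
      using that by (auto simp: Chains_def relation_of_def)
    have tot: "a \<le> b \<or> b \<le> a" if "a \<in> C" "b \<in> C" for a b
      using that C by (auto simp: Chains_def relation_of_def)
    show "\<exists>u\<in>A. \<forall>a\<in>C. u \<le> a"
    proof (cases "C = {}")
      case True
      then show ?thesis using p A_def by auto
    next
      case False
      define u where "u = (\<lambda>x. INF q\<in>C. q x)"
      have lb: "- p (- x) \<le> q x" if "q \<in> C" for q x
        using sublin_minus[of q x] sub[OF that] unfolding A_def le_fun_def
        by (smt (verit) mem_Collect_eq)
      have ule: "u x \<le> q x" if "q \<in> C" for q x
        unfolding u_def using that lb by (intro cINF_lower bdd_belowI2) auto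
      have uge: "c \<le> u x" if "\<And>q. q \<in> C \<Longrightarrow> c \<le> q x" for c x
        unfolding u_def using that False by (intro cINF_greatest) auto
      have "sublin u"
      proof (rule sublinI_mono)
        fix x y
        have *: "u (x + y) \<le> a x + b y" if ab: "a \<in> C" "b \<in> C" for a b
        proof -
          obtain m where m: "m \<in> C" "m \<le> a" "m \<le> b" using tot[OF ab] ab by blast
          have "u (x + y) \<le> m (x + y)" using ule m by blast
          also have "\<dots> \<le> m x + m y" using sub[OF m(1)] unfolding A_def sublin_def by blast
          also have "\<dots> \<le> a x + b y" using m by (intro add_mono) (auto simp: le_fun_def)
          finally show ?thesis .
        qed
        have "u (x + y) - u y \<le> u x"
        proof (rule uge)
          fix a assume a: "a \<in> C"
          have "u (x + y) - a x \<le> u y"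
          proof (rule uge)
            fix b assume "b \<in> C"
            then show "u (x + y) - a x \<le> b y" using *[OF a, of b] by simp
          qed
          then show "u (x + y) - u y \<le> a x" by simp
        qed
        then show "u (x + y) \<le> u x + u y" by simp
      next
        fix t :: real and x assume t: "t > 0"
        have "u (rs t x) / t \<le> u x"
        proof (rule uge)
          fix a assume a: "a \<in> C"
          have "u (rs t x) \<le> a (rs t x)" using ule a by blast
          also have "\<dots> = t * a x" using sub[OF a] t unfolding A_def sublin_def by simp
          finally show "u (rs t x) / t \<le> a x" using t by (simp add: divide_le_eq mult.commute)
        qed
        then show "u (rs t x) \<le> t * u x" using t by (simp add: divide_le_eq mult.commute)
      next
        have z: "q 0 = 0" if "q \<in> C" for q using sub[OF that] sublin_0 unfolding A_def by blast
        obtain q where "q \<in> C" using False by blast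
        then show "u 0 = 0" using ule[of q 0] uge[of 0 0] z by fastforce
      qed
      moreover have "u \<le> p"
      proof (rule le_funI)
        fix x
        obtain q where "q \<in> C" using False by blast
        then show "u x \<le> p x" using ule[of q x] sub[of q] unfolding A_def le_fun_def
          by (metis (mono_tags, lifting) mem_Collect_eq order_trans)
      qed
      ultimately show ?thesis using ule unfolding A_def by (intro bexI[of _ u]) (auto simp: le_fun_def)
    qed
  qed
  then obtain m where "m \<in> A" "\<And>a. a \<in> A \<Longrightarrow> a \<le> m \<Longrightarrow> a = m" by blast
  then show ?thesis using that[of m] unfolding A_def by (metis (mono_tags, lifting) mem_Collect_eq order_trans)
qed

lemma hahn_banach_real:
  assumes p: "sublin p" and W0: "0 \<in> W" and Wa: "\<And>v w. v \<in> W \<Longrightarrow> w \<in> W \<Longrightarrow> v + w \<in> W"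
    and Ws: "\<And>t w. w \<in> W \<Longrightarrow> rs t w \<in> W"
    and g: "\<And>w. w \<in> W \<Longrightarrow> g w \<le> p w" and ga: "\<And>v w. v \<in> W \<Longrightarrow> w \<in> W \<Longrightarrow> g (v + w) = g v + g w"
    and gs: "\<And>t w. w \<in> W \<Longrightarrow> g (rs t w) = t * g w"
  obtains F where "\<And>x y. F (x + y) = F x + F y" "\<And>t x. F (rs t x) = t * F x"
    "\<And>w. w \<in> W \<Longrightarrow> F w = g w" "\<And>x. F x \<le> p x"
proof -
  have Wm: "- w \<in> W" if "w \<in> W" for w using Ws[OF that, of "-1"] by simp
  have gm: "g (- w) = - g w" if "w \<in> W" for w using gs[OF that, of "-1"] by simp
  have glow: "- p (- w) \<le> g w" if "w \<in> W" for w using g[OF Wm[OF that]] gm[OF that] by simp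
  define h where "h = (\<lambda>x. INF w\<in>W. p (x - w) + g w)"
  have Ws': "rs t w \<in> W" and gs': "g (rs t w) = t * g w" if "t > 0" "w \<in> W" for t w
    using Ws gs that by auto
  note L = infimal_sublin[of p W g, OF p W0 Wa Ws' glow ga gs', folded h_def, folded fun_cong[OF h_def]]
  have h: "sublin h" by (rule L(1))
  have hp: "h x \<le> p x" for x by (rule L(2))
  have hg: "h w \<le> g w" if "w \<in> W" for w
    using L(3)[of w w] that sublin_0[OF p] by simp
  obtain F where F: "sublin F" "F \<le> h" "\<And>k. sublin k \<Longrightarrow> k \<le> F \<Longrightarrow> k = F"
    using exists_minimal_sublin[OF h] by blast
  have lin: "F (x + y) = F x + F y" "F (rs t x) = t * F x" for x y t
    using minimal_sublin_linear[OF F(1,3)] by blast+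
  have le: "F w \<le> g w" if "w \<in> W" for w using F(2) hg[OF that] unfolding le_fun_def by (meson order_trans)
  \<comment> \<open>F is linear and F \<le> g on W; applying the inequality to \<open>- w\<close> as
    well turns it into an equality.\<close>
  have "F w = g w" if "w \<in> W" for w
    using le[OF that] le[OF Wm[OF that]] gm[OF that] lin(2)[of "-1" w] by simp
  moreover have "F x \<le> p x" for x using F(2) hp unfolding le_fun_def by (meson order_trans)
  ultimately show ?thesis using that lin by blast
qed

end

theorem hahn_banach:
  fixes s :: "'k::rc_field \<Rightarrow> 'v::ab_group_add \<Rightarrow> 'v" and p :: "'v \<Rightarrow> real"
  assumes s: "vector_space s"
    and p_add: "\<And>x y. p (x + y) \<le> p x + p y" and p_scale: "\<And>c x. p (s c x) = norm c * p x"
    and W: "module.subspace s W"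
    and f_add: "\<And>x y. x \<in> W \<Longrightarrow> y \<in> W \<Longrightarrow> f (x + y) = f x + f y"
    and f_scale: "\<And>c x. x \<in> W \<Longrightarrow> f (s c x) = c * f x"
    and f_le: "\<And>x. x \<in> W \<Longrightarrow> norm (f x) \<le> p x"
  obtains F where "Vector_Spaces.linear s (*) F" "\<And>x. x \<in> W \<Longrightarrow> F x = f x" "\<And>x. norm (F x) \<le> p x"
proof -
  interpret s: vector_space s by fact
  define rs where "rs r x = s (of_real r) x" for r x
  interpret rs: rs_space rs
    by unfold_locales (auto simp: rs_def s.scale_right_distrib s.scale_left_distrib)
  have sub: "rs.sublin p" unfolding rs.sublin_def by (auto simp: p_add rs_def p_scale)
  obtain G where G: "\<And>x y. G (x + y) = G x + G y" "\<And>t x. G (rs t x) = t * G x"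
    "\<And>w. w \<in> W \<Longrightarrow> G w = kre (f w)" "\<And>x. G x \<le> p x"
  proof (rule rs.hahn_banach_real[of p W "\<lambda>x. kre (f x)", OF sub])
    show "kre (f w) \<le> p w" if "w \<in> W" for w
      using f_le[OF that] abs_kre_le[of "f w"] by simp
    show "kre (f (v + w)) = kre (f v) + kre (f w)" if "v \<in> W" "w \<in> W" for v w
      using f_add[OF that] by (simp add: kre_add)
    show "kre (f (rs t w)) = t * kre (f w)" if "w \<in> W" for t w
      using f_scale[OF that] by (simp add: rs_def kre_scale)
  qed (use W in \<open>auto simp: s.subspace_def rs_def\<close>)
  obtain j :: 'k where j: "j = 0 \<or> j * j = -1" "kconj j = - j" "\<And>x. \<exists>a b. x = of_real a + of_real b * j"
    using rc_field_imaginary by metis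
  \<comment> \<open>The usual recovery of a functional from its real part G. For j = 0 the second
    term vanishes and F is G viewed in the field.\<close>
  define F where "F x = of_real (G x) - j * of_real (G (s j x))" for x
  have F_add: "F (x + y) = F x + F y" for x y
    by (simp add: F_def G(1) s.scale_right_distrib algebra_simps)
  have F_real: "F (s (of_real t) x) = of_real t * F x" for t x
  proof -
    have "s j (s (of_real t) x) = rs t (s j x)" by (simp add: rs_def mult.commute)
    then show ?thesis using G(2)[of t x] G(2)[of t "s j x"] by (simp add: F_def rs_def algebra_simps)
  qed
  have Gm: "G (- x) = - G x" for x using G(2)[of "-1" x] by simp
  have G0: "G 0 = 0" using G(1)[of 0 0] by simp
  have F_j: "F (s j x) = j * F x" for x
  proof (cases "j = 0")
    case False
    then have jj: "j * j = -1" using j(1) by blast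
    have "j * F x = j * of_real (G x) - (j * j) * of_real (G (s j x))"
      unfolding F_def by (simp only: right_diff_distrib mult.assoc)
    moreover have "F (s j x) = of_real (G (s j x)) - j * of_real (G (- x))"
      by (simp add: F_def jj)
    ultimately show ?thesis by (simp add: jj Gm)
  qed (simp add: F_def G0)
  have F_scale: "F (s c x) = c * F x" for c x
  proof -
    obtain a b where c: "c = of_real a + of_real b * j" using j(3) by blast
    have "s c x = s (of_real a) x + s (of_real b) (s j x)" by (simp add: c s.scale_left_distrib)
    then show ?thesis by (simp only: F_add F_real F_j) (simp add: c algebra_simps)
  qed
  have kj: "kre (j * of_real r) = 0" for r
    by (rule kre_eqI) (simp add: kconj_mult kconj_of_real j(2))
  have kF: "kre (F x) = G x" for x
  proof -
    have "F x = of_real (G x) + j * of_real (- G (s j x))" by (simp add: F_def)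
    then show ?thesis by (simp only: kre_add kj kre_of_real add_0_right)
  qed
  have "F x = f x" if x: "x \<in> W" for x
  proof -
    have jx: "s j x \<in> W" using W x by (simp add: s.subspace_scale)
    obtain a b where c: "f x = of_real a + of_real b * j" using j(3) by blast
    have a: "kre (f x) = a" unfolding c using kj[of b] by (simp add: kre_add mult.commute)
    have F: "F x = of_real a - j * of_real (kre (j * f x))"
      unfolding F_def G(3)[OF x] G(3)[OF jx] f_scale[OF x] a ..
    show ?thesis
    proof (cases "j = 0")
      case False
      then have jj: "j * j = -1" using j(1) by blast
      have "j * f x = j * of_real a + (j * j) * of_real b"
        unfolding c by (simp only: distrib_left mult.assoc mult.commute[of "of_real b" j])
      also have "(j * j) * of_real b = of_real (- b)" by (simp add: jj)
      finally have "kre (j * f x) = - b" by (simp only: kre_add kj kre_of_real add_0_left)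
      then show ?thesis by (simp add: F c)
    qed (simp add: F c)
  qed
  moreover have "norm (F x) \<le> p x" for x
  proof -
    obtain c where c: "norm c = 1" "c * F x = of_real (norm (F x))" using rotate_to_norm by blast
    have "norm (F x) = kre (F (s c x))" by (simp add: F_scale c)
    also have "\<dots> \<le> p (s c x)" by (simp add: kF G(4))
    finally show ?thesis by (simp add: p_scale c(1))
  qed
  moreover have "Vector_Spaces.linear s (*) F"
    unfolding Vector_Spaces.linear_iff using F_add F_scale s vector_space_mult by blast
  ultimately show ?thesis using that by blast
qed

section \<open>Finite nets of Euclidean balls\<close>

abbreviation l2 :: "'i set \<Rightarrow> ('i \<Rightarrow> 'k::real_normed_vector) \<Rightarrow> real"
  where "l2 D c \<equiv> L2_set (\<lambda>i. norm (c i)) D"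

lemma l2_triangle: "l2 D (\<lambda>i. u i + v i) \<le> l2 D u + l2 D v"
proof -
  have "l2 D (\<lambda>i. u i + v i) \<le> L2_set (\<lambda>i. norm (u i) + norm (v i)) D"
    by (intro L2_set_mono norm_triangle_ineq norm_ge_zero)
  also have "\<dots> \<le> l2 D u + l2 D v" by (rule L2_set_triangle_ineq)
  finally show ?thesis .
qed

lemma l2_scale: "l2 D (\<lambda>i. c * u i) = norm c * l2 D u" for c :: "'k::real_normed_field"
  by (simp add: norm_mult L2_set_right_distrib)

lemma l2_power2: "(l2 D c)\<^sup>2 = (\<Sum>i\<in>D. (norm (c i))\<^sup>2)"
  by (simp add: L2_set_def sum_nonneg)

lemma norm_sum_mult_le: "norm (\<Sum>i\<in>D. c i * u i) \<le> l2 D c * l2 D u" for c :: "'i \<Rightarrow> 'k::real_normed_field"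
proof -
  have "norm (\<Sum>i\<in>D. c i * u i) \<le> (\<Sum>i\<in>D. norm (c i * u i))" by (rule norm_sum)
  also have "\<dots> = (\<Sum>i\<in>D. \<bar>norm (c i)\<bar> * \<bar>norm (u i)\<bar>)" by (simp add: norm_mult)
  also have "\<dots> \<le> l2 D c * l2 D u" by (rule L2_set_mult_ineq)
  finally show ?thesis .
qed

lemma l2_dual:
  fixes c :: "'i \<Rightarrow> 'k::rc_field"
  shows "\<exists>u. l2 D u \<le> 1 \<and> (\<Sum>i\<in>D. c i * u i) = of_real (l2 D c)"
proof (cases "l2 D c = 0")
  case True
  then show ?thesis by (intro exI[of _ "\<lambda>_. 0"]) (simp add: L2_set_def)
next
  case False
  let ?s = "l2 D c"
  define u where "u i = of_real (1 / ?s) * kconj (c i)" for i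
  have "l2 D u = 1" unfolding u_def l2_scale using False by (simp add: norm_divide)
  moreover have "(\<Sum>i\<in>D. c i * u i) = of_real ?s"
  proof -
    have "c i * u i = of_real (1 / ?s) * (c i * kconj (c i))" for i
      by (simp add: u_def)
    then have "(\<Sum>i\<in>D. c i * u i) = of_real (1 / ?s) * (\<Sum>i\<in>D. of_real ((norm (c i))\<^sup>2))"
      by (simp only: mult_kconj sum_distrib_left)
    also have "\<dots> = of_real (1 / ?s * ?s\<^sup>2)"
      by (simp only: l2_power2 of_real_sum of_real_mult)
    finally show ?thesis using False by (simp add: power2_eq_square)
  qed
  ultimately show ?thesis using False by (intro exI[of _ u]) simp
qed

text \<open>The net points must lie in the ball themselves: in the tail estimate they are the
  coefficient vectors whose squares sum to at most 1. Only the coordinates in D matter.\<close>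

definition l2_net :: "real \<Rightarrow> 'i set \<Rightarrow> ('i \<Rightarrow> 'k::rc_field) set \<Rightarrow> bool"
  where "l2_net \<rho> D V \<longleftrightarrow> finite V \<and> V \<noteq> {} \<and> (\<forall>v\<in>V. l2 D v \<le> 1) \<and>
    (\<forall>u. l2 D u \<le> 1 \<longrightarrow> (\<exists>v\<in>V. l2 D (\<lambda>i. u i - v i) \<le> \<rho>))"

text \<open>Approximating coordinatewise from a finite net of the scalar ball may leave the
  Euclidean ball. Every grid point within \<rho>/2 of some ball vector is therefore replaced by such
  a vector, at the price of another \<rho>/2.\<close>

lemma l2_net_exists:
  assumes D: "finite D" and \<rho>: "\<rho> > 0"
  shows "\<exists>V :: ('i \<Rightarrow> 'k::rc_field) set. l2_net \<rho> D V"
proof -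
  \<comment> \<open>The sum of \<open>card D\<close> coordinate errors of size \<sigma> stays below
    \<rho>/2; the summand 1 avoids division by zero for empty D.\<close>
  define \<sigma> where "\<sigma> = \<rho> / (2 * (real (card D) + 1))"
  have "\<sigma> > 0" using \<rho> by (simp add: \<sigma>_def)
  then obtain G :: "'k set" where G: "finite G" "\<And>x. norm x \<le> 1 \<Longrightarrow> \<exists>y\<in>G. norm (x - y) \<le> \<sigma>"
    using rc_field_finite_net by metis
  define near where "near g v \<longleftrightarrow> l2 D v \<le> 1 \<and> l2 D (\<lambda>i. v i - g i) \<le> \<rho> / 2" for g v :: "'i \<Rightarrow> 'k"
  define V where "V = insert (\<lambda>_. 0) ((\<lambda>g. SOME v. near g v) ` {g \<in> PiE D (\<lambda>_. G). \<exists>v. near g v})"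
  have "finite (PiE D (\<lambda>_. G))" using D G(1) by (intro finite_PiE) auto
  then have "finite V" by (simp add: V_def)
  moreover have "l2 D v \<le> 1" if "v \<in> V" for v
  proof -
    have "near g (SOME v. near g v)" if "near g w" for g w using someI[of "near g"] that by blast
    then show ?thesis using that by (auto simp: V_def near_def L2_set_def)
  qed
  moreover have "\<exists>v\<in>V. l2 D (\<lambda>i. u i - v i) \<le> \<rho>" if u: "l2 D u \<le> 1" for u
  proof -
    have "norm (u i) \<le> 1" if "i \<in> D" for i
      using member_le_L2_set[OF D that, of "\<lambda>i. norm (u i)"] u by simp
    then have "\<forall>i\<in>D. \<exists>y\<in>G. norm (u i - y) \<le> \<sigma>" using G(2) by blast
    then obtain h where h: "\<And>i. i \<in> D \<Longrightarrow> h i \<in> G \<and> norm (u i - h i) \<le> \<sigma>" by metis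
    define g where "g = restrict h D"
    have "l2 D (\<lambda>i. u i - g i) \<le> (\<Sum>i\<in>D. norm (u i - g i))" by (rule L2_set_le_sum) simp
    also have "\<dots> \<le> (\<Sum>i\<in>D. \<sigma>)" using h by (intro sum_mono) (simp add: g_def)
    also have "\<dots> \<le> (card D + 1) * \<sigma>" using \<open>\<sigma> > 0\<close> by (simp add: algebra_simps)
    also have "\<dots> = \<rho> / 2" by (simp add: \<sigma>_def field_simps)
    finally have g: "near g u" using u by (simp add: near_def)
    then have n: "near g (SOME v. near g v)" (is "near g ?v") using someI[of "near g"] by blast
    have "g \<in> PiE D (\<lambda>_. G)" using h by (auto simp: g_def)
    then have "?v \<in> V" using g by (auto simp: V_def)
    moreover have "l2 D (\<lambda>i. u i - ?v i) \<le> l2 D (\<lambda>i. u i - g i) + l2 D (\<lambda>i. g i - ?v i)"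
      using l2_triangle[of "\<lambda>i. u i - g i" "\<lambda>i. g i - ?v i" D] by simp
    moreover have "l2 D (\<lambda>i. g i - ?v i) = l2 D (\<lambda>i. ?v i - g i)" by (simp only: norm_minus_commute)
    ultimately show ?thesis using g n by (intro bexI[of _ ?v]) (auto simp: near_def)
  qed
  ultimately have "l2_net \<rho> D V" unfolding l2_net_def by (auto simp: V_def)
  then show ?thesis ..
qed

text \<open>A net point within \<rho> of the norming vector of c loses at most \<rho> times the norm
  of c. What becomes large is the real part, not just the modulus, and the exponential moments need
  this.\<close>

lemma l2_net_functional:
  assumes V: "l2_net \<rho> D V"
  shows "\<exists>v\<in>V. (1 - \<rho>) * l2 D c \<le> kre (\<Sum>i\<in>D. c i * v i)"
proof -
  obtain u where u: "l2 D u \<le> 1" "(\<Sum>i\<in>D. c i * u i) = of_real (l2 D c)" using l2_dual by blast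
  then obtain v where v: "v \<in> V" "l2 D (\<lambda>i. u i - v i) \<le> \<rho>" using V unfolding l2_net_def by blast
  have "norm (\<Sum>i\<in>D. c i * (u i - v i)) \<le> l2 D c * l2 D (\<lambda>i. u i - v i)" by (rule norm_sum_mult_le)
  also have "\<dots> \<le> l2 D c * \<rho>" using v by (intro mult_left_mono) auto
  finally have n: "kre (\<Sum>i\<in>D. c i * (u i - v i)) \<le> l2 D c * \<rho>" using abs_kre_le by (smt (verit))
  have "(\<Sum>i\<in>D. c i * u i) = (\<Sum>i\<in>D. c i * (u i - v i)) + (\<Sum>i\<in>D. c i * v i)"
    by (simp flip: sum.distrib add: algebra_simps)
  then have "kre (of_real (l2 D c) :: 'b) = kre (\<Sum>i\<in>D. c i * (u i - v i)) + kre (\<Sum>i\<in>D. c i * v i)"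
    by (simp only: u(2)[symmetric] kre_add)
  then have "l2 D c = kre (\<Sum>i\<in>D. c i * (u i - v i)) + kre (\<Sum>i\<in>D. c i * v i)" by simp
  then show ?thesis using n v(1) by (intro bexI[of _ v]) (auto simp: algebra_simps)
qed

section \<open>Multilinear forms with random signs\<close>

abbreviation multi_index :: "nat \<Rightarrow> 'i set \<Rightarrow> (nat \<Rightarrow> 'i) set"
  where "multi_index k D \<equiv> PiE {..<k} (\<lambda>_. D)"

text \<open>The k-linear form on tuples of coordinate vectors with coefficient array a, indexed by
  the functions from slots to D.\<close>

definition coord_form :: "nat \<Rightarrow> 'i set \<Rightarrow> ((nat \<Rightarrow> 'i) \<Rightarrow> 'k) \<Rightarrow> (nat \<Rightarrow> 'i \<Rightarrow> 'k::comm_semiring_1) \<Rightarrow> 'k"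
  where "coord_form k D a u = (\<Sum>w\<in>multi_index k D. a w * (\<Prod>j<k. u j (w j)))"

lemma finite_multi_index: "finite D \<Longrightarrow> finite (multi_index k D)"
  by (intro finite_PiE) auto

lemma coord_form_cong: "(\<And>j. j < k \<Longrightarrow> u j = v j) \<Longrightarrow> coord_form k D a u = coord_form k D a v"
  by (auto simp: coord_form_def intro!: sum.cong prod.cong)

lemma coord_form_linear:
  fixes u :: "nat \<Rightarrow> 'i \<Rightarrow> 'k::comm_semiring_1"
  assumes D: "finite D" and j: "j < k"
  shows "\<exists>c. \<forall>y. coord_form k D a (u(j := y)) = (\<Sum>i\<in>D. c i * y i)"
proof (intro exI allI)
  let ?W = "multi_index k D"
  fix y :: "'i \<Rightarrow> 'k"
  let ?r = "\<lambda>w. a w * (\<Prod>l\<in>{..<k} - {j}. u l (w l))"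
  have p: "(\<Prod>l<k. (u(j := y)) l (w l)) = y (w j) * (\<Prod>l\<in>{..<k} - {j}. u l (w l))" for w
    using j by (subst prod.remove[of _ j]) (auto intro!: prod.cong)
  have "coord_form k D a (u(j := y)) = (\<Sum>w\<in>?W. ?r w * y (w j))"
    unfolding coord_form_def p by (simp add: mult_ac)
  also have "\<dots> = (\<Sum>i\<in>D. \<Sum>w\<in>{w \<in> ?W. w j = i}. ?r w * y (w j))"
    using D j by (intro sum.group[symmetric] finite_multi_index) auto
  also have "\<dots> = (\<Sum>i\<in>D. (\<Sum>w\<in>{w \<in> ?W. w j = i}. ?r w) * y i)"
    by (intro sum.cong refl) (auto simp: sum_distrib_right intro!: sum.cong)
  finally show "coord_form k D a (u(j := y)) = (\<Sum>i\<in>D. (\<Sum>w\<in>{w \<in> ?W. w j = i}. ?r w) * y i)" .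
qed

text \<open>Slots are moved into the net one at a time. With the other slots frozen the form is a
  linear functional of one coordinate vector, whose norm is attained on the net up to the factor 1 -
  \<rho>; hence the k-th power.\<close>

lemma coord_form_net_bound:
  fixes u :: "nat \<Rightarrow> 'i \<Rightarrow> 'k::rc_field"
  assumes D: "finite D" and V: "l2_net \<rho> D V" and \<rho>: "\<rho> < 1" and k: "k \<ge> 1"
    and u: "\<And>j. j < k \<Longrightarrow> l2 D (u j) \<le> 1"
  shows "\<exists>v\<in>PiE {..<k} (\<lambda>_. V). (1 - \<rho>) ^ k * norm (coord_form k D a u) \<le> kre (coord_form k D a v)"
proof -
  let ?F = "coord_form k D a"
  \<comment> \<open>For m = 0 no slot lies in the net yet and only the modulus is available; the
    real part is gained with the first replacement, which is why k \<ge> 1 is assumed.\<close>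
  have "\<exists>v. (\<forall>j<m. v j \<in> V) \<and> (\<forall>j\<ge>m. v j = u j) \<and>
      (1 - \<rho>) ^ m * norm (?F u) \<le> (if m = 0 then norm (?F v) else kre (?F v))" if "m \<le> k" for m
    using that
  proof (induction m)
    case 0
    then show ?case by (intro exI[of _ u]) simp
  next
    case (Suc m)
    then obtain v where v: "\<forall>j<m. v j \<in> V" "\<forall>j\<ge>m. v j = u j"
      "(1 - \<rho>) ^ m * norm (?F u) \<le> (if m = 0 then norm (?F v) else kre (?F v))" by auto
    have "(1 - \<rho>) ^ m * norm (?F u) \<le> norm (?F v)"
      using v(3) abs_kre_le[of "?F v"] by (auto split: if_splits)
    moreover obtain c where c: "\<And>y. ?F (v(m := y)) = (\<Sum>i\<in>D. c i * y i)"
      using coord_form_linear[OF D, of m k a v] Suc.prems by auto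
    have "?F v = (\<Sum>i\<in>D. c i * u m i)" using c[of "u m"] v(2) by (metis fun_upd_triv order_refl)
    moreover have "norm (\<Sum>i\<in>D. c i * u m i) \<le> l2 D c * l2 D (u m)" by (rule norm_sum_mult_le)
    moreover have "\<dots> \<le> l2 D c" using u[of m] Suc.prems by (simp add: mult_left_le)
    ultimately have "(1 - \<rho>) ^ m * norm (?F u) \<le> l2 D c" by simp
    then have "(1 - \<rho>) ^ Suc m * norm (?F u) \<le> (1 - \<rho>) * l2 D c"
      using mult_left_mono[of _ "l2 D c" "1 - \<rho>"] \<rho> by (simp add: mult.assoc)
    moreover obtain x where x: "x \<in> V" "(1 - \<rho>) * l2 D c \<le> kre (\<Sum>i\<in>D. c i * x i)"
      using l2_net_functional[OF V] by blast
    ultimately show ?case using v c[of x]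
      by (intro exI[of _ "v(m := x)"]) (auto simp: less_Suc_eq)
  qed
  from this[of k] k obtain v where v: "\<forall>j<k. v j \<in> V" "(1 - \<rho>) ^ k * norm (?F u) \<le> kre (?F v)" by auto
  have "?F (restrict v {..<k}) = ?F v" by (rule coord_form_cong) simp
  with v show ?thesis by (intro bexI[of _ "restrict v {..<k}"]) auto
qed

text \<open>The coefficient array of an elementary tensor factorizes, so its Euclidean norm is the
  product of the norms. This bounds the variance of the random form at a net tuple.\<close>

lemma sum_power2_multi_index:
  fixes v :: "nat \<Rightarrow> 'i \<Rightarrow> 'k::real_normed_field"
  assumes D: "finite D" and v: "\<And>j. j < k \<Longrightarrow> l2 D (v j) \<le> 1"
  shows "(\<Sum>w\<in>multi_index k D. (norm (\<Prod>j<k. v j (w j)))\<^sup>2) \<le> 1"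
proof -
  have "(\<Sum>w\<in>multi_index k D. (norm (\<Prod>j<k. v j (w j)))\<^sup>2)
      = (\<Sum>w\<in>multi_index k D. \<Prod>j<k. (norm (v j (w j)))\<^sup>2)"
    by (simp flip: prod_norm prod_power_distrib)
  also have "\<dots> = (\<Prod>j<k. \<Sum>i\<in>D. (norm (v j i))\<^sup>2)" using D by (subst prod_sum_PiE) auto
  also have "\<dots> = (\<Prod>j<k. (l2 D (v j))\<^sup>2)" by (simp only: l2_power2)
  also have "\<dots> \<le> 1" using v by (intro prod_le_1) (auto intro: power_le_one)
  finally show ?thesis .
qed

section \<open>Exponential moments of random signs\<close>

abbreviation signs :: "'w set \<Rightarrow> ('w \<Rightarrow> real) set"
  where "signs W \<equiv> PiE W (\<lambda>_. {-1, 1})"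

lemma card_signs: "finite W \<Longrightarrow> card (signs W) = 2 ^ card W"
  by (simp add: card_PiE card_insert_if numeral_2_eq_2)

lemma tanh_le_self: "tanh x \<le> x" if "x \<ge> 0" for x :: real
proof -
  have "(\<lambda>x. x - tanh x) 0 \<le> (\<lambda>x. x - tanh x) x"
  proof (rule DERIV_nonneg_imp_nondecreasing[OF that])
    fix y :: real
    have "((\<lambda>x. x - tanh x) has_real_derivative 1 - (1 - (tanh y)\<^sup>2) * 1) (at y)"
      by (intro derivative_intros) (use cosh_real_pos[of y] in auto)
    then show "\<exists>d. ((\<lambda>x. x - tanh x) has_real_derivative d) (at y) \<and> 0 \<le> d" by force
  qed
  then show ?thesis by simp
qed

text \<open>The function x^2/2 - ln cosh x vanishes at 0 and has derivative x - tanh x, which is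
  nonnegative for x \<ge> 0; negative x follow by evenness.\<close>

lemma cosh_le_exp_power2: "cosh x \<le> exp (x\<^sup>2 / 2)" for x :: real
proof -
  have *: "ln (cosh x) \<le> x\<^sup>2 / 2" if "x \<ge> 0" for x :: real
  proof -
    have "(\<lambda>x. x\<^sup>2 / 2 - ln (cosh x)) 0 \<le> (\<lambda>x. x\<^sup>2 / 2 - ln (cosh x)) x"
    proof (rule DERIV_nonneg_imp_nondecreasing[OF that])
      fix y :: real assume y: "0 \<le> y"
      have "((\<lambda>x. x\<^sup>2 / 2 - ln (cosh x)) has_real_derivative y - tanh y) (at y)"
        by (auto intro!: derivative_eq_intros simp: tanh_def)
      then show "\<exists>d. ((\<lambda>x. x\<^sup>2 / 2 - ln (cosh x)) has_real_derivative d) (at y) \<and> 0 \<le> d"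
        using tanh_le_self[OF y] by force
    qed
    then show ?thesis by simp
  qed
  have "ln (cosh x) \<le> x\<^sup>2 / 2"
    using *[of x] *[of "- x"] by (cases "x \<ge> 0") auto
  then show ?thesis by (metis cosh_real_pos exp_le_cancel_iff exp_ln)
qed

text \<open>The subgaussian bound for Rademacher sums: independence turns the sum over all patterns
  into a product of hyperbolic cosines. Means are kept unnormalized, \<open>2 ^ card W\<close> being
  the number of patterns.\<close>

lemma sum_signs_exp_le:
  assumes W: "finite W"
  shows "(\<Sum>\<epsilon>\<in>signs W. exp (\<Sum>w\<in>W. \<epsilon> w * b w)) \<le> 2 ^ card W * exp ((\<Sum>w\<in>W. (b w)\<^sup>2) / 2)"
proof -
  have "(\<Sum>\<epsilon>\<in>signs W. exp (\<Sum>w\<in>W. \<epsilon> w * b w)) = (\<Sum>\<epsilon>\<in>signs W. \<Prod>w\<in>W. exp (\<epsilon> w * b w))"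
    using W by (simp add: exp_sum)
  also have "\<dots> = (\<Prod>w\<in>W. \<Sum>s\<in>{-1, 1}. exp (s * b w))" using W by (subst prod_sum_PiE) auto
  also have "\<dots> = (\<Prod>w\<in>W. 2 * cosh (b w))" by (intro prod.cong refl) (simp add: cosh_field_def)
  also have "\<dots> \<le> (\<Prod>w\<in>W. 2 * exp ((b w)\<^sup>2 / 2))"
    using cosh_le_exp_power2 by (intro prod_mono) (auto intro: less_imp_le)
  also have "\<dots> = 2 ^ card W * exp ((\<Sum>w\<in>W. (b w)\<^sup>2) / 2)"
    using W by (simp add: prod.distrib exp_sum sum_divide_distrib)
  finally show ?thesis .
qed

text \<open>Distinct signs are uncorrelated because flipping the sign at w is an involution of the
  patterns that negates each term.\<close>

lemma sum_signs_mult: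
  assumes W: "finite W" and w: "w \<in> W" "w' \<in> W"
  shows "(\<Sum>\<epsilon>\<in>signs W. \<epsilon> w * \<epsilon> w') = (if w = w' then 2 ^ card W else 0)"
proof (cases "w = w'")
  case True
  have "\<epsilon> w * \<epsilon> w = 1" if "\<epsilon> \<in> signs W" for \<epsilon>
  proof -
    have "\<epsilon> w \<in> {-1, 1}" using that w by blast
    then show ?thesis by auto
  qed
  then show ?thesis using True W by (simp add: card_signs)
next
  case False
  define flip where "flip \<epsilon> = \<epsilon>(w := - \<epsilon> w)" for \<epsilon> :: "'a \<Rightarrow> real"
  have f: "flip \<epsilon> \<in> signs W" if "\<epsilon> \<in> signs W" for \<epsilon>
  proof (rule PiE_I)
    fix x assume "x \<in> W"
    then have "\<epsilon> x \<in> {-1, 1}" using that by blast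
    then show "flip \<epsilon> x \<in> {-1, 1}" by (auto simp: flip_def)
  next
    fix x assume "x \<notin> W" then show "flip \<epsilon> x = undefined" using that w by (auto simp: flip_def)
  qed
  have ff: "flip (flip \<epsilon>) = \<epsilon>" for \<epsilon> by (simp add: flip_def)
  have "(\<Sum>\<epsilon>\<in>signs W. \<epsilon> w * \<epsilon> w') = (\<Sum>\<epsilon>\<in>signs W. flip \<epsilon> w * flip \<epsilon> w')"
    by (rule sum.reindex_bij_witness[of _ flip flip]) (auto simp only: f ff)
  also have "\<dots> = - (\<Sum>\<epsilon>\<in>signs W. \<epsilon> w * \<epsilon> w')"
    using False by (simp add: flip_def sum_negf)
  finally show ?thesis using False by simp
qed

text \<open>Trades a second moment for an exponential one. Below the threshold B the square is at
  most B^2; above it \<open>x / B \<le> exp (x / B - 1)\<close> is squared, and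
  \<open>2 \<le> B\<^sup>2\<close> enlarges the exponent.\<close>

lemma power2_le_exp_bound:
  fixes x B :: real
  assumes B: "B\<^sup>2 \<ge> 2" "B > 0" and x: "x \<ge> 0"
  shows "x\<^sup>2 \<le> B\<^sup>2 * (1 + exp (B * x - B\<^sup>2))"
proof (cases "x \<le> B")
  case True
  have "x\<^sup>2 \<le> B\<^sup>2 * 1" using True x by (simp add: power_mono)
  also have "\<dots> \<le> B\<^sup>2 * (1 + exp (B * x - B\<^sup>2))" by (intro mult_left_mono) auto
  finally show ?thesis .
next
  case False
  have "x / B \<le> exp (x / B - 1)" using exp_ge_add_one_self[of "x / B - 1"] by simp
  moreover have "x / B \<ge> 0" using False B by simp
  ultimately have "(x / B)\<^sup>2 \<le> (exp (x / B - 1))\<^sup>2" by (rule power_mono)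
  also have "\<dots> = exp (2 * (x / B - 1))" by (simp flip: exp_double)
  also have "\<dots> \<le> exp (B\<^sup>2 * (x / B - 1))"
    using False B by (simp only: exp_le_cancel_iff) (intro mult_right_mono, auto)
  also have "B\<^sup>2 * (x / B - 1) = B * x - B\<^sup>2" using B by (simp add: power2_eq_square field_simps)
  finally have "x\<^sup>2 \<le> B\<^sup>2 * exp (B * x - B\<^sup>2)" using B by (simp add: power_divide divide_le_eq mult.commute)
  also have "\<dots> \<le> B\<^sup>2 * (1 + exp (B * x - B\<^sup>2))" by (intro mult_left_mono) auto
  finally show ?thesis .
qed

text \<open>\<open>wt\<close> majorizes the squared supremum of the signed form over the product of
  Euclidean balls. A sum of exponentials over all net tuples replaces the maximum, so that the mean
  can be estimated term by term.\<close>

lemma random_sign_forms: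
  fixes V :: "('i \<Rightarrow> 'k::rc_field) set"
  assumes D: "finite D" and V: "l2_net \<rho> D V" and \<rho>: "\<rho> < 1" and k: "k \<ge> 1"
  defines "W \<equiv> multi_index k D"
  obtains wt :: "((nat \<Rightarrow> 'i) \<Rightarrow> real) \<Rightarrow> real" where
    "\<And>\<epsilon>. wt \<epsilon> > 0"
    "\<And>\<epsilon> u. (\<And>j. j < k \<Longrightarrow> l2 D (u j :: 'i \<Rightarrow> 'k) \<le> 1) \<Longrightarrow>
      (norm (coord_form k D (\<lambda>w. of_real (\<epsilon> w)) u))\<^sup>2 \<le> wt \<epsilon>"
    "(\<Sum>\<epsilon>\<in>signs W. wt \<epsilon>) \<le> 2 ^ card W * ((4 * real k * ln (real (card V)) + 4) / (1 - \<rho>) ^ (2 * k))"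
proof -
  let ?P = "PiE {..<k} (\<lambda>_. V)"
  let ?F = "\<lambda>\<epsilon>. coord_form k D (\<lambda>w. of_real (\<epsilon> w) :: 'k)"
  have finV: "finite V" "V \<noteq> {}" using V by (auto simp: l2_net_def)
  then have cV: "card V \<ge> 1" by (simp add: card_gt_0_iff Suc_leI)
  have finP: "finite ?P" using finV by (intro finite_PiE) auto
  have finW: "finite W" unfolding W_def using D by (rule finite_multi_index)
  \<comment> \<open>This value gives |V|^k exp(-Q/2) = 1/e, so passing to all net tuples costs only
    a bounded factor; the summand 2 also ensures B^2 \<ge> 2 for the threshold.\<close>
  define Q where "Q = 2 * k * ln (card V) + 2"
  define B where "B = sqrt Q"
  have Q2: "Q \<ge> 2" using cV by (simp add: Q_def)
  have B: "B\<^sup>2 = Q" "B > 0" using Q2 by (auto simp: B_def)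
  define R where "R = (1 - \<rho>) ^ k"
  have R: "R > 0" using \<rho> by (simp add: R_def)
  define wt where "wt \<epsilon> = (Q / R\<^sup>2) * (1 + (\<Sum>v\<in>?P. exp (B * kre (?F \<epsilon> v) - Q)))" for \<epsilon>
  show ?thesis
  proof (rule that)
    show "wt \<epsilon> > 0" for \<epsilon>
      unfolding wt_def using Q2 R by (intro mult_pos_pos divide_pos_pos add_pos_nonneg sum_nonneg) auto
    show "(norm (?F \<epsilon> u))\<^sup>2 \<le> wt \<epsilon>" if u: "\<And>j. j < k \<Longrightarrow> l2 D (u j) \<le> 1" for \<epsilon> u
    proof -
      obtain v where v: "v \<in> ?P" "R * norm (?F \<epsilon> u) \<le> kre (?F \<epsilon> v)"
        using coord_form_net_bound[OF D V \<rho> k, of u] u unfolding R_def by blast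
      have "R\<^sup>2 * (norm (?F \<epsilon> u))\<^sup>2 \<le> (kre (?F \<epsilon> v))\<^sup>2"
        using power_mono[OF v(2), of 2] R by (simp add: power_mult_distrib)
      also have "\<dots> \<le> B\<^sup>2 * (1 + exp (B * kre (?F \<epsilon> v) - B\<^sup>2))"
        using B Q2 R v(2) by (intro power2_le_exp_bound order_trans[OF _ v(2)]) auto
      also have "\<dots> \<le> Q * (1 + (\<Sum>v\<in>?P. exp (B * kre (?F \<epsilon> v) - Q)))"
        unfolding B using v(1) finP Q2 by (intro mult_left_mono add_mono order_refl member_le_sum) auto
      finally show ?thesis using R by (simp add: wt_def field_simps)
    qed
    have "(\<Sum>\<epsilon>\<in>signs W. exp (B * kre (?F \<epsilon> v) - Q)) \<le> 2 ^ card W * exp (- Q / 2)" if v: "v \<in> ?P" for v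
    proof -
      have vV: "l2 D (v j) \<le> 1" if "j < k" for j using V v that by (auto simp: l2_net_def PiE_iff)
      let ?b = "\<lambda>w. B * kre (\<Prod>j<k. v j (w j))"
      have "B * kre (?F \<epsilon> v) = (\<Sum>w\<in>W. \<epsilon> w * ?b w)" for \<epsilon>
        by (simp add: coord_form_def kre_sum kre_scale W_def sum_distrib_left mult_ac)
      then have "(\<Sum>\<epsilon>\<in>signs W. exp (B * kre (?F \<epsilon> v) - Q))
          = (\<Sum>\<epsilon>\<in>signs W. exp (\<Sum>w\<in>W. \<epsilon> w * ?b w)) * exp (- Q)"
        by (simp only: diff_conv_add_uminus exp_add sum_distrib_right)
      also have "\<dots> \<le> 2 ^ card W * exp ((\<Sum>w\<in>W. (?b w)\<^sup>2) / 2) * exp (- Q)"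
        by (intro mult_right_mono sum_signs_exp_le finW) auto
      also have "\<dots> = 2 ^ card W * exp ((\<Sum>w\<in>W. (?b w)\<^sup>2) / 2 - Q)"
        by (simp only: diff_conv_add_uminus exp_add mult.assoc)
      \<comment> \<open>Since B^2 = Q and the squared moduli at a net tuple sum to at most 1, the
        exponent is at most Q/2 - Q.\<close>
      also have "\<dots> \<le> 2 ^ card W * exp (- Q / 2)"
      proof -
        have "(\<Sum>w\<in>W. (?b w)\<^sup>2) \<le> (\<Sum>w\<in>W. Q * (norm (\<Prod>j<k. v j (w j)))\<^sup>2)"
        proof (intro sum_mono)
          fix w
          have "(kre (\<Prod>j<k. v j (w j)))\<^sup>2 \<le> (norm (\<Prod>j<k. v j (w j)))\<^sup>2"
            using abs_kre_le[of "\<Prod>j<k. v j (w j)"] by (intro abs_le_square_iff[THEN iffD1]) simp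
          then show "(?b w)\<^sup>2 \<le> Q * (norm (\<Prod>j<k. v j (w j)))\<^sup>2"
            using Q2 by (simp only: power_mult_distrib B(1)) (intro mult_left_mono, auto)
        qed
        also have "\<dots> = Q * (\<Sum>w\<in>W. (norm (\<Prod>j<k. v j (w j)))\<^sup>2)" by (simp only: sum_distrib_left)
        also have "\<dots> \<le> Q * 1"
          unfolding W_def using Q2 vV by (intro mult_left_mono sum_power2_multi_index D) auto
        finally show ?thesis by simp
      qed
      finally show ?thesis .
    qed
    then have "(\<Sum>v\<in>?P. \<Sum>\<epsilon>\<in>signs W. exp (B * kre (?F \<epsilon> v) - Q)) \<le> (\<Sum>v\<in>?P. 2 ^ card W * exp (- Q / 2))"
      by (intro sum_mono)
    also have "\<dots> = 2 ^ card W * (real (card V) ^ k * exp (- Q / 2))" by (simp add: card_PiE)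
    also have "real (card V) ^ k * exp (- Q / 2) \<le> 1"
    proof -
      have "real (card V) ^ k = exp (k * ln (card V))" using cV by (simp add: exp_of_nat_mult)
      then have "real (card V) ^ k * exp (- Q / 2) = exp (- 1)"
        by (simp only: exp_add[symmetric]) (simp add: Q_def field_simps)
      then show ?thesis by simp
    qed
    finally have le: "(\<Sum>v\<in>?P. \<Sum>\<epsilon>\<in>signs W. exp (B * kre (?F \<epsilon> v) - Q)) \<le> 2 ^ card W" by simp
    have "(\<Sum>\<epsilon>\<in>signs W. wt \<epsilon>)
        = (Q / R\<^sup>2) * (2 ^ card W + (\<Sum>v\<in>?P. \<Sum>\<epsilon>\<in>signs W. exp (B * kre (?F \<epsilon> v) - Q)))"
      unfolding wt_def sum_distrib_left[symmetric] sum.distrib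
      by (subst sum.swap) (simp add: card_signs finW)
    also have "\<dots> \<le> (Q / R\<^sup>2) * (2 ^ card W + 2 ^ card W)"
      using le Q2 by (intro mult_left_mono add_mono) auto
    also have "\<dots> = 2 ^ card W * ((4 * real k * ln (real (card V)) + 4) / (1 - \<rho>) ^ (2 * k))"
      by (simp add: Q_def R_def field_simps flip: power_mult)
    finally show "(\<Sum>\<epsilon>\<in>signs W. wt \<epsilon>) \<le> 2 ^ card W * ((4 * real k * ln (real (card V)) + 4) / (1 - \<rho>) ^ (2 * k))" .
  qed
qed

section \<open>Lower bounds for the tensor powers\<close>

lemma vector_space_banach_over: "banach_over s \<Longrightarrow> vector_space s"
  by (simp add: banach_over_def)

lemma dual_spaceI:
  assumes s: "banach_over s" and f: "Vector_Spaces.linear s (*) f" and C: "\<And>x. norm (f x) \<le> C * norm x"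
  shows "f \<in> dual_space s"
proof -
  interpret s: banach_over s by fact
  interpret f: Vector_Spaces.linear s "(*)" f by fact
  have "bounded_linear f"
  proof (rule bounded_linear_intro)
    show "f (r *\<^sub>R x) = r *\<^sub>R f x" for r x
      using f.scale[of "of_real r" x] by (simp add: s.scale_of_real scaleR_conv_of_real)
    show "norm (f x) \<le> norm x * C" for x using C[of x] by (simp add: mult.commute)
  qed (rule f.add)
  then show ?thesis using f by (simp add: dual_space_def bounded_operator_def)
qed

lemma dual_space_linear: "f \<in> dual_space s \<Longrightarrow> Vector_Spaces.linear s (*) f"
  by (simp add: dual_space_def bounded_operator_def)

lemma dual_space_bound: "f \<in> dual_space s \<Longrightarrow> norm (f x) \<le> onorm f * norm x"
  by (simp add: dual_space_def bounded_operator_def onorm)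

lemma dual_ball_bound: "f \<in> dual_ball s \<Longrightarrow> norm (f x) \<le> norm x"
  using dual_space_bound[of f s x] mult_right_mono[of "onorm f" 1 "norm x"]
  by (auto simp: dual_ball_def)

text \<open>The operator from the Euclidean space on D that sends c to the combination of the x i
  has norm at most 1. Dually, every functional in the dual ball has values of Euclidean norm at most
  1 on the system: weak 2-summability with constant 1.\<close>

definition contractive_system ::
  "('k::rc_field \<Rightarrow> 'a::banach \<Rightarrow> 'a) \<Rightarrow> 'i set \<Rightarrow> ('i \<Rightarrow> 'a) \<Rightarrow> bool"
  where "contractive_system s D x \<longleftrightarrow> (\<forall>c. norm (\<Sum>i\<in>D. s (c i) (x i)) \<le> l2 D c)"

lemma contractive_system_dual:
  assumes x: "contractive_system s D x" and f: "f \<in> dual_ball s"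
  shows "l2 D (\<lambda>i. f (x i)) \<le> 1"
proof -
  interpret f: Vector_Spaces.linear s "(*)" f
    using f by (auto simp: dual_ball_def intro: dual_space_linear)
  obtain u where u: "l2 D u \<le> 1" "(\<Sum>i\<in>D. f (x i) * u i) = of_real (l2 D (\<lambda>i. f (x i)))"
    using l2_dual[of D "\<lambda>i. f (x i)"] by blast
  have "f (\<Sum>i\<in>D. s (u i) (x i)) = (\<Sum>i\<in>D. f (x i) * u i)"
    by (simp add: f.sum f.scale mult.commute)
  then have "l2 D (\<lambda>i. f (x i)) = norm (f (\<Sum>i\<in>D. s (u i) (x i)))" using u(2) by simp
  also have "\<dots> \<le> norm (\<Sum>i\<in>D. s (u i) (x i))" using f by (rule dual_ball_bound)
  also have "\<dots> \<le> l2 D u" using x unfolding contractive_system_def by blast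
  finally show ?thesis using u(1) by simp
qed

lemma tensor_sum_apply: "(\<Sum>a\<in>A. F a) \<phi> = (\<Sum>a\<in>A. F a \<phi>)"
  for F :: "'b \<Rightarrow> 'c \<Rightarrow> 'd::comm_monoid_add"
  by (induction A rule: infinite_finite_induct) auto

text \<open>The easy half of the duality between the projective norm and bounded k-linear forms.
  Evaluating z at the form is the pairing, because tensors are modelled as functionals on
  forms.\<close>

lemma norm_le_projective_norm:
  fixes s :: "'k::rc_field \<Rightarrow> 'a::banach \<Rightarrow> 'a"
  assumes \<phi>: "multilinear s (*) k \<phi>" and le: "\<And>xs. length xs = k \<Longrightarrow> norm (\<phi> xs) \<le> M * (\<Prod>j<k. norm (xs ! j))"
    and M: "M > 0"
  shows "ennreal (norm (z \<phi>)) \<le> ennreal M * projective_norm s k z"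
proof -
  have "ennreal (norm (z \<phi>) / M) \<le> projective_norm s k z"
    unfolding projective_norm_def
  proof (rule INF_greatest)
    fix mx :: "nat \<times> (nat \<Rightarrow> 'a list)"
    assume "mx \<in> {(m, x). (\<forall>i<m. length (x i) = k) \<and> z = (\<Sum>i<m. elem_tensor s (x i))}"
    then obtain m x where mx: "mx = (m, x)"
      and x: "\<forall>i<m. length (x i) = k" "z = (\<Sum>i<m. elem_tensor s (x i))" by auto
    have "z \<phi> = (\<Sum>i<m. \<phi> (x i))" using x \<phi> by (simp add: tensor_sum_apply elem_tensor_def)
    then have "norm (z \<phi>) \<le> (\<Sum>i<m. norm (\<phi> (x i)))" by (simp add: norm_sum)
    also have "\<dots> \<le> (\<Sum>i<m. M * (\<Prod>j<k. norm (x i ! j)))" using x(1) le by (intro sum_mono) auto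
    finally have "ennreal (norm (z \<phi>) / M) \<le> ennreal (\<Sum>i<m. \<Prod>j<k. norm (x i ! j))"
      using M by (intro ennreal_leI) (simp add: divide_le_eq mult.commute flip: sum_distrib_left)
    then show "ennreal (norm (z \<phi>) / M)
        \<le> (case mx of (m, x) \<Rightarrow> ennreal (\<Sum>i<m. \<Prod>j<k. norm (x i ! j)))"
      by (simp add: mx)
  qed
  then have "ennreal M * ennreal (norm (z \<phi>) / M) \<le> ennreal M * projective_norm s k z"
    by (rule mult_left_mono) simp
  then show ?thesis using M by (simp flip: ennreal_mult')
qed

lemma multilinear_sum:
  assumes s: "vector_space s" and \<phi>: "\<And>w. w \<in> W \<Longrightarrow> multilinear s (*) k (\<phi> w)"
  shows "multilinear s (*) k (\<lambda>xs. \<Sum>w\<in>W. a w * \<phi> w xs)"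
  using s \<phi> unfolding multilinear_def Vector_Spaces.linear_iff
  by (auto simp: vector_space_mult sum_distrib_left mult_ac distrib_left simp flip: sum.distrib
      intro!: sum.cong)

text \<open>For b = 0 a nonzero a would make the quotient infinite, so the bound forces a = 0; thus
  the case of a vanishing injective norm is covered.\<close>

lemma le_mult_of_divide_ennreal:
  fixes a b c :: ennreal
  assumes "a / b \<le> c" "b \<noteq> top" "c \<noteq> top"
  shows "a \<le> c * b"
proof (cases "b = 0")
  case True
  then have "a = 0"
    using assms by (auto simp: top_unique split: if_splits)
  then show ?thesis by simp
next
  case False
  have "a = a / b * b" using False assms(2) by (simp add: ennreal_divide_times less_top)
  also have "\<dots> \<le> c * b" using assms by (intro mult_right_mono) auto
  finally show ?thesis .
qed

lemma ennreal_root_leD: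
  assumes k: "k \<ge> 1" and C: "C \<ge> 0" and le: "ennreal_root k q \<le> ennreal C"
  shows "q \<le> ennreal (C ^ k)"
proof -
  have q: "q \<noteq> top" using le by (auto simp: ennreal_root_def top_unique)
  then have "root k (enn2real q) \<le> C" using le C by (simp add: ennreal_root_def ennreal_le_iff)
  then have "root k (enn2real q) ^ k \<le> C ^ k" using k by (intro power_mono) auto
  then have "enn2real q \<le> C ^ k" using k by (simp add: real_root_pow_pos2)
  then have "ennreal (enn2real q) \<le> ennreal (C ^ k)" by (rule ennreal_leI)
  then show ?thesis using q by (simp add: ennreal_enn2real_if)
qed

text \<open>The tensor \<open>z \<epsilon>\<close> and the form \<open>\<phi> \<epsilon>\<close>
  carry the same signs, and the root of the same weight bounds both, so the assumption on
  \<open>tau\<close> bounds their pairing by \<open>C ^ k * wt \<epsilon>\<close>. Summing over all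
  patterns leaves on the left only the terms with equal multi-indices, and these add up to the k-th
  power of the trace.\<close>

lemma tau_lower_bound:
  fixes s1 :: "'k::rc_field \<Rightarrow> 'a::banach \<Rightarrow> 'a" and s2 :: "'k \<Rightarrow> 'b::banach \<Rightarrow> 'b"
    and g :: "'i \<Rightarrow> 'b \<Rightarrow> 'k" and V :: "('i \<Rightarrow> 'k) set"
  assumes s: "banach_over s1" "banach_over s2" and T: "bounded_operator s1 s2 T"
    and D: "finite D" and x: "contractive_system s1 D x"
    and g: "\<And>i. i \<in> D \<Longrightarrow> Vector_Spaces.linear s2 (*) (g i)"
    and gb: "\<And>y. l2 D (\<lambda>i. g i y) \<le> norm y"
    and V: "l2_net \<rho> D V" and \<rho>: "\<rho> < 1"
    and k: "k \<ge> 1" and C: "C \<ge> 0" "tau s1 s2 T k \<le> ennreal C"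
  shows "norm (\<Sum>i\<in>D. g i (T (x i))) ^ k \<le> C ^ k * ((4 * real k * ln (real (card V)) + 4) / (1 - \<rho>) ^ (2 * k))"
proof -
  define W where "W = multi_index k D"
  have finW: "finite W" unfolding W_def using D by (rule finite_multi_index)
  have linT: "Vector_Spaces.linear s1 s2 T" using T by (simp add: bounded_operator_def)
  interpret vt: vector_space "tensor_scale :: 'k \<Rightarrow> ('k, 'a) tensor \<Rightarrow> _" by (rule vector_space_tensor)
  interpret mp: Vector_Spaces.linear "tensor_scale :: 'k \<Rightarrow> ('k, 'a) tensor \<Rightarrow> _" tensor_scale "tensor_map s2 k T"
    by (rule linear_tensor_map)
  let ?xs = "\<lambda>w. map (\<lambda>j. x (w j)) [0..<k]"
  define z where "z \<epsilon> = (\<Sum>w\<in>W. tensor_scale (of_real (\<epsilon> w)) (elem_tensor s1 (?xs w)))" for \<epsilon> :: "(nat \<Rightarrow> 'i) \<Rightarrow> real"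
  define \<phi> where "\<phi> \<epsilon> ys = coord_form k D (\<lambda>w. of_real (\<epsilon> w)) (\<lambda>j i. g i (ys ! j))"
    for \<epsilon> :: "(nat \<Rightarrow> 'i) \<Rightarrow> real" and ys :: "'b list"
  obtain wt where wt: "\<And>\<epsilon>. wt \<epsilon> > 0"
    "\<And>\<epsilon> u. (\<And>j. j < k \<Longrightarrow> l2 D (u j :: 'i \<Rightarrow> 'k) \<le> 1) \<Longrightarrow>
      (norm (coord_form k D (\<lambda>w. of_real (\<epsilon> w)) u))\<^sup>2 \<le> wt \<epsilon>"
    "(\<Sum>\<epsilon>\<in>signs W. wt \<epsilon>) \<le> 2 ^ card W * ((4 * real k * ln (real (card V)) + 4) / (1 - \<rho>) ^ (2 * k))"
    unfolding W_def by (rule random_sign_forms[OF D V \<rho> k]) blast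
  have wts: "norm (coord_form k D (\<lambda>w. of_real (\<epsilon> w)) u) \<le> sqrt (wt \<epsilon>)"
    if "\<And>j. j < k \<Longrightarrow> l2 D (u j :: 'i \<Rightarrow> 'k) \<le> 1" for \<epsilon> u
    using wt(2)[OF that] by (rule real_le_rsqrt)
  have \<phi>_mult: "multilinear s2 (*) k (\<phi> \<epsilon>)" for \<epsilon>
    unfolding \<phi>_def coord_form_def
  proof (rule multilinear_sum[OF vector_space_banach_over[OF s(2)]])
    fix w assume "w \<in> multi_index k D"
    then show "multilinear s2 (*) k (\<lambda>xs. \<Prod>j<k. g (w j) (xs ! j))"
      using g by (intro multilinear_prod) auto
  qed
  have \<phi>_le: "norm (\<phi> \<epsilon> ys) \<le> sqrt (wt \<epsilon>) * (\<Prod>j<k. norm (ys ! j))" if "length ys = k" for \<epsilon> ys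
  proof -
    let ?n = "\<lambda>j. of_real (norm (ys ! j)) :: 'k"
    \<comment> \<open>Normalizing each slot reduces the bound to coordinate vectors in the ball. At
      a zero vector the quotient is 0 by convention and \<open>g i\<close> vanishes, so the
      factorization still holds.\<close>
    define u where "u j i = g i (ys ! j) / ?n j" for j i
    have gz: "g i (ys ! j) = u j i * ?n j" if "i \<in> D" for i j
    proof (cases "ys ! j = 0")
      case True
      interpret gi: Vector_Spaces.linear s2 "(*)" "g i" using g that by blast
      show ?thesis using True by simp
    qed (simp add: u_def)
    have "l2 D (u j) \<le> 1" for j
    proof -
      have "l2 D (u j) = l2 D (\<lambda>i. inverse (?n j) * g i (ys ! j))" by (simp add: u_def field_simps)
      also have "\<dots> = norm (inverse (?n j)) * l2 D (\<lambda>i. g i (ys ! j))" by (rule l2_scale)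
      also have "\<dots> \<le> norm (inverse (?n j)) * norm (ys ! j)" by (intro mult_left_mono gb) auto
      also have "\<dots> \<le> 1" by (cases "ys ! j = 0") (auto simp: norm_inverse)
      finally show ?thesis .
    qed
    then have "norm (coord_form k D (\<lambda>w. of_real (\<epsilon> w)) u) \<le> sqrt (wt \<epsilon>)" by (intro wts)
    moreover have "\<phi> \<epsilon> ys = coord_form k D (\<lambda>w. of_real (\<epsilon> w)) u * (\<Prod>j<k. ?n j)"
    proof -
      have "(\<Prod>j<k. g (w j) (ys ! j)) = (\<Prod>j<k. u j (w j)) * (\<Prod>j<k. ?n j)" if "w \<in> multi_index k D" for w
      proof -
        have "(\<Prod>j<k. g (w j) (ys ! j)) = (\<Prod>j<k. u j (w j) * ?n j)"
          using that by (intro prod.cong refl gz) auto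
        then show ?thesis by (simp add: prod.distrib)
      qed
      then show ?thesis by (simp add: \<phi>_def coord_form_def sum_distrib_right mult.assoc)
    qed
    ultimately show ?thesis
      by (simp add: norm_mult prod_norm[symmetric] mult_right_mono prod_nonneg)
  qed
  have z_mem: "z \<epsilon> \<in> tensor_power s1 k" for \<epsilon>
    unfolding z_def tensor_power_def
    by (intro vt.span_sum vt.span_scale vt.span_base) auto
  have inj: "injective_norm s1 k (z \<epsilon>) \<le> ennreal (sqrt (wt \<epsilon>))" for \<epsilon>
    unfolding injective_norm_def
  proof (rule SUP_least)
    fix l :: "nat \<Rightarrow> 'a \<Rightarrow> 'k" assume "l \<in> {l. \<forall>i<k. l i \<in> dual_ball s1}"
    then have l: "\<And>j. j < k \<Longrightarrow> l j \<in> dual_ball s1" by simp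
    then have ll: "\<And>j. j < k \<Longrightarrow> Vector_Spaces.linear s1 (*) (l j)"
      by (auto simp: dual_ball_def intro: dual_space_linear)
    interpret tf: Vector_Spaces.linear "tensor_scale :: 'k \<Rightarrow> ('k, 'a) tensor \<Rightarrow> _" "(*)" "tensor_functional k l"
      by (rule linear_tensor_functional)
    have "tensor_functional k l (elem_tensor s1 (?xs w)) = (\<Prod>j<k. l j (x (w j)))" for w
      using ll by (subst tensor_functional_elem) auto
    then have "tensor_functional k l (z \<epsilon>) = coord_form k D (\<lambda>w. of_real (\<epsilon> w)) (\<lambda>j i. l j (x i))"
      unfolding z_def by (simp add: tf.sum tf.scale coord_form_def W_def)
    then have "norm (tensor_functional k l (z \<epsilon>)) \<le> sqrt (wt \<epsilon>)"
      using contractive_system_dual[OF x l] by (auto intro: wts)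
    then show "ennreal (norm (tensor_functional k l (z \<epsilon>))) \<le> ennreal (sqrt (wt \<epsilon>))" by (rule ennreal_leI)
  qed
  have q: "projective_norm s2 k (tensor_map s2 k T y) / injective_norm s1 k y \<le> ennreal (C ^ k)"
    if "y \<in> tensor_power s1 k - {0}" for y
  proof -
    have "(SUP z \<in> tensor_power s1 k - {0}. projective_norm s2 k (tensor_map s2 k T z) / injective_norm s1 k z)
        \<le> ennreal (C ^ k)"
      using C k unfolding tau_def by (intro ennreal_root_leD) auto
    then show ?thesis by (rule order_trans[OF SUP_upper[OF that]])
  qed
  \<comment> \<open>The supremum in \<open>tau\<close> omits the zero tensor, so a pattern with
    \<open>z \<epsilon> = 0\<close> is treated apart.\<close>
  have each: "norm (tensor_map s2 k T (z \<epsilon>) (\<phi> \<epsilon>)) \<le> C ^ k * wt \<epsilon>" for \<epsilon>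
  proof (cases "z \<epsilon> = 0")
    case True
    then have "tensor_map s2 k T (z \<epsilon>) = 0" by simp
    then show ?thesis using C(1) wt(1)[of \<epsilon>] by simp
  next
    case False
    have r: "sqrt (wt \<epsilon>) > 0" using wt(1) by simp
    have i_fin: "injective_norm s1 k (z \<epsilon>) \<noteq> top" using inj[of \<epsilon>] by (auto simp: top_unique)
    have "ennreal (norm (tensor_map s2 k T (z \<epsilon>) (\<phi> \<epsilon>)))
        \<le> ennreal (sqrt (wt \<epsilon>)) * projective_norm s2 k (tensor_map s2 k T (z \<epsilon>))"
      by (intro norm_le_projective_norm \<phi>_mult \<phi>_le r)
    also have "\<dots> \<le> ennreal (sqrt (wt \<epsilon>)) * (ennreal (C ^ k) * injective_norm s1 k (z \<epsilon>))"
      using False z_mem i_fin by (intro mult_left_mono le_mult_of_divide_ennreal q) auto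
    also have "\<dots> \<le> ennreal (sqrt (wt \<epsilon>)) * (ennreal (C ^ k) * ennreal (sqrt (wt \<epsilon>)))"
      by (intro mult_left_mono inj) auto
    also have "\<dots> = ennreal (C ^ k * wt \<epsilon>)"
    proof -
      have "sqrt (wt \<epsilon>) * (C ^ k * sqrt (wt \<epsilon>)) = C ^ k * wt \<epsilon>"
        using wt(1)[of \<epsilon>] real_sqrt_mult_self[of "wt \<epsilon>"] by (simp add: mult.left_commute)
      then show ?thesis using r C(1) by (simp flip: ennreal_mult)
    qed
    finally show ?thesis using C(1) wt(1)[of \<epsilon>] by (subst (asm) ennreal_le_iff) auto
  qed
  let ?t = "\<Sum>i\<in>D. g i (T (x i))"
  let ?a = "\<lambda>w w'. \<Prod>j<k. g (w' j) (T (x (w j)))"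
  have val: "tensor_map s2 k T (z \<epsilon>) (\<phi> \<epsilon>) = (\<Sum>w\<in>W. \<Sum>w'\<in>W. of_real (\<epsilon> w * \<epsilon> w') * ?a w w')" for \<epsilon>
  proof -
    have "tensor_map s2 k T (elem_tensor s1 (?xs w)) = elem_tensor s2 (map T (?xs w))" for w
      by (intro tensor_map_elem linT) simp
    then have "tensor_map s2 k T (z \<epsilon>) = (\<Sum>w\<in>W. tensor_scale (of_real (\<epsilon> w)) (elem_tensor s2 (map T (?xs w))))"
      unfolding z_def by (simp add: mp.sum mp.scale)
    then have "tensor_map s2 k T (z \<epsilon>) (\<phi> \<epsilon>) = (\<Sum>w\<in>W. of_real (\<epsilon> w) * \<phi> \<epsilon> (map T (?xs w)))"
      using \<phi>_mult by (simp add: tensor_sum_apply tensor_scale_def elem_tensor_def)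
    also have "\<dots> = (\<Sum>w\<in>W. \<Sum>w'\<in>W. of_real (\<epsilon> w * \<epsilon> w') * ?a w w')"
      by (simp add: \<phi>_def coord_form_def W_def sum_distrib_left mult.assoc)
    finally show ?thesis .
  qed
  have "(\<Sum>\<epsilon>\<in>signs W. tensor_map s2 k T (z \<epsilon>) (\<phi> \<epsilon>))
      = (\<Sum>w\<in>W. \<Sum>w'\<in>W. \<Sum>\<epsilon>\<in>signs W. of_real (\<epsilon> w * \<epsilon> w') * ?a w w')"
    unfolding val by (subst sum.swap) (intro sum.cong refl sum.swap)
  also have "\<dots> = (\<Sum>w\<in>W. \<Sum>w'\<in>W. of_real (\<Sum>\<epsilon>\<in>signs W. \<epsilon> w * \<epsilon> w') * ?a w w')"
    by (simp only: of_real_sum sum_distrib_right)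
  also have "\<dots> = (\<Sum>w\<in>W. \<Sum>w'\<in>W. if w = w' then 2 ^ card W * ?a w w else 0)"
    by (intro sum.cong refl) (simp add: sum_signs_mult finW)
  also have "\<dots> = 2 ^ card W * (\<Sum>w\<in>W. ?a w w)" using finW by (simp add: sum_distrib_left)
  also have "(\<Sum>w\<in>W. ?a w w) = ?t ^ k"
    unfolding W_def using D by (subst prod_sum_PiE[symmetric]) auto
  finally have "norm (2 ^ card W * ?t ^ k) = norm (\<Sum>\<epsilon>\<in>signs W. tensor_map s2 k T (z \<epsilon>) (\<phi> \<epsilon>))" by simp
  also have "\<dots> \<le> (\<Sum>\<epsilon>\<in>signs W. norm (tensor_map s2 k T (z \<epsilon>) (\<phi> \<epsilon>)))" by (rule norm_sum)
  also have "\<dots> \<le> (\<Sum>\<epsilon>\<in>signs W. C ^ k * wt \<epsilon>)" by (intro sum_mono each)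
  also have "\<dots> = C ^ k * (\<Sum>\<epsilon>\<in>signs W. wt \<epsilon>)" by (simp add: sum_distrib_left)
  also have "\<dots> \<le> C ^ k * (2 ^ card W * ((4 * real k * ln (real (card V)) + 4) / (1 - \<rho>) ^ (2 * k)))"
    using C(1) by (intro mult_left_mono wt(3)) auto
  finally have "2 ^ card W * norm ?t ^ k
      \<le> 2 ^ card W * (C ^ k * ((4 * real k * ln (real (card V)) + 4) / (1 - \<rho>) ^ (2 * k)))"
    by (simp add: norm_mult norm_power mult_ac)
  then show ?thesis by (rule mult_left_le_imp_le) simp
qed

text \<open>If the modulus of the trace times (1 - \<rho>)^2 exceeded C, the k-th power of the ratio
  would decay geometrically and beat the factor linear in k, contradicting the preceding bound at
  some large k. Afterwards \<rho> tends to 0. Infinitely many k suffice, so this is a statement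
  about the lower limit of \<open>tau\<close>.\<close>

proposition trace_le_frequently_tau:
  fixes s1 :: "'k::rc_field \<Rightarrow> 'a::banach \<Rightarrow> 'a" and s2 :: "'k \<Rightarrow> 'b::banach \<Rightarrow> 'b"
    and g :: "'i \<Rightarrow> 'b \<Rightarrow> 'k"
  assumes s: "banach_over s1" "banach_over s2" and T: "bounded_operator s1 s2 T"
    and D: "finite D" and x: "contractive_system s1 D x"
    and g: "\<And>i. i \<in> D \<Longrightarrow> Vector_Spaces.linear s2 (*) (g i)"
    and gb: "\<And>y. l2 D (\<lambda>i. g i y) \<le> norm y"
    and C: "C \<ge> 0" "\<exists>\<^sub>F k in sequentially. tau s1 s2 T k \<le> ennreal C"
  shows "norm (\<Sum>i\<in>D. g i (T (x i))) \<le> C"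
proof -
  let ?t = "norm (\<Sum>i\<in>D. g i (T (x i)))"
  have main: "?t * (1 - \<rho>)\<^sup>2 \<le> C" if \<rho>: "0 < \<rho>" "\<rho> < 1" for \<rho>
  proof (rule ccontr)
    assume "\<not> ?thesis"
    then have q: "?t * (1 - \<rho>)\<^sup>2 > C" (is "?q > C") by simp
    then have q0: "?q > 0" using C(1) by simp
    obtain V :: "('i \<Rightarrow> 'k) set" where V: "l2_net \<rho> D V" using l2_net_exists[OF D \<rho>(1)] by blast
    let ?L = "ln (real (card V))"
    have r: "norm (C / ?q) < 1" using q C(1) q0 by simp
    have "(\<lambda>k. (C / ?q) ^ k * (4 * real k * ?L + 4)) \<longlonglongrightarrow> 0"
    proof -
      have "(\<lambda>k. 4 * ?L * (real k * (C / ?q) ^ k) + 4 * (C / ?q) ^ k) \<longlonglongrightarrow> 4 * ?L * 0 + 4 * 0"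
        by (intro tendsto_add tendsto_mult tendsto_const powser_times_n_limit_0[OF r] LIMSEQ_power_zero[OF r])
      then show ?thesis by (simp add: algebra_simps)
    qed
    then have "\<forall>\<^sub>F k in sequentially. (C / ?q) ^ k * (4 * real k * ?L + 4) < 1"
      by (rule order_tendstoD) simp
    then have "\<exists>\<^sub>F k in sequentially. tau s1 s2 T k \<le> ennreal C \<and>
        ((C / ?q) ^ k * (4 * real k * ?L + 4) < 1 \<and> k \<ge> 1)"
      by (intro frequently_eventually_frequently[OF C(2)] eventually_conj eventually_ge_at_top)
    then obtain k where k: "tau s1 s2 T k \<le> ennreal C" "(C / ?q) ^ k * (4 * real k * ?L + 4) < 1" "k \<ge> 1"
      by (metis (mono_tags, lifting) frequently_ex)
    have "?t ^ k \<le> C ^ k * ((4 * real k * ?L + 4) / (1 - \<rho>) ^ (2 * k))"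
      by (rule tau_lower_bound[OF s T D x g gb V \<rho>(2) k(3) C(1) k(1)])
    then have "?t ^ k * (1 - \<rho>) ^ (2 * k) \<le> C ^ k * (4 * real k * ?L + 4)"
      using \<rho> by (simp add: field_simps)
    then have "?q ^ k \<le> C ^ k * (4 * real k * ?L + 4)" by (simp add: power_mult_distrib power_mult)
    then have "1 \<le> (C / ?q) ^ k * (4 * real k * ?L + 4)"
      using q0 by (simp add: power_divide le_divide_eq)
    then show False using k(2) by simp
  qed
  have "((\<lambda>\<rho>. ?t * (1 - \<rho>)\<^sup>2) \<longlongrightarrow> ?t * (1 - 0)\<^sup>2) (at_right 0)"
    by (intro tendsto_intros)
  moreover have "\<forall>\<^sub>F \<rho> in at_right 0. ?t * (1 - \<rho>)\<^sup>2 \<le> C"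
    using eventually_at_right_real[of 0 "1::real"] by (rule eventually_mono) (auto intro: main)
  ultimately show ?thesis
    using tendsto_upperbound[of "\<lambda>\<rho>. ?t * (1 - \<rho>)\<^sup>2" "?t * (1 - 0)\<^sup>2" "at_right 0" C] by simp
qed

section \<open>The upper bound by the nuclear norm\<close>

text \<open>A concrete finite representation of cost at most C. Working with witnesses keeps the
  estimates in the reals until the infimum in \<open>projective_norm\<close> is taken.\<close>

definition tensor_rep ::
  "('k::rc_field \<Rightarrow> 'a::banach \<Rightarrow> 'a) \<Rightarrow> nat \<Rightarrow> ('k, 'a) tensor \<Rightarrow> real \<Rightarrow> bool"
  where "tensor_rep s k z C \<longleftrightarrow> (\<exists>m x. (\<forall>i<m. length (x i) = k) \<and> z = (\<Sum>i<m::nat. elem_tensor s (x i)) \<and>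
    (\<Sum>i<m. \<Prod>j<k. norm (x i ! j)) \<le> C)"

lemma tensor_rep_projective_norm:
  assumes "tensor_rep s k z C"
  shows "projective_norm s k z \<le> ennreal C"
proof -
  obtain m x where mx: "\<forall>i<m. length (x i) = k" "z = (\<Sum>i<m::nat. elem_tensor s (x i))"
    "(\<Sum>i<m. \<Prod>j<k. norm (x i ! j)) \<le> C"
    using assms unfolding tensor_rep_def by blast
  have "projective_norm s k z \<le> ennreal (\<Sum>i<m. \<Prod>j<k. norm (x i ! j))"
    unfolding projective_norm_def by (rule INF_lower2[of "(m, x)"]) (use mx in auto)
  also have "\<dots> \<le> ennreal C" using mx(3) by (rule ennreal_leI)
  finally show ?thesis .
qed

lemma tensor_rep_zero: "tensor_rep s k 0 0"
  unfolding tensor_rep_def by (intro exI[of _ 0]) auto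

lemma sum_lessThan_append:
  fixes F G :: "nat \<Rightarrow> 'b::comm_monoid_add"
  shows "(\<Sum>i<m + n. if i < m then F i else G (i - m)) = sum F {..<m} + sum G {..<n}"
  by (induction n) (auto simp: add.assoc)

lemma tensor_rep_add:
  assumes "tensor_rep s k z C" "tensor_rep s k z' C'"
  shows "tensor_rep s k (z + z') (C + C')"
proof -
  obtain m x where m: "\<forall>i<m. length (x i) = k" "z = (\<Sum>i<m::nat. elem_tensor s (x i))"
    "(\<Sum>i<m. \<Prod>j<k. norm (x i ! j)) \<le> C"
    using assms(1) unfolding tensor_rep_def by blast
  obtain n y where n: "\<forall>i<n. length (y i) = k" "z' = (\<Sum>i<n::nat. elem_tensor s (y i))"
    "(\<Sum>i<n. \<Prod>j<k. norm (y i ! j)) \<le> C'"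
    using assms(2) unfolding tensor_rep_def by blast
  let ?x = "\<lambda>i. if i < m then x i else y (i - m)"
  have "(\<Sum>i<m + n. H (?x i)) = (\<Sum>i<m. H (x i)) + (\<Sum>i<n. H (y i))" for H :: "'b list \<Rightarrow> 'c::comm_monoid_add"
  proof -
    have "(\<Sum>i<m + n. H (?x i)) = (\<Sum>i<m + n. if i < m then H (x i) else H (y (i - m)))"
      by (intro sum.cong) auto
    then show ?thesis using sum_lessThan_append[of m "\<lambda>i. H (x i)" "\<lambda>i. H (y i)" n] by simp
  qed
  note this[of "elem_tensor s"] this[of "\<lambda>xs. \<Prod>j<k. norm (xs ! j)"]
  then show ?thesis unfolding tensor_rep_def using m n
    by (intro exI[of _ "m + n"] exI[of _ ?x]) auto
qed

lemma tensor_rep_sum: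
  assumes "finite A" "\<And>a. a \<in> A \<Longrightarrow> tensor_rep s k (z a) (C a)"
  shows "tensor_rep s k (\<Sum>a\<in>A. z a) (\<Sum>a\<in>A. C a)"
  using assms by (induction A rule: finite_induct) (auto intro: tensor_rep_zero tensor_rep_add)

lemma tensor_rep_elem:
  assumes "length xs = k"
  shows "tensor_rep s k (elem_tensor s xs) (\<Prod>j<k. norm (xs ! j))"
  unfolding tensor_rep_def using assms by (intro exI[of _ 1] exI[of _ "\<lambda>_. xs"]) auto

lemma tensor_rep_mono: "tensor_rep s k z C \<Longrightarrow> C \<le> C' \<Longrightarrow> tensor_rep s k z C'"
  unfolding tensor_rep_def by (elim exE conjE) (intro exI conjI, assumption+, erule (1) order_trans)

text \<open>Representations are sums of elementary tensors without coefficients, so the scalar is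
  absorbed into the first factor, which exists because k \<ge> 1.\<close>

lemma tensor_rep_scaled_elem:
  assumes s: "banach_over s" and k: "k \<ge> 1" and xs: "length xs = k"
  shows "tensor_rep s k (tensor_scale c (elem_tensor s xs)) (norm c * (\<Prod>j<k. norm (xs ! j)))"
proof -
  interpret s: banach_over s by fact
  interpret l: Vector_Spaces.linear s tensor_scale "\<lambda>v. elem_tensor s (xs[0 := v])"
    using multilinear_elem_tensor[OF vector_space_banach_over[OF s], of k] xs k
    by (auto simp: multilinear_def)
  let ?ys = "xs[0 := s c (xs ! 0)]"
  have "tensor_scale c (elem_tensor s xs) = elem_tensor s ?ys"
    using l.scale[of c "xs ! 0"] by (simp add: list_update_id)
  moreover have "(\<Prod>j<k. norm (?ys ! j)) = norm c * (\<Prod>j<k. norm (xs ! j))"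
  proof -
    have 0: "0 \<in> {..<k}" using k by simp
    have "(\<Prod>j<k. norm (?ys ! j)) = norm (?ys ! 0) * (\<Prod>j\<in>{..<k} - {0}. norm (?ys ! j))"
      using 0 by (intro prod.remove) auto
    also have "(\<Prod>j\<in>{..<k} - {0}. norm (?ys ! j)) = (\<Prod>j\<in>{..<k} - {0}. norm (xs ! j))"
      by (intro prod.cong) auto
    also have "norm (?ys ! 0) = norm c * norm (xs ! 0)" using 0 xs by (simp add: s.norm_scale)
    finally show ?thesis using prod.remove[OF _ 0, of "\<lambda>j. norm (xs ! j)"] by (simp add: mult.assoc)
  qed
  moreover have "tensor_rep s k (elem_tensor s ?ys) (\<Prod>j<k. norm (?ys ! j))"
    by (rule tensor_rep_elem) (simp add: xs)
  ultimately show ?thesis by simp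
qed

lemma tensor_power_rep:
  assumes s: "banach_over s" and k: "k \<ge> 1" and z: "z \<in> tensor_power s k"
  obtains m x where "\<And>i. i < m \<Longrightarrow> length (x i) = k" "z = (\<Sum>i<m::nat. elem_tensor s (x i))"
proof -
  interpret vt: vector_space "tensor_scale :: 'a \<Rightarrow> ('a, 'b) tensor \<Rightarrow> _" by (rule vector_space_tensor)
  have "\<exists>C. tensor_rep s k z C"
    using z unfolding tensor_power_def
  proof (induction rule: vt.span_induct_alt)
    case base
    then show ?case using tensor_rep_zero by (metis zero_fun_def)
  next
    case (step c x y)
    then show ?case using tensor_rep_add tensor_rep_scaled_elem[OF s k] by blast
  qed
  then show ?thesis unfolding tensor_rep_def using that by blast
qed

section \<open>Expanding and telescoping elementary tensors\<close>

lemma multilinear_fun_upd: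
  assumes "multilinear s1 s2 k \<phi>" "j < k"
  shows "Vector_Spaces.linear s1 s2 (\<lambda>v. \<phi> (map (h(j := v)) [0..<k]))"
proof -
  have "map (h(j := v)) [0..<k] = (map h [0..<k])[j := v]" for v
    using assms(2) by (intro nth_equalityI) (auto simp: nth_list_update)
  moreover have "Vector_Spaces.linear s1 s2 (\<lambda>v. \<phi> ((map h [0..<k])[j := v]))"
    using assms unfolding multilinear_def by simp
  ultimately show ?thesis by (simp only:)
qed

lemma sum_multi_index_Suc:
  "(\<Sum>w\<in>multi_index (Suc m) I. F w) = (\<Sum>w\<in>multi_index m I. \<Sum>i\<in>I. F (w(m := i)))"
proof -
  have "multi_index (Suc m) I = (\<lambda>(i, w). w(m := i)) ` (I \<times> multi_index m I)"
    using PiE_insert_eq[of m "{..<m}" "\<lambda>_. I"] by (simp add: lessThan_Suc)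
  moreover have "inj_on (\<lambda>(i, w). w(m := i)) (I \<times> multi_index m I)"
    using inj_combinator[of m "{..<m}" "\<lambda>_. I"] by simp
  ultimately have "(\<Sum>w\<in>multi_index (Suc m) I. F w) = (\<Sum>(i, w)\<in>I \<times> multi_index m I. F (w(m := i)))"
    using sum.reindex[of "\<lambda>(i, w). w(m := i)" "I \<times> multi_index m I" F]
    by (simp only: o_def case_prod_unfold)
  also have "\<dots> = (\<Sum>w\<in>multi_index m I. \<Sum>i\<in>I. F (w(m := i)))"
    by (simp only: sum.cartesian_product[symmetric]) (rule sum.swap)
  finally show ?thesis .
qed

lemma multilinear_expand:
  assumes \<phi>: "multilinear s (*) k \<phi>"
  shows "\<phi> (map (\<lambda>j. \<Sum>i\<in>I. s (c j i) (y i)) [0..<k])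
    = (\<Sum>w\<in>multi_index k I. (\<Prod>j<k. c j (w j)) * \<phi> (map (\<lambda>j. y (w j)) [0..<k]))"
proof -
  let ?v = "\<lambda>j. \<Sum>i\<in>I. s (c j i) (y i)"
  \<comment> \<open>Generalized for the induction: only the first m slots are expanded, and
    arbitrary vectors h occupy the others.\<close>
  have "\<phi> (map (\<lambda>j. if j < m then ?v j else h j) [0..<k])
      = (\<Sum>w\<in>multi_index m I. (\<Prod>j<m. c j (w j)) * \<phi> (map (\<lambda>j. if j < m then y (w j) else h j) [0..<k]))"
    if "m \<le> k" for m h
    using that
  proof (induction m arbitrary: h)
    case 0
    then show ?case by simp
  next
    case (Suc m)
    have "(\<lambda>j. if j < Suc m then ?v j else h j) = (\<lambda>j. if j < m then ?v j else (h(m := ?v m)) j)"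
      by (auto simp: fun_eq_iff less_Suc_eq)
    then have "\<phi> (map (\<lambda>j. if j < Suc m then ?v j else h j) [0..<k])
        = (\<Sum>w\<in>multi_index m I. (\<Prod>j<m. c j (w j)) * \<phi> (map (\<lambda>j. if j < m then y (w j) else (h(m := ?v m)) j) [0..<k]))"
      using Suc by simp
    also have "\<dots> = (\<Sum>w\<in>multi_index m I. \<Sum>i\<in>I. (\<Prod>j<Suc m. c j ((w(m := i)) j)) *
        \<phi> (map (\<lambda>j. if j < Suc m then y ((w(m := i)) j) else h j) [0..<k]))"
    proof (intro sum.cong refl)
      fix w
      let ?h = "\<lambda>j. if j < m then y (w j) else h j"
      interpret l: Vector_Spaces.linear s "(*)" "\<lambda>v. \<phi> (map (?h(m := v)) [0..<k])"
        by (rule multilinear_fun_upd[OF \<phi>]) (use Suc.prems in simp)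
      have 1: "(\<lambda>j. if j < m then y (w j) else (h(m := ?v m)) j) = ?h(m := ?v m)"
        by (auto simp: fun_eq_iff)
      have 2: "(\<lambda>j. if j < Suc m then y ((w(m := i)) j) else h j) = ?h(m := y i)" for i
        by (auto simp: fun_eq_iff less_Suc_eq)
      have 3: "(\<Prod>j<Suc m. c j ((w(m := i)) j)) = (\<Prod>j<m. c j (w j)) * c m i" for i
        by (simp add: lessThan_Suc mult.commute)
      have "\<phi> (map (?h(m := ?v m)) [0..<k]) = (\<Sum>i\<in>I. c m i * \<phi> (map (?h(m := y i)) [0..<k]))"
        unfolding l.sum l.scale ..
      then show "(\<Prod>j<m. c j (w j)) * \<phi> (map (\<lambda>j. if j < m then y (w j) else (h(m := ?v m)) j) [0..<k]) =
          (\<Sum>i\<in>I. (\<Prod>j<Suc m. c j ((w(m := i)) j)) * \<phi> (map (\<lambda>j. if j < Suc m then y ((w(m := i)) j) else h j) [0..<k]))"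
        unfolding 1 2 3 by (simp add: sum_distrib_left mult.assoc)
    qed
    also have "\<dots> = (\<Sum>w\<in>multi_index (Suc m) I. (\<Prod>j<Suc m. c j (w j)) *
        \<phi> (map (\<lambda>j. if j < Suc m then y (w j) else h j) [0..<k]))"
      by (simp only: sum_multi_index_Suc)
    finally show ?case .
  qed
  from this[of k undefined] have "\<phi> (map (\<lambda>j. if j < k then ?v j else undefined j) [0..<k])
      = (\<Sum>w\<in>multi_index k I. (\<Prod>j<k. c j (w j)) * \<phi> (map (\<lambda>j. if j < k then y (w j) else undefined j) [0..<k]))"
    by simp
  moreover have "map (\<lambda>j. if j < k then u j else undefined j) [0..<k] = map u [0..<k]" for u :: "nat \<Rightarrow> 'b"
    by simp
  ultimately show ?thesis by simp
qed

lemma elem_tensor_expand: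
  "elem_tensor s (map (\<lambda>j. \<Sum>i\<in>I. s (c j i) (y i)) [0..<k])
    = (\<Sum>w\<in>multi_index k I. tensor_scale (\<Prod>j<k. c j (w j)) (elem_tensor s (map (\<lambda>j. y (w j)) [0..<k])))"
proof
  fix \<phi>
  show "elem_tensor s (map (\<lambda>j. \<Sum>i\<in>I. s (c j i) (y i)) [0..<k]) \<phi>
    = (\<Sum>w\<in>multi_index k I. tensor_scale (\<Prod>j<k. c j (w j)) (elem_tensor s (map (\<lambda>j. y (w j)) [0..<k]))) \<phi>"
    unfolding tensor_sum_apply tensor_scale_def elem_tensor_def
    using multilinear_expand[of s k \<phi> c y I] by (cases "multilinear s (*) k \<phi>") auto
qed

text \<open>Going from v to u one slot at a time, each step changes a single slot, and linearity
  there produces the factor u - v. When v is a truncation of u, every correction term contains a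
  small factor.\<close>

lemma elem_tensor_telescope:
  assumes s: "vector_space s"
  shows "elem_tensor s (map u [0..<k]) = elem_tensor s (map v [0..<k]) +
    (\<Sum>j<k. elem_tensor s (map (\<lambda>l. if l < j then u l else if l = j then u l - v l else v l) [0..<k]))"
proof -
  define G where "G j = elem_tensor s (map (\<lambda>l. if l < j then u l else v l) [0..<k])" for j
  have "elem_tensor s (map (\<lambda>l. if l < j then u l else if l = j then u l - v l else v l) [0..<k])
      = G (Suc j) - G j" if j: "j < k" for j
  proof -
    let ?h = "\<lambda>l. if l < j then u l else v l"
    interpret l: Vector_Spaces.linear s tensor_scale "\<lambda>x. elem_tensor s (map (?h(j := x)) [0..<k])"
      by (rule multilinear_fun_upd[OF multilinear_elem_tensor[OF s] j])
    have 1: "(\<lambda>l. if l < j then u l else if l = j then u l - v l else v l) = ?h(j := u j - v j)"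
      by (auto simp: fun_eq_iff)
    have 2: "(\<lambda>l. if l < Suc j then u l else v l) = ?h(j := u j)"
      by (auto simp: fun_eq_iff less_Suc_eq)
    have 3: "G j = elem_tensor s (map (?h(j := v j)) [0..<k])"
      unfolding G_def by (intro arg_cong[where f = "\<lambda>h. elem_tensor s (map h [0..<k])"]) (auto simp: fun_eq_iff)
    show ?thesis unfolding 1 3 unfolding G_def 2 by (rule l.diff)
  qed
  then have "(\<Sum>j<k. elem_tensor s (map (\<lambda>l. if l < j then u l else if l = j then u l - v l else v l) [0..<k]))
      = (\<Sum>j<k. G (Suc j) - G j)" by simp
  also have "\<dots> = G k - G 0" by (rule sum_lessThan_telescope)
  also have "G k = elem_tensor s (map u [0..<k])"
    unfolding G_def by (intro arg_cong[where f = "elem_tensor s"]) simp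
  also have "G 0 = elem_tensor s (map v [0..<k])" unfolding G_def by simp
  finally show ?thesis by (subst add.commute) (simp only: diff_add_cancel)
qed

text \<open>Rescaling the functionals into the dual ball extracts the product of their norms. A
  functional of norm 0 vanishes, and so does its rescaling by the convention for division by
  0.\<close>

lemma norm_tensor_functional_le:
  assumes s: "banach_over s" and f: "\<And>j. j < k \<Longrightarrow> f j \<in> dual_space s"
    and x: "\<And>i. i < m \<Longrightarrow> length (x i) = k" and z: "z = (\<Sum>i<m::nat. elem_tensor s (x i))"
    and J: "injective_norm s k z \<le> ennreal J" "J \<ge> 0"
  shows "norm (tensor_functional k f z) \<le> (\<Prod>j<k. onorm (f j)) * J"
proof -
  define l where "l j x = f j x / of_real (onorm (f j))" for j x
  have on: "onorm (f j) \<ge> 0" if "j < k" for j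
    using f[OF that] by (auto simp: dual_space_def bounded_operator_def intro: onorm_pos_le)
  have fl: "f j x = of_real (onorm (f j)) * l j x" if "j < k" for j x
    using dual_space_bound[OF f[OF that], of x] by (cases "onorm (f j) = 0") (auto simp: l_def)
  have lb: "norm (l j x) \<le> 1 * norm x" if "j < k" for j x
    using dual_space_bound[OF f[OF that], of x] on[OF that]
    by (cases "onorm (f j) = 0") (auto simp: l_def norm_divide field_simps)
  have l: "l j \<in> dual_ball s" if "j < k" for j
  proof -
    interpret fj: Vector_Spaces.linear s "(*)" "f j" using f[OF that] by (rule dual_space_linear)
    have "Vector_Spaces.linear s (*) (l j)"
      unfolding Vector_Spaces.linear_iff
      by (auto simp: l_def fj.add fj.scale add_divide_distrib vector_space_mult vector_space_banach_over[OF s])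
    then have "l j \<in> dual_space s" using s lb[OF that] by (intro dual_spaceI)
    moreover have "onorm (l j) \<le> 1" using lb[OF that] by (intro onorm_bound) auto
    ultimately show ?thesis by (simp add: dual_ball_def)
  qed
  have val: "tensor_functional k h z = (\<Sum>i<m. \<Prod>j<k. h j (x i ! j))"
    if "\<And>j. j < k \<Longrightarrow> Vector_Spaces.linear s (*) (h j)" for h
  proof -
    interpret tf: Vector_Spaces.linear "tensor_scale :: 'a \<Rightarrow> ('a, 'b) tensor \<Rightarrow> _" "(*)" "tensor_functional k h"
      by (rule linear_tensor_functional)
    show ?thesis unfolding z tf.sum using x that by (intro sum.cong tensor_functional_elem) auto
  qed
  have "tensor_functional k f z = (\<Sum>i<m. \<Prod>j<k. f j (x i ! j))"
    by (rule val) (rule dual_space_linear[OF f])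
  also have "\<dots> = (\<Prod>j<k. of_real (onorm (f j))) * (\<Sum>i<m. \<Prod>j<k. l j (x i ! j))"
    by (simp add: fl prod.distrib sum_distrib_left)
  also have "(\<Sum>i<m. \<Prod>j<k. l j (x i ! j)) = tensor_functional k l z"
    by (rule val[symmetric]) (use l in \<open>auto simp: dual_ball_def intro: dual_space_linear\<close>)
  finally have "norm (tensor_functional k f z) = norm (\<Prod>j<k. of_real (onorm (f j)) :: 'a) * norm (tensor_functional k l z)"
    by (simp only: norm_mult)
  moreover have "norm (\<Prod>j<k. of_real (onorm (f j)) :: 'a) = (\<Prod>j<k. onorm (f j))"
    using on by (simp add: prod_norm[symmetric])
  moreover have "norm (tensor_functional k l z) \<le> J"
  proof -
    have "ennreal (norm (tensor_functional k l z)) \<le> injective_norm s k z"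
      unfolding injective_norm_def using l by (intro SUP_upper) auto
    also have "\<dots> \<le> ennreal J" by (rule J(1))
    finally show ?thesis using J(2) by (simp add: ennreal_le_iff)
  qed
  moreover have "(\<Prod>j<k. onorm (f j)) \<ge> 0" using on by (intro prod_nonneg) auto
  ultimately show ?thesis by (simp add: mult_left_mono)
qed

lemma injective_norm_finite:
  assumes s: "banach_over s" and x: "\<And>i. i < m \<Longrightarrow> length (x i) = k" and z: "z = (\<Sum>i<m::nat. elem_tensor s (x i))"
  shows "injective_norm s k z \<noteq> top"
proof -
  have "injective_norm s k z \<le> ennreal (\<Sum>i<m. \<Prod>j<k. norm (x i ! j))"
    unfolding injective_norm_def
  proof (rule SUP_least)
    fix l :: "nat \<Rightarrow> 'b \<Rightarrow> 'a" assume "l \<in> {l. \<forall>i<k. l i \<in> dual_ball s}"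
    then have l: "\<And>j. j < k \<Longrightarrow> l j \<in> dual_ball s" by simp
    interpret tf: Vector_Spaces.linear "tensor_scale :: 'a \<Rightarrow> ('a, 'b) tensor \<Rightarrow> _" "(*)" "tensor_functional k l"
      by (rule linear_tensor_functional)
    have "tensor_functional k l z = (\<Sum>i<m. \<Prod>j<k. l j (x i ! j))"
      unfolding z tf.sum using x l
      by (intro sum.cong tensor_functional_elem) (auto simp: dual_ball_def intro: dual_space_linear)
    also have "norm \<dots> \<le> (\<Sum>i<m. norm (\<Prod>j<k. l j (x i ! j)))" by (rule norm_sum)
    also have "\<dots> \<le> (\<Sum>i<m. \<Prod>j<k. norm (x i ! j))"
      unfolding prod_norm[symmetric] using l by (intro sum_mono prod_mono) (auto intro: dual_ball_bound)
    finally show "ennreal (norm (tensor_functional k l z)) \<le> ennreal (\<Sum>i<m. \<Prod>j<k. norm (x i ! j))"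
      by (rule ennreal_leI)
  qed
  then show ?thesis by (auto simp: top_unique)
qed

text \<open>The nuclear series is truncated at n because the projective norm admits finite
  representations only. The truncation contributes at most the k-th power of its partial sum times
  J. The telescoping remainder \<open>\<delta> n\<close> tends to 0, since z has finitely many terms
  and each correction contains a factor tending to 0.\<close>

lemma projective_norm_tensor_map_le:
  fixes s1 :: "'k::rc_field \<Rightarrow> 'a::banach \<Rightarrow> 'a" and s2 :: "'k \<Rightarrow> 'b::banach \<Rightarrow> 'b"
  assumes s: "banach_over s1" "banach_over s2" and T: "Vector_Spaces.linear s1 s2 T"
    and rep: "nuclear_representation s1 s2 T f y" and k: "k \<ge> 1"
    and x: "\<And>i. i < m \<Longrightarrow> length (x i) = k" and z: "z = (\<Sum>i<m::nat. elem_tensor s1 (x i))"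
    and J: "injective_norm s1 k z \<le> ennreal J" "J \<ge> 0"
  shows "projective_norm s2 k (tensor_map s2 k T z) \<le> ennreal ((\<Sum>i. onorm (f i) * norm (y i)) ^ k * J)"
proof -
  let ?c = "\<Sum>i. onorm (f i) * norm (y i)"
  interpret mp: Vector_Spaces.linear "tensor_scale :: 'k \<Rightarrow> ('k, 'a) tensor \<Rightarrow> _" tensor_scale "tensor_map s2 k T"
    by (rule linear_tensor_map)
  have f: "\<And>i. f i \<in> dual_space s1" and summ: "summable (\<lambda>i. onorm (f i) * norm (y i))"
    and sums: "\<And>x. (\<lambda>i. s2 (f i x) (y i)) sums T x"
    using rep by (auto simp: nuclear_representation_def)
  have nonneg: "0 \<le> onorm (f i)" for i
    using f[of i] by (auto simp: dual_space_def bounded_operator_def intro: onorm_pos_le)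
  define Tn where "Tn n v = (\<Sum>i<n. s2 (f i v) (y i))" for n v
  have Tn: "(\<lambda>n. Tn n v) \<longlonglongrightarrow> T v" for v using sums[of v] by (simp add: sums_def Tn_def)
  define u where "u n a j l = (if l < j then T (x a ! l) else if l = j then T (x a ! l) - Tn n (x a ! l) else Tn n (x a ! l))"
    for n a j l :: nat
  define \<delta> where "\<delta> n = (\<Sum>a<m. \<Sum>j<k. \<Prod>l<k. norm (u n a j l))" for n
  have \<delta>: "\<delta> \<longlonglongrightarrow> 0"
  proof -
    have "(\<lambda>n. \<Prod>l<k. norm (u n a j l)) \<longlonglongrightarrow> 0" if j: "j < k" for a j
    proof -
      have "(\<lambda>n. \<Prod>l<k. norm (u n a j l))
          \<longlonglongrightarrow> (\<Prod>l<k. norm (if l = j then 0 else T (x a ! l)))"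
      proof (intro tendsto_prod tendsto_norm)
        fix l
        have "(\<lambda>n. T (x a ! l) - Tn n (x a ! l)) \<longlonglongrightarrow> T (x a ! l) - T (x a ! l)"
          by (intro tendsto_diff tendsto_const Tn)
        then show "(\<lambda>n. u n a j l) \<longlonglongrightarrow> (if l = j then 0 else T (x a ! l))"
          using Tn[of "x a ! l"] unfolding u_def by (cases "l < j"; cases "l = j") auto
      qed
      also have "(\<Prod>l<k. norm (if l = j then 0 else T (x a ! l))) = 0"
        using j by (intro prod_zero) auto
      finally show ?thesis .
    qed
    then have "\<delta> \<longlonglongrightarrow> (\<Sum>a<m. \<Sum>j<k. 0)" unfolding \<delta>_def by (intro tendsto_sum) auto
    then show ?thesis by simp
  qed
  have "tensor_rep s2 k (tensor_map s2 k T z) (?c ^ k * J + \<delta> n)" for n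
  proof -
    let ?W = "multi_index k {..<n}"
    let ?e = "\<lambda>w. elem_tensor s2 (map (\<lambda>j. y (w j)) [0..<k])"
    let ?r = "\<lambda>a j. elem_tensor s2 (map (u n a j) [0..<k])"
    have el: "tensor_map s2 k T (elem_tensor s1 (x a))
        = (\<Sum>w\<in>?W. tensor_scale (\<Prod>j<k. f (w j) (x a ! j)) (?e w)) + (\<Sum>j<k. ?r a j)" if "a < m" for a
    proof -
      have m: "map h (x a) = map (\<lambda>j. h (x a ! j)) [0..<k]" for h :: "'a \<Rightarrow> 'b"
        using x[OF that] by (intro nth_equalityI) auto
      have "tensor_map s2 k T (elem_tensor s1 (x a)) = elem_tensor s2 (map T (x a))"
        using x[OF that] T by (rule tensor_map_elem)
      also have "\<dots> = elem_tensor s2 (map (\<lambda>j. Tn n (x a ! j)) [0..<k]) + (\<Sum>j<k. ?r a j)"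
        unfolding m u_def by (rule elem_tensor_telescope[OF vector_space_banach_over[OF s(2)]])
      also have "elem_tensor s2 (map (\<lambda>j. Tn n (x a ! j)) [0..<k])
          = (\<Sum>w\<in>?W. tensor_scale (\<Prod>j<k. f (w j) (x a ! j)) (?e w))"
        unfolding Tn_def by (rule elem_tensor_expand)
      finally show ?thesis .
    qed
    have "tensor_map s2 k T z = (\<Sum>a<m. tensor_map s2 k T (elem_tensor s1 (x a)))"
      by (simp add: z mp.sum)
    also have "\<dots> = (\<Sum>a<m. \<Sum>w\<in>?W. tensor_scale (\<Prod>j<k. f (w j) (x a ! j)) (?e w)) + (\<Sum>a<m. \<Sum>j<k. ?r a j)"
      by (simp add: el sum.distrib)
    \<comment> \<open>Collecting the coefficient of each tensor built from the y yields the value at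
      z of a product of the functionals; here the injective norm of z enters.\<close>
    also have "(\<Sum>a<m. \<Sum>w\<in>?W. tensor_scale (\<Prod>j<k. f (w j) (x a ! j)) (?e w))
        = (\<Sum>w\<in>?W. tensor_scale (tensor_functional k (\<lambda>j. f (w j)) z) (?e w))"
    proof -
      have "tensor_functional k (\<lambda>j. f (w j)) z = (\<Sum>a<m. \<Prod>j<k. f (w j) (x a ! j))" for w
      proof -
        interpret tf: Vector_Spaces.linear "tensor_scale :: 'k \<Rightarrow> ('k, 'a) tensor \<Rightarrow> _" "(*)" "tensor_functional k (\<lambda>j. f (w j))"
          by (rule linear_tensor_functional)
        show ?thesis unfolding z tf.sum using x
          by (intro sum.cong tensor_functional_elem) (auto intro: dual_space_linear f)
      qed
      then show ?thesis
        by (subst sum.swap) (auto simp: fun_eq_iff tensor_sum_apply tensor_scale_def sum_distrib_right intro!: sum.cong)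
    qed
    finally have eq: "tensor_map s2 k T z = (\<Sum>w\<in>?W. tensor_scale (tensor_functional k (\<lambda>j. f (w j)) z) (?e w))
        + (\<Sum>a<m. \<Sum>j<k. ?r a j)" .
    have "tensor_rep s2 k (tensor_scale (tensor_functional k (\<lambda>j. f (w j)) z) (?e w))
        (J * (\<Prod>j<k. onorm (f (w j)) * norm (y (w j))))" for w
    proof -
      have "tensor_rep s2 k (tensor_scale (tensor_functional k (\<lambda>j. f (w j)) z) (?e w))
          (norm (tensor_functional k (\<lambda>j. f (w j)) z) * (\<Prod>j<k. norm (map (\<lambda>j. y (w j)) [0..<k] ! j)))"
        by (rule tensor_rep_scaled_elem[OF s(2) k]) simp
      moreover have "norm (tensor_functional k (\<lambda>j. f (w j)) z) * (\<Prod>j<k. norm (map (\<lambda>j. y (w j)) [0..<k] ! j))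
          \<le> ((\<Prod>j<k. onorm (f (w j))) * J) * (\<Prod>j<k. norm (y (w j)))"
        using norm_tensor_functional_le[OF s(1) f x z J, of "\<lambda>j. w j"]
        by (simp add: mult_right_mono prod_nonneg)
      ultimately show ?thesis by (auto simp: prod.distrib mult_ac elim: tensor_rep_mono)
    qed
    then have "tensor_rep s2 k (\<Sum>w\<in>?W. tensor_scale (tensor_functional k (\<lambda>j. f (w j)) z) (?e w))
        (\<Sum>w\<in>?W. J * (\<Prod>j<k. onorm (f (w j)) * norm (y (w j))))"
      by (intro tensor_rep_sum finite_multi_index) auto
    moreover have "tensor_rep s2 k (\<Sum>a<m. \<Sum>j<k. ?r a j) (\<delta> n)"
      unfolding \<delta>_def
    proof (intro tensor_rep_sum finite_lessThan)
      fix a j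
      show "tensor_rep s2 k (?r a j) (\<Prod>l<k. norm (u n a j l))"
        using tensor_rep_elem[of "map (u n a j) [0..<k]" k s2] by simp
    qed
    ultimately have "tensor_rep s2 k (tensor_map s2 k T z)
        ((\<Sum>w\<in>?W. J * (\<Prod>j<k. onorm (f (w j)) * norm (y (w j)))) + \<delta> n)"
      unfolding eq by (rule tensor_rep_add)
    moreover have "(\<Sum>w\<in>?W. J * (\<Prod>j<k. onorm (f (w j)) * norm (y (w j)))) \<le> ?c ^ k * J"
    proof -
      have "(\<Sum>w\<in>?W. J * (\<Prod>j<k. onorm (f (w j)) * norm (y (w j)))) = J * (\<Sum>i<n. onorm (f i) * norm (y i)) ^ k"
        using prod_sum_PiE[of "{..<k}" "\<lambda>_. {..<n}" "\<lambda>_ i. onorm (f i) * norm (y i)"]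
        by (simp flip: sum_distrib_left)
      also have "\<dots> \<le> J * ?c ^ k"
        using J(2) nonneg by (intro mult_left_mono power_mono sum_le_suminf summ sum_nonneg) auto
      finally show ?thesis by (simp add: mult.commute)
    qed
    ultimately show ?thesis by (elim tensor_rep_mono) simp
  qed
  then have le: "projective_norm s2 k (tensor_map s2 k T z) \<le> ennreal (?c ^ k * J + \<delta> n)" for n
    by (rule tensor_rep_projective_norm)
  have lim: "(\<lambda>n. ennreal (?c ^ k * J + \<delta> n)) \<longlonglongrightarrow> ennreal (?c ^ k * J + 0)"
    by (intro tendsto_ennrealI tendsto_add tendsto_const \<delta>)
  have "projective_norm s2 k (tensor_map s2 k T z) \<le> ennreal (?c ^ k * J + 0)"
    by (rule LIMSEQ_le_const[OF lim]) (intro exI allI impI le)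
  then show ?thesis by simp
qed

proposition tau_le_nuclear_norm:
  fixes s1 :: "'k::rc_field \<Rightarrow> 'a::banach \<Rightarrow> 'a" and s2 :: "'k \<Rightarrow> 'b::banach \<Rightarrow> 'b"
  assumes s: "banach_over s1" "banach_over s2" and T: "bounded_operator s1 s2 T" and k: "k \<ge> 1"
  shows "tau s1 s2 T k \<le> nuclear_norm s1 s2 T"
  unfolding nuclear_norm_def
proof (rule INF_greatest)
  fix fy assume "fy \<in> {(f, y). nuclear_representation s1 s2 T f y}"
  then obtain f y where fy: "fy = (f, y)" and rep: "nuclear_representation s1 s2 T f y" by auto
  let ?c = "\<Sum>i. onorm (f i) * norm (y i)"
  have "0 \<le> onorm (f i)" for i
    using rep by (auto simp: nuclear_representation_def dual_space_def bounded_operator_def intro: onorm_pos_le)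
  then have c: "?c \<ge> 0" using rep by (intro suminf_nonneg) (auto simp: nuclear_representation_def)
  let ?q = "SUP z \<in> tensor_power s1 k - {0}. projective_norm s2 k (tensor_map s2 k T z) / injective_norm s1 k z"
  have q: "?q \<le> ennreal (?c ^ k)"
  proof (rule SUP_least)
    fix z assume z: "z \<in> tensor_power s1 k - {0}"
    then obtain m x where x: "\<And>i. i < m \<Longrightarrow> length (x i) = k" "z = (\<Sum>i<m::nat. elem_tensor s1 (x i))"
      using tensor_power_rep[OF s(1) k, of z] by blast
    define J where "J = enn2real (injective_norm s1 k z)"
    have J: "injective_norm s1 k z = ennreal J" "J \<ge> 0"
      using injective_norm_finite[OF s(1) x] by (auto simp: J_def less_top)
    have p: "projective_norm s2 k (tensor_map s2 k T z) \<le> ennreal (?c ^ k * J)"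
      using T J k x by (intro projective_norm_tensor_map_le[OF s _ rep]) (auto simp: bounded_operator_def)
    show "projective_norm s2 k (tensor_map s2 k T z) / injective_norm s1 k z \<le> ennreal (?c ^ k)"
    \<comment> \<open>A zero injective norm forces a zero projective norm of the image, and 0/0 is 0
      in \<open>ennreal\<close>.\<close>
    proof (cases "J = 0")
      case True
      then have "projective_norm s2 k (tensor_map s2 k T z) = 0" using p by simp
      then show ?thesis by simp
    next
      case False
      then show ?thesis unfolding J(1) using p J(2) c
        by (intro divide_le_posI_ennreal) (auto simp: mult.commute simp flip: ennreal_mult')
    qed
  qed
  have "?q \<noteq> top" using le_less_trans[OF q ennreal_less_top] by (simp only: less_top)
  moreover have "enn2real ?q \<le> ?c ^ k" using q c by (intro enn2real_leI) auto
  then have "root k (enn2real ?q) \<le> ?c"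
    using real_root_le_mono[of k "enn2real ?q" "?c ^ k"] real_root_power_cancel[of k ?c] k c by simp
  ultimately have "tau s1 s2 T k \<le> ennreal ?c"
    unfolding tau_def ennreal_root_def by (simp only: if_False ennreal_leI)
  then show "tau s1 s2 T k \<le> (case fy of (f, y) \<Rightarrow> ennreal (\<Sum>i. onorm (f i) * norm (y i)))"
    by (simp only: fy prod.case)
qed

section \<open>Nuclear representations from trace duality\<close>

lemma seminorm_nonneg:
  fixes s :: "'k::rc_field \<Rightarrow> 'v::ab_group_add \<Rightarrow> 'v" and p :: "'v \<Rightarrow> real"
  assumes "vector_space s" and "\<And>x y. p (x + y) \<le> p x + p y" and "\<And>c x. p (s c x) = norm c * p x"
  shows "p x \<ge> 0"
proof -
  interpret s: vector_space s by fact
  have "p 0 = 0" using assms(3)[of 0 0] by simp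
  moreover have "p (- x) = p x" using assms(3)[of "-1" x] by simp
  ultimately show ?thesis using assms(2)[of x "- x"] by simp
qed

text \<open>The functional c p(a) on the multiples of a by c is extended from the line through a.
  The coefficient is unique for nonzero a; for a = 0 the zero functional serves, as p(0) = 0. A
  seminorm is allowed because the nuclear norm of a system ignores its values off D.\<close>

lemma norming_functional:
  fixes s :: "'k::rc_field \<Rightarrow> 'v::ab_group_add \<Rightarrow> 'v" and p :: "'v \<Rightarrow> real"
  assumes s: "vector_space s"
    and p_add: "\<And>x y. p (x + y) \<le> p x + p y" and p_scale: "\<And>c x. p (s c x) = norm c * p x"
  obtains F where "Vector_Spaces.linear s (*) F" "\<And>x. norm (F x) \<le> p x" "F a = of_real (p a)"
proof -
  interpret s: vector_space s by fact
  have p0: "p x \<ge> 0" for x using assms by (rule seminorm_nonneg)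
  define f where "f x = (if a = 0 then 0 else (SOME c. x = s c a) * of_real (p a))" for x
  have f: "f (s c a) = c * of_real (p a)" for c
  proof (cases "a = 0")
    case True
    then show ?thesis using p_scale[of 0 0] by (simp add: f_def)
  next
    case False
    then have "(SOME d. s c a = s d a) = c" by (intro some_equality) auto
    then show ?thesis using False by (simp add: f_def)
  qed
  have sub: "s.subspace (range (\<lambda>c. s c a))"
  proof (rule s.subspaceI)
    show "0 \<in> range (\<lambda>c. s c a)" by (metis rangeI s.scale_zero_left)
    show "x + y \<in> range (\<lambda>c. s c a)" if "x \<in> range (\<lambda>c. s c a)" "y \<in> range (\<lambda>c. s c a)" for x y
      using that by (auto simp flip: s.scale_left_distrib)
    show "s c x \<in> range (\<lambda>c. s c a)" if "x \<in> range (\<lambda>c. s c a)" for c x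
      using that by auto
  qed
  obtain F where F: "Vector_Spaces.linear s (*) F" "\<And>x. x \<in> range (\<lambda>c. s c a) \<Longrightarrow> F x = f x" "\<And>x. norm (F x) \<le> p x"
  proof (rule hahn_banach[OF s p_add p_scale sub, of f])
    show "f (x + y) = f x + f y" if xy: "x \<in> range (\<lambda>c. s c a)" "y \<in> range (\<lambda>c. s c a)" for x y
    proof -
      obtain c d where "x = s c a" "y = s d a" using xy by blast
      then show ?thesis using f[of "c + d"] f[of c] f[of d] by (simp add: s.scale_left_distrib distrib_right)
    qed
    show "f (s c x) = c * f x" if x: "x \<in> range (\<lambda>c. s c a)" for c x
    proof -
      obtain d where "x = s d a" using x by blast
      then show ?thesis using f[of "c * d"] f[of d] by simp
    qed
    show "norm (f x) \<le> p x" if x: "x \<in> range (\<lambda>c. s c a)" for x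
    proof -
      obtain d where "x = s d a" using x by blast
      then show ?thesis using p0[of a] by (simp add: f p_scale norm_mult)
    qed
  qed (rule that)
  have "F a = f (s 1 a)" using F(2)[OF rangeI, of 1] by simp
  then have "F a = of_real (p a)" by (simp only: f mult_1)
  then show ?thesis using that F by blast
qed

lemma banach_norming_functional:
  assumes s: "banach_over s"
  obtains F where "Vector_Spaces.linear s (*) F" "\<And>x. norm (F x) \<le> norm x" "F a = of_real (norm a)"
  using norming_functional[OF vector_space_banach_over[OF s], of norm a]
  by (metis s banach_over.norm_scale norm_triangle_ineq)

lemma onorm_le_unit_ball:
  fixes s :: "'k::rc_field \<Rightarrow> 'a::banach \<Rightarrow> 'a"
  assumes s: "banach_over s" and f: "Vector_Spaces.linear s (*) f"
    and b: "\<And>x. norm x \<le> 1 \<Longrightarrow> norm (f x) \<le> b"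
  shows "onorm f \<le> b" "norm (f x) \<le> b * norm x"
proof -
  interpret s: banach_over s by fact
  interpret f: Vector_Spaces.linear s "(*)" f by fact
  have b0: "b \<ge> 0" using b[of 0] by simp
  have *: "norm (f x) \<le> b * norm x" for x
  proof (cases "x = 0")
    case False
    let ?c = "of_real (1 / norm x) :: 'k"
    have "norm (f (s ?c x)) \<le> b" using False by (intro b) (simp add: s.norm_scale norm_divide)
    then have "norm (f x) / norm x \<le> b" by (simp add: f.scale norm_mult norm_divide)
    then show ?thesis using False by (simp add: divide_le_eq)
  qed simp
  then show "norm (f x) \<le> b * norm x" .
  show "onorm f \<le> b" using b0 * by (rule onorm_bound)
qed

text \<open>The dual of a finite sup-norm power of X is the l1 sum of duals: test vectors can be
  chosen independently in each component. The induction exchanges one value for its supremum at a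
  time, moving the others into the varying bound b.\<close>

lemma sum_onorm_le:
  fixes s :: "'k::rc_field \<Rightarrow> 'a::banach \<Rightarrow> 'a" and \<xi> :: "'v \<Rightarrow> 'a \<Rightarrow> 'k"
  assumes s: "banach_over s" and V: "finite V" and \<xi>: "\<And>v. v \<in> V \<Longrightarrow> Vector_Spaces.linear s (*) (\<xi> v)"
    and b: "\<And>x. (\<And>v. norm (x v) \<le> 1) \<Longrightarrow> (\<Sum>v\<in>V. norm (\<xi> v (x v))) \<le> b"
  shows "(\<Sum>v\<in>V. onorm (\<xi> v)) \<le> b"
  using V \<xi> b
proof (induction V arbitrary: b rule: finite_induct)
  case empty
  then show ?case using empty(2)[of "\<lambda>_. 0"] by simp
next
  case (insert v V)
  have "norm (\<xi> v y) \<le> b - (\<Sum>v\<in>V. onorm (\<xi> v))" if y: "norm y \<le> 1" for y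
  proof -
    have "(\<Sum>v\<in>V. onorm (\<xi> v)) \<le> b - norm (\<xi> v y)"
    proof (rule insert.IH)
      fix x :: "'v \<Rightarrow> 'a" assume x: "\<And>v. norm (x v) \<le> 1"
      have "(\<Sum>u\<in>insert v V. norm (\<xi> u ((x(v := y)) u))) \<le> b"
        using x y by (intro insert.prems) auto
      moreover have "(\<Sum>u\<in>V. norm (\<xi> u ((x(v := y)) u))) = (\<Sum>u\<in>V. norm (\<xi> u (x u)))"
        using insert.hyps by (intro sum.cong) auto
      ultimately show "(\<Sum>v\<in>V. norm (\<xi> v (x v))) \<le> b - norm (\<xi> v y)"
        using insert.hyps by simp
    qed (use insert.prems in auto)
    then show ?thesis by simp
  qed
  then have "onorm (\<xi> v) \<le> b - (\<Sum>v\<in>V. onorm (\<xi> v))"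
    using insert.prems by (intro onorm_le_unit_ball[OF s]) auto
  then show ?case using insert.hyps by simp
qed

lemma vector_space_fun:
  assumes "vector_space s"
  shows "vector_space (\<lambda>c F. \<lambda>i. s c (F i))"
proof -
  interpret s: vector_space s by fact
  show ?thesis by standard (auto simp: fun_eq_iff s.scale_right_distrib s.scale_left_distrib)
qed

lemma contractive_system_scale:
  assumes s: "banach_over s" and x: "\<And>c. t * norm (\<Sum>i\<in>D. s (c i) (x i)) \<le> l2 D c" and d: "norm d \<le> t"
  shows "contractive_system s D (\<lambda>i. s d (x i))"
  unfolding contractive_system_def
proof
  fix c
  interpret s: banach_over s by fact
  have "(\<Sum>i\<in>D. s (c i) (s d (x i))) = s d (\<Sum>i\<in>D. s (c i) (x i))"
    by (simp add: s.scale_sum_right mult.commute)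
  then have "norm (\<Sum>i\<in>D. s (c i) (s d (x i))) = norm d * norm (\<Sum>i\<in>D. s (c i) (x i))"
    by (simp add: s.norm_scale)
  also have "\<dots> \<le> t * norm (\<Sum>i\<in>D. s (c i) (x i))" using d by (intro mult_right_mono) auto
  also have "\<dots> \<le> l2 D c" by (rule x)
  finally show "norm (\<Sum>i\<in>D. s (c i) (s d (x i))) \<le> l2 D c" .
qed

lemma le_mult_of_greater:
  fixes a K M :: real
  assumes "\<And>M'. M' > M \<Longrightarrow> a \<le> K * M'"
  shows "a \<le> K * M"
proof -
  have "((\<lambda>M'. K * M') \<longlongrightarrow> K * M) (at_right M)" by (intro tendsto_intros)
  moreover have "\<forall>\<^sub>F M' in at_right M. a \<le> K * M'"
    using eventually_at_right_less[of M] by (rule eventually_mono) (rule assms)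
  ultimately show ?thesis by (rule tendsto_lowerbound) simp
qed

text \<open>Systems in \<open>X\<close> are operators from a Euclidean space to \<open>X\<close>. Evaluating on a fine finite net of
  the ball embeds them almost isometrically into a finite sup-norm power of \<open>X\<close>, to which the
  functional given by \<open>f\<close> extends; the components of the extension are the \<open>\<xi>\<close>.\<close>

lemma dual_factorization:
  fixes s :: "'k::rc_field \<Rightarrow> 'a::banach \<Rightarrow> 'a" and f :: "'i \<Rightarrow> 'a \<Rightarrow> 'k"
  assumes s: "banach_over s" and D: "finite D" and f: "\<And>i. i \<in> D \<Longrightarrow> Vector_Spaces.linear s (*) (f i)"
    and C: "\<And>x r. contractive_system s D x \<Longrightarrow> (\<Sum>i\<in>D. f i (x i)) = of_real r \<Longrightarrow> r \<le> C"
    and \<eta>: "\<eta> > 0"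
  obtains V \<xi> where "finite V" "\<And>v. v \<in> V \<Longrightarrow> l2 D v \<le> 1" "\<And>v. \<xi> v \<in> dual_space s"
    "(\<Sum>v\<in>V. onorm (\<xi> v)) \<le> C + \<eta>" "\<And>i x. i \<in> D \<Longrightarrow> f i x = (\<Sum>v\<in>V. v i * \<xi> v x)"
proof -
  interpret s: banach_over s by fact
  have C0: "C \<ge> 0"
  proof -
    have "contractive_system s D (\<lambda>_. 0)" by (simp add: contractive_system_def)
    moreover have "f i 0 = 0" if "i \<in> D" for i
    proof -
      interpret fi: Vector_Spaces.linear s "(*)" "f i" using f that by blast
      show ?thesis by simp
    qed
    then have "(\<Sum>i\<in>D. f i 0) = of_real 0" by simp
    ultimately show ?thesis by (rule C)
  qed
  \<comment> \<open>Chosen so that C / (1 - \<rho>) is at most C + \<eta>; the summand 1 keeps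
    \<rho> below 1 even for C = 0.\<close>
  define \<rho> where "\<rho> = \<eta> / (C + \<eta> + 1)"
  have \<rho>: "0 < \<rho>" "\<rho> < 1" using C0 \<eta> by (auto simp: \<rho>_def divide_simps)
  define C' where "C' = C / (1 - \<rho>)"
  have C': "0 \<le> C'" "C' \<le> C + \<eta>"
  proof -
    have "\<rho> * (C + \<eta>) \<le> \<rho> * (C + \<eta> + 1)" using \<rho> by simp
    also have "\<dots> = \<eta>" using C0 \<eta> by (simp add: \<rho>_def)
    finally have "C \<le> (C + \<eta>) * (1 - \<rho>)" by (simp add: algebra_simps)
    then show "0 \<le> C'" "C' \<le> C + \<eta>" using \<rho> C0 by (auto simp: C'_def divide_le_eq)
  qed
  obtain V :: "('i \<Rightarrow> 'k) set" where V: "l2_net \<rho> D V" using l2_net_exists[OF D \<rho>(1)] by blast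
  have finV: "finite V" "V \<noteq> {}" using V by (auto simp: l2_net_def)
  define J where "J x v = (\<Sum>i\<in>D. s (v i) (x i))" for x :: "'i \<Rightarrow> 'a" and v :: "'i \<Rightarrow> 'k"
  define \<delta> :: "'i \<Rightarrow> 'i \<Rightarrow> 'k" where "\<delta> i = (\<lambda>l. if l = i then 1 else 0)" for i
  \<comment> \<open>\<open>\<phi>\<close> reads a function at the unit vectors, while
    \<open>p\<close> sees only its values on V. They are comparable on the range of J, because
    \<open>J x\<close> is linear in v and hence controlled by its values on the net.\<close>
  define \<phi> where "\<phi> F = (\<Sum>i\<in>D. f i (F (\<delta> i)))" for F :: "('i \<Rightarrow> 'k) \<Rightarrow> 'a"
  define sc where "sc c F = (\<lambda>v. s c (F v))" for c and F :: "('i \<Rightarrow> 'k) \<Rightarrow> 'a"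
  define p where "p F = C' * Max ((\<lambda>v. norm (F v)) ` V)" for F :: "('i \<Rightarrow> 'k) \<Rightarrow> 'a"
  have vs: "vector_space sc"
    unfolding sc_def by (rule vector_space_fun[OF vector_space_banach_over[OF s]])
  interpret sc: vector_space sc by (rule vs)
  have Max_ge': "norm (F v) \<le> Max ((\<lambda>v. norm (F v)) ` V)" if "v \<in> V" for F :: "('i \<Rightarrow> 'k) \<Rightarrow> 'a" and v
    using finV that by (intro Max_ge) auto
  have p_le: "p F \<le> C' * b" if "\<And>v. v \<in> V \<Longrightarrow> norm (F v) \<le> b" for F b
    unfolding p_def using finV that C' by (intro mult_left_mono Max.boundedI) auto
  have p_add: "p (F + G) \<le> p F + p G" for F G
  proof -
    have "p (F + G) \<le> C' * (Max ((\<lambda>v. norm (F v)) ` V) + Max ((\<lambda>v. norm (G v)) ` V))"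
    proof (rule p_le)
      fix v assume "v \<in> V"
      then have "norm (F v) + norm (G v) \<le> Max ((\<lambda>v. norm (F v)) ` V) + Max ((\<lambda>v. norm (G v)) ` V)"
        by (intro add_mono Max_ge')
      then show "norm ((F + G) v) \<le> Max ((\<lambda>v. norm (F v)) ` V) + Max ((\<lambda>v. norm (G v)) ` V)"
        using norm_triangle_ineq[of "F v" "G v"] by simp
    qed
    then show ?thesis by (simp add: p_def distrib_left)
  qed
  have p_scale: "p (sc c F) = norm c * p F" for c F
  proof -
    have "Max ((\<lambda>v. norm c * norm (F v)) ` V) = norm c * Max ((\<lambda>v. norm (F v)) ` V)"
      using mono_Max_commute[of "\<lambda>t. norm c * t" "(\<lambda>v. norm (F v)) ` V"] finV
      by (simp add: image_image mono_def mult_left_mono)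
    then show ?thesis by (simp add: p_def sc_def s.norm_scale)
  qed
  have J\<delta>: "J x (\<delta> i) = x i" if "i \<in> D" for x i
  proof -
    have "J x (\<delta> i) = (\<Sum>l\<in>D. if l = i then x l else 0)"
      unfolding J_def \<delta>_def by (intro sum.cong) auto
    then show ?thesis using that D by simp
  qed
  have J_le: "(1 - \<rho>) * norm (J x u) \<le> M * l2 D u" if M: "\<And>v. v \<in> V \<Longrightarrow> norm (J x v) \<le> M" for x u M
  proof -
    obtain G where G: "Vector_Spaces.linear s (*) G" "\<And>y. norm (G y) \<le> norm y" "G (J x u) = of_real (norm (J x u))"
      using banach_norming_functional[OF s] by blast
    interpret G: Vector_Spaces.linear s "(*)" G by (rule G(1))
    have GJ: "G (J x v) = (\<Sum>i\<in>D. G (x i) * v i)" for v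
      unfolding J_def by (simp add: G.sum G.scale mult.commute)
    obtain v where v: "v \<in> V" "(1 - \<rho>) * l2 D (\<lambda>i. G (x i)) \<le> kre (\<Sum>i\<in>D. G (x i) * v i)"
      using l2_net_functional[OF V, of "\<lambda>i. G (x i)"] by blast
    have "kre (\<Sum>i\<in>D. G (x i) * v i) \<le> norm (G (J x v))" using abs_kre_le[of "G (J x v)"] by (simp add: GJ)
    also have "\<dots> \<le> M" using G(2) M[OF v(1)] order_trans by blast
    finally have M': "(1 - \<rho>) * l2 D (\<lambda>i. G (x i)) \<le> M" using v(2) by simp
    have "norm (J x u) = norm (G (J x u))" by (simp add: G(3))
    also have "\<dots> \<le> l2 D (\<lambda>i. G (x i)) * l2 D u" unfolding GJ by (rule norm_sum_mult_le)
    finally have "(1 - \<rho>) * norm (J x u) \<le> (1 - \<rho>) * (l2 D (\<lambda>i. G (x i)) * l2 D u)"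
      using \<rho> by (intro mult_left_mono) auto
    also have "\<dots> \<le> M * l2 D u" unfolding mult.assoc[symmetric] using M' by (intro mult_right_mono) auto
    finally show ?thesis .
  qed
  have \<phi>_le: "norm (\<phi> (J x)) \<le> p (J x)" for x
    unfolding p_def
  proof (rule le_mult_of_greater)
    \<comment> \<open>The maximum may be 0; a strictly larger M can be divided by when x is rescaled
      to a contractive system.\<close>
    fix M assume M: "M > Max ((\<lambda>v. norm (J x v)) ` V)"
    obtain v where "v \<in> V" using finV by blast
    then have M0: "M > 0" using M Max_ge'[of v "J x"] norm_ge_zero[of "J x v"] by linarith
    let ?t = "(1 - \<rho>) / M"
    obtain c where c: "norm c = 1" "c * \<phi> (J x) = of_real (norm (\<phi> (J x)))" using rotate_to_norm by blast
    have "contractive_system s D (\<lambda>i. s (of_real ?t * c) (x i))"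
    proof (rule contractive_system_scale[OF s])
      fix u
      have "(1 - \<rho>) * norm (J x u) \<le> M * l2 D u"
        using Max_ge'[of _ "J x"] M by (intro J_le) fastforce
      then show "?t * norm (\<Sum>i\<in>D. s (u i) (x i)) \<le> l2 D u"
        using M0 by (simp add: J_def divide_le_eq mult.commute)
    qed (use \<rho> M0 c in \<open>simp add: norm_mult norm_divide flip: of_real_diff\<close>)
    moreover have "(\<Sum>i\<in>D. f i (s (of_real ?t * c) (x i))) = of_real (?t * norm (\<phi> (J x)))"
    proof -
      have "f i (s (of_real ?t * c) (x i)) = of_real ?t * (c * f i (J x (\<delta> i)))" if "i \<in> D" for i
      proof -
        interpret fi: Vector_Spaces.linear s "(*)" "f i" using f that by blast
        show ?thesis using J\<delta>[OF that] by (simp only: fi.scale mult.assoc)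
      qed
      then have "(\<Sum>i\<in>D. f i (s (of_real ?t * c) (x i))) = of_real ?t * (c * \<phi> (J x))"
        by (simp only: \<phi>_def sum_distrib_left cong: sum.cong)
      then show ?thesis by (simp only: c of_real_mult)
    qed
    ultimately have "?t * norm (\<phi> (J x)) \<le> C" by (rule C)
    then show "norm (\<phi> (J x)) \<le> C' * M" using M0 \<rho> by (simp add: C'_def field_simps)
  qed
  have J_add: "J x + J y = J (\<lambda>i. x i + y i)" and J_scale: "sc c (J x) = J (\<lambda>i. s c (x i))" for x y c
    by (auto simp: fun_eq_iff J_def sc_def s.scale_right_distrib sum.distrib s.scale_sum_right mult.commute)
  have \<phi>_lin: "\<phi> (F + G) = \<phi> F + \<phi> G" "\<phi> (sc c F) = c * \<phi> F" for F G c
  proof -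
    have "f i (F (\<delta> i) + G (\<delta> i)) = f i (F (\<delta> i)) + f i (G (\<delta> i))"
      "f i (s c (F (\<delta> i))) = c * f i (F (\<delta> i))" if "i \<in> D" for i
    proof -
      interpret fi: Vector_Spaces.linear s "(*)" "f i" using f that by blast
      show "f i (F (\<delta> i) + G (\<delta> i)) = f i (F (\<delta> i)) + f i (G (\<delta> i))"
        "f i (s c (F (\<delta> i))) = c * f i (F (\<delta> i))" by (simp_all add: fi.add fi.scale)
    qed
    then show "\<phi> (F + G) = \<phi> F + \<phi> G" "\<phi> (sc c F) = c * \<phi> F"
      by (simp_all add: \<phi>_def sc_def sum.distrib sum_distrib_left)
  qed
  have sub: "sc.subspace (range J)"
  proof (rule sc.subspaceI)
    have "J (\<lambda>_. 0) = 0" by (simp add: J_def fun_eq_iff)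
    then show "0 \<in> range J" by (metis rangeI)
  qed (use J_add J_scale in auto)
  obtain F where F: "Vector_Spaces.linear sc (*) F" "\<And>G. G \<in> range J \<Longrightarrow> F G = \<phi> G" "\<And>G. norm (F G) \<le> p G"
  proof (rule hahn_banach[OF vs p_add p_scale sub, of \<phi>])
    show "norm (\<phi> G) \<le> p G" if "G \<in> range J" for G using that \<phi>_le by blast
  qed (rule \<phi>_lin, rule \<phi>_lin, rule that)
  interpret F: Vector_Spaces.linear sc "(*)" F by (rule F(1))
  define sgl where "sgl v x = (\<lambda>v'. if v' = v then x else 0)" for v :: "'i \<Rightarrow> 'k" and x :: 'a
  define \<xi> where "\<xi> v x = F (sgl v x)" for v x
  have sgl_add: "sgl v (x + y) = sgl v x + sgl v y" and sgl_scale: "sgl v (s c x) = sc c (sgl v x)" for v x y c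
    by (auto simp: sgl_def sc_def fun_eq_iff)
  have \<xi>_lin: "Vector_Spaces.linear s (*) (\<xi> v)" for v
    unfolding Vector_Spaces.linear_iff
    by (auto simp: \<xi>_def sgl_add sgl_scale F.add F.scale vector_space_mult vector_space_banach_over[OF s])
  \<comment> \<open>G and the sum of its parts concentrated at single points of V agree on V, so
    \<open>p\<close> of the difference is 0 and F identifies them.\<close>
  have F_V: "F G = (\<Sum>v\<in>V. \<xi> v (G v))" for G
  proof -
    have eq: "(\<Sum>v\<in>V. sgl v (G v)) u = G u" if "u \<in> V" for u
      using that finV by (simp add: tensor_sum_apply sgl_def)
    have "norm (F (G - (\<Sum>v\<in>V. sgl v (G v)))) \<le> C' * 0"
      by (rule order_trans[OF F(3) p_le]) (simp add: eq)
    then have "F G = F (\<Sum>v\<in>V. sgl v (G v))" by (simp add: F.diff)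
    then show ?thesis by (simp add: F.sum \<xi>_def)
  qed
  have sum_\<xi>: "(\<Sum>v\<in>V. norm (\<xi> v (x v))) \<le> C'" if x: "\<And>v. norm (x v) \<le> 1" for x
  proof -
    have "\<forall>v. \<exists>c. norm c = 1 \<and> c * \<xi> v (x v) = of_real (norm (\<xi> v (x v)))" using rotate_to_norm by blast
    then obtain c where c: "\<And>v. norm (c v) = 1" "\<And>v. c v * \<xi> v (x v) = of_real (norm (\<xi> v (x v)))" by metis
    have "\<xi> v (s (c v) (x v)) = of_real (norm (\<xi> v (x v)))" for v
    proof -
      interpret \<xi>v: Vector_Spaces.linear s "(*)" "\<xi> v" by (rule \<xi>_lin)
      show ?thesis by (simp add: \<xi>v.scale c)
    qed
    then have "F (\<lambda>v. s (c v) (x v)) = of_real (\<Sum>v\<in>V. norm (\<xi> v (x v)))" unfolding F_V by simp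
    then have "norm (F (\<lambda>v. s (c v) (x v))) = \<bar>\<Sum>v\<in>V. norm (\<xi> v (x v))\<bar>" by (simp only: norm_of_real)
    then have "(\<Sum>v\<in>V. norm (\<xi> v (x v))) = norm (F (\<lambda>v. s (c v) (x v)))" by (simp add: sum_nonneg)
    also have "\<dots> \<le> C' * 1" by (rule order_trans[OF F(3) p_le]) (simp add: s.norm_scale c x)
    finally show ?thesis by simp
  qed
  show ?thesis
  proof (rule that)
    show "finite V" by (rule finV)
    show "l2 D v \<le> 1" if "v \<in> V" for v using V that by (simp add: l2_net_def)
    show "\<xi> v \<in> dual_space s" for v
    proof (rule dual_spaceI[OF s \<xi>_lin])
      fix x
      show "norm (\<xi> v x) \<le> C' * norm x"
        unfolding \<xi>_def by (rule order_trans[OF F(3) p_le]) (simp add: sgl_def)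
    qed
    have "(\<Sum>v\<in>V. onorm (\<xi> v)) \<le> C'" by (rule sum_onorm_le[OF s finV(1) \<xi>_lin sum_\<xi>])
    then show "(\<Sum>v\<in>V. onorm (\<xi> v)) \<le> C + \<eta>" using C' by simp
    fix i and x :: 'a assume i: "i \<in> D"
    let ?x = "\<lambda>l. if l = i then x else 0"
    have J: "J ?x = (\<lambda>v. s (v i) x)"
    proof
      fix v
      have "J ?x v = (\<Sum>l\<in>D. if l = i then s (v l) x else 0)" unfolding J_def by (intro sum.cong) auto
      then show "J ?x v = s (v i) x" using i D by simp
    qed
    have "f i x = \<phi> (J ?x)"
    proof -
      have "f l (?x l) = (if l = i then f l x else 0)" if "l \<in> D" for l
      proof -
        interpret fl: Vector_Spaces.linear s "(*)" "f l" using f that by blast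
        show ?thesis by simp
      qed
      then have "\<phi> (J ?x) = (\<Sum>l\<in>D. if l = i then f l x else 0)"
        unfolding \<phi>_def by (intro sum.cong refl) (simp add: J\<delta>)
      then show ?thesis using i D by simp
    qed
    also have "\<dots> = F (J ?x)" using F(2)[of "J ?x"] by simp
    also have "\<dots> = (\<Sum>v\<in>V. \<xi> v (s (v i) x))" unfolding J by (rule F_V)
    also have "\<dots> = (\<Sum>v\<in>V. v i * \<xi> v x)"
    proof (intro sum.cong refl)
      fix v
      interpret \<xi>v: Vector_Spaces.linear s "(*)" "\<xi> v" by (rule \<xi>_lin)
      show "\<xi> v (s (v i) x) = v i * \<xi> v x" by (rule \<xi>v.scale)
    qed
    finally show "f i x = (\<Sum>v\<in>V. v i * \<xi> v x)" .
  qed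
qed

text \<open>A norming functional for the nuclear norm \<open>\<nu>\<close> of the system \<open>a\<close> is a contraction from \<open>X\<close> to
  the Euclidean space.\<close>

lemma predual_factorization:
  fixes s :: "'k::rc_field \<Rightarrow> 'a::banach \<Rightarrow> 'a" and a :: "'i \<Rightarrow> 'a"
  assumes s: "banach_over s" and D: "finite D"
    and C: "\<And>g r. (\<And>i. i \<in> D \<Longrightarrow> Vector_Spaces.linear s (*) (g i)) \<Longrightarrow> (\<And>y. l2 D (\<lambda>i. g i y) \<le> norm y) \<Longrightarrow>
      (\<Sum>i\<in>D. g i (a i)) = of_real r \<Longrightarrow> r \<le> C"
    and \<eta>: "\<eta> > 0"
  obtains L :: "(('i \<Rightarrow> 'k) \<times> 'a) list" where "\<And>i. i \<in> D \<Longrightarrow> a i = (\<Sum>(c, x)\<leftarrow>L. s (c i) x)"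
    "(\<Sum>(c, x)\<leftarrow>L. l2 D c * norm x) \<le> C + \<eta>"
proof -
  interpret s: banach_over s by fact
  define rep where "rep b L \<longleftrightarrow> (\<forall>i\<in>D. b i = (\<Sum>(c, x)\<leftarrow>L. s (c i) x))"
    for b :: "'i \<Rightarrow> 'a" and L :: "(('i \<Rightarrow> 'k) \<times> 'a) list"
  define cost where "cost L = (\<Sum>(c, x)\<leftarrow>L. l2 D c * norm x)" for L :: "(('i \<Rightarrow> 'k) \<times> 'a) list"
  have cost0: "cost L \<ge> 0" for L unfolding cost_def by (intro sum_list_nonneg) auto
  define \<nu> where "\<nu> b = Inf (cost ` {L. rep b L})" for b
  define sc where "sc c F = (\<lambda>i. s c (F i))" for c and F :: "'i \<Rightarrow> 'a"
  have vs: "vector_space sc"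
    unfolding sc_def by (rule vector_space_fun[OF vector_space_banach_over[OF s]])
  interpret sc: vector_space sc by (rule vs)
  have \<nu>_le: "\<nu> b \<le> cost L" if "rep b L" for b L
    unfolding \<nu>_def using that cost0 by (intro cInf_lower bdd_belowI[of _ 0]) auto
  have ex: "\<exists>L. rep b L" for b
  proof -
    obtain xs where xs: "set xs = D" "distinct xs" using D finite_distinct_list by blast
    have "b i = (\<Sum>(c, x)\<leftarrow>map (\<lambda>l. (\<lambda>i. if i = l then 1 else 0, b l)) xs. s (c i) x)" if i: "i \<in> D" for i
    proof -
      have "(\<Sum>(c, x)\<leftarrow>map (\<lambda>l. (\<lambda>i. if i = l then 1 else 0, b l)) xs. s (c i) x)
          = (\<Sum>l\<leftarrow>xs. s (if i = l then 1 else 0) (b l))" by (simp add: o_def)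
      also have "\<dots> = (\<Sum>l\<in>D. s (if i = l then 1 else 0) (b l))"
        using xs by (simp add: sum_list_distinct_conv_sum_set)
      also have "\<dots> = (\<Sum>l\<in>D. if i = l then b l else 0)" by (intro sum.cong) auto
      finally show ?thesis using i D by simp
    qed
    then show ?thesis unfolding rep_def by blast
  qed
  have \<nu>_ge: "t \<le> \<nu> b" if "\<And>L. rep b L \<Longrightarrow> t \<le> cost L" for t b
    unfolding \<nu>_def using that ex[of b] by (intro cInf_greatest) auto
  have \<nu>0: "\<nu> b \<ge> 0" for b using cost0 by (intro \<nu>_ge)
  have \<nu>_add: "\<nu> (b + b') \<le> \<nu> b + \<nu> b'" for b b'
  proof -
    have *: "\<nu> (b + b') \<le> cost L + cost L'" if "rep b L" "rep b' L'" for L L'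
    proof -
      have "rep (b + b') (L @ L')" using that by (auto simp: rep_def)
      then have "\<nu> (b + b') \<le> cost (L @ L')" by (rule \<nu>_le)
      then show ?thesis by (simp add: cost_def)
    qed
    have "\<nu> (b + b') - \<nu> b' \<le> \<nu> b"
    proof (rule \<nu>_ge)
      fix L assume L: "rep b L"
      have "\<nu> (b + b') - cost L \<le> \<nu> b'"
      proof (rule \<nu>_ge)
        fix L' assume "rep b' L'"
        then show "\<nu> (b + b') - cost L \<le> cost L'" using *[OF L] by fastforce
      qed
      then show "\<nu> (b + b') - \<nu> b' \<le> cost L" by simp
    qed
    then show ?thesis by simp
  qed
  have \<nu>_scale_le: "\<nu> (sc c b) \<le> norm c * \<nu> b" for c b
  proof (cases "c = 0")
    case True
    have "rep (sc c b) []" using True by (auto simp: rep_def sc_def)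
    then have "\<nu> (sc c b) \<le> cost []" by (rule \<nu>_le)
    then show ?thesis using True by (simp add: cost_def)
  next
    case False
    have "\<nu> (sc c b) / norm c \<le> \<nu> b"
    proof (rule \<nu>_ge)
      fix L assume L: "rep b L"
      let ?L = "map (\<lambda>(d, x). (d, s c x)) L"
      have "(\<Sum>(d, x)\<leftarrow>?L. s (d i) x) = s c (\<Sum>(d, x)\<leftarrow>L. s (d i) x)" for i
        by (induction L) (auto simp: s.scale_right_distrib mult.commute)
      then have "rep (sc c b) ?L" using L by (simp add: rep_def sc_def)
      moreover have "cost ?L = norm c * cost L"
        unfolding cost_def by (induction L) (auto simp: s.norm_scale algebra_simps)
      ultimately have "\<nu> (sc c b) \<le> norm c * cost L" using \<nu>_le by metis
      then show "\<nu> (sc c b) / norm c \<le> cost L" using False by (simp add: divide_le_eq mult.commute)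
    qed
    then show ?thesis using False by (simp add: divide_le_eq mult.commute)
  qed
  have \<nu>_scale: "\<nu> (sc c b) = norm c * \<nu> b" for c b
  proof (cases "c = 0")
    case True
    then show ?thesis using \<nu>_scale_le[of c b] \<nu>0[of "sc c b"] by simp
  next
    case False
    then have "\<nu> b \<le> norm (inverse c) * \<nu> (sc c b)" using \<nu>_scale_le[of "inverse c" "sc c b"] by simp
    then have "norm c * \<nu> b \<le> norm c * (inverse (norm c) * \<nu> (sc c b))"
      unfolding norm_inverse by (intro mult_left_mono) auto
    then have "norm c * \<nu> b \<le> \<nu> (sc c b)" using False by (simp flip: mult.assoc)
    then show ?thesis using \<nu>_scale_le[of c b] by simp
  qed
  obtain F where F: "Vector_Spaces.linear sc (*) F" "\<And>b. norm (F b) \<le> \<nu> b" "F a = of_real (\<nu> a)"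
    using norming_functional[of sc \<nu> a, OF vs \<nu>_add \<nu>_scale] by blast
  interpret F: Vector_Spaces.linear sc "(*)" F by (rule F(1))
  define sgl where "sgl i x = (\<lambda>l. if l = i then x else 0)" for i :: 'i and x :: 'a
  define g where "g i x = F (sgl i x)" for i x
  have sgl_add: "sgl v (x + y) = sgl v x + sgl v y" and sgl_scale: "sgl v (s c x) = sc c (sgl v x)" for v x y c
    by (auto simp: sgl_def sc_def fun_eq_iff)
  have g_lin: "Vector_Spaces.linear s (*) (g i)" for i
    unfolding Vector_Spaces.linear_iff
    by (auto simp: g_def sgl_add sgl_scale F.add F.scale vector_space_mult vector_space_banach_over[OF s])
  have F_D: "F b = (\<Sum>i\<in>D. g i (b i))" for b
  proof -
    have "(\<Sum>i\<in>D. sgl i (b i)) l = b l" if "l \<in> D" for l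
      using that D by (simp add: tensor_sum_apply sgl_def)
    \<comment> \<open>The difference vanishes on D, so the empty list represents it at cost 0. Hence
      F depends only on the values on D.\<close>
    then have "rep (b - (\<Sum>i\<in>D. sgl i (b i))) []" by (simp add: rep_def)
    then have "norm (F (b - (\<Sum>i\<in>D. sgl i (b i)))) \<le> cost []" using F(2) \<nu>_le order_trans by blast
    then have "F b = F (\<Sum>i\<in>D. sgl i (b i))" by (simp add: F.diff cost_def)
    then show ?thesis by (simp add: F.sum g_def)
  qed
  have "l2 D (\<lambda>i. g i y) \<le> norm y" for y
  proof -
    obtain u where u: "l2 D u \<le> 1" "(\<Sum>i\<in>D. g i y * u i) = of_real (l2 D (\<lambda>i. g i y))"
      using l2_dual[of D "\<lambda>i. g i y"] by blast
    have "F (\<lambda>i. s (u i) y) = (\<Sum>i\<in>D. g i y * u i)"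
      unfolding F_D
    proof (intro sum.cong refl)
      fix i
      interpret gi: Vector_Spaces.linear s "(*)" "g i" by (rule g_lin)
      show "g i (s (u i) y) = g i y * u i" by (simp add: gi.scale mult.commute)
    qed
    then have "l2 D (\<lambda>i. g i y) = norm (F (\<lambda>i. s (u i) y))" by (simp add: u(2))
    \<comment> \<open>The system of the multiples of y by \<open>u i\<close> is represented by the
      single pair \<open>(u, y)\<close>; this turns the bound of F by \<nu> into contractivity of
      g.\<close>
    also have "\<dots> \<le> cost [(u, y)]" by (rule order_trans[OF F(2) \<nu>_le]) (simp add: rep_def)
    also have "\<dots> \<le> 1 * norm y" unfolding cost_def using mult_right_mono[OF u(1), of "norm y"] by simp
    finally show ?thesis by simp
  qed
  then have "\<nu> a \<le> C" using F(3) g_lin by (intro C[of g]) (auto simp: F_D)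
  then have "Inf (cost ` {L. rep a L}) < C + \<eta>" using \<eta> by (simp add: \<nu>_def)
  then obtain L where "rep a L" "cost L < C + \<eta>"
    using cInf_lessD[of "cost ` {L. rep a L}"] ex[of a] by auto
  then show ?thesis using that[of L] by (simp add: rep_def cost_def)
qed

section \<open>Assembling finite blocks into one nuclear series\<close>

text \<open>The blocks are padded by zeros to infinite rows, and the double sequence is enumerated
  by \<open>prod_decode\<close>. The norms are summable in any order, so the series may be regrouped
  by rows, which identifies its sum as T x.\<close>

lemma nuclear_norm_le_blocks:
  fixes s1 :: "'k::rc_field \<Rightarrow> 'a::banach \<Rightarrow> 'a" and s2 :: "'k \<Rightarrow> 'b::banach \<Rightarrow> 'b"
    and L :: "nat \<Rightarrow> (('a \<Rightarrow> 'k) \<times> 'b) list"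
  assumes s: "banach_over s1" "banach_over s2"
    and L: "\<And>m f y. (f, y) \<in> set (L m) \<Longrightarrow> f \<in> dual_space s1"
    and c: "\<And>m. (\<Sum>(f, y)\<leftarrow>L m. onorm f * norm y) \<le> c m" "c sums S"
    and T: "\<And>x. (\<lambda>m. \<Sum>(f, y)\<leftarrow>L m. s2 (f x) y) sums T x"
  shows "nuclear_norm s1 s2 T \<le> ennreal S"
proof -
  interpret s2: banach_over s2 by (rule s(2))
  define F where "F p = (case p of (m, i) \<Rightarrow> if i < length (L m) then fst (L m ! i) else (\<lambda>_. 0))" for p
  define Y where "Y p = (case p of (m, i) \<Rightarrow> if i < length (L m) then snd (L m ! i) else 0)" for p
  have zero: "(\<lambda>_. 0) \<in> dual_space s1"
    by (rule dual_spaceI[OF s(1), of _ 0])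
      (auto simp: Vector_Spaces.linear_iff vector_space_mult vector_space_banach_over[OF s(1)])
  have F: "F p \<in> dual_space s1" for p
    using zero L by (auto simp: F_def split: prod.split) (metis nth_mem prod.collapse)
  have block: "(\<Sum>i<length (L m). G (F (m, i)) (Y (m, i))) = (\<Sum>(f, y)\<leftarrow>L m. G f y)"
    for m and G :: "('a \<Rightarrow> 'k) \<Rightarrow> 'b \<Rightarrow> 'c::comm_monoid_add"
    by (simp add: sum_list_sum_nth atLeast0LessThan F_def Y_def case_prod_unfold)
  define a where "a p = onorm (F p) * norm (Y p)" for p
  have on0: "onorm (F p) \<ge> 0" for p
    using F[of p] by (auto simp: dual_space_def bounded_operator_def intro: onorm_pos_le)
  have a0: "a p \<ge> 0" for p using on0 by (simp add: a_def)
  have az: "a (m, i) = 0" if "i \<ge> length (L m)" for m i using that by (simp add: a_def Y_def)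
  have az': "a p = 0" if "length (L (fst p)) \<le> snd p" for p using az[of "fst p" "snd p"] that by simp
  have c0: "c m \<ge> 0" for m
  proof -
    have "0 \<le> (\<Sum>i<length (L m). a (m, i))" using a0 by (intro sum_nonneg)
    also have "\<dots> \<le> c m" unfolding a_def using c(1)[of m] block[of "\<lambda>f y. onorm f * norm y" m] by simp
    finally show ?thesis .
  qed
  have bound: "(\<Sum>n<N. a (prod_decode n)) \<le> S" for N
  proof -
    define K where "K = prod_decode ` {..<N}"
    have finK: "finite K" by (simp add: K_def)
    \<comment> \<open>Finitely many pairs lie in finitely many rows, so the partial sum is dominated
      by the costs of the first M blocks.\<close>
    obtain M where M: "\<And>m i. (m, i) \<in> K \<Longrightarrow> m < M"
    proof
      fix m i assume "(m, i) \<in> K"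
      then have "m \<in> fst ` K" by (intro image_eqI[of m fst "(m, i)"]) auto
      then have "m \<le> Max (fst ` K)" using finK by (intro Max_ge) auto
      then show "m < Suc (Max (fst ` K))" by simp
    qed
    have "(\<Sum>n<N. a (prod_decode n)) = (\<Sum>p\<in>K. a p)"
      unfolding K_def by (subst sum.reindex) (auto intro: inj_prod_decode)
    also have "\<dots> = (\<Sum>p\<in>{p \<in> K. snd p < length (L (fst p))}. a p)"
      by (rule sum.mono_neutral_right) (auto simp: not_less finK intro!: az')
    also have "\<dots> \<le> (\<Sum>p\<in>(SIGMA m:{..<M}. {..<length (L m)}). a p)"
      by (rule sum_mono2) (auto simp: a0 dest: M)
    also have "\<dots> = (\<Sum>m<M. \<Sum>i<length (L m). a (m, i))" by (simp add: sum.Sigma)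
    also have "\<dots> \<le> (\<Sum>m<M. c m)"
      unfolding a_def using c(1) block[of "\<lambda>f y. onorm f * norm y"] by (intro sum_mono) simp
    also have "\<dots> \<le> S"
      using sum_le_suminf[OF sums_summable[OF c(2)], of "{..<M}"] c0 sums_unique[OF c(2)] by simp
    finally show ?thesis .
  qed
  have summ: "summable (\<lambda>n. a (prod_decode n))" using a0 bound by (rule summableI_nonneg_bounded)
  have S: "(\<Sum>n. a (prod_decode n)) \<le> S" using summ bound by (rule suminf_le_const)
  have "nuclear_representation s1 s2 T (\<lambda>n. F (prod_decode n)) (\<lambda>n. Y (prod_decode n))"
    unfolding nuclear_representation_def
  proof (intro conjI allI)
    show "F (prod_decode i) \<in> dual_space s1" for i by (rule F)
    show "summable (\<lambda>i. onorm (F (prod_decode i)) * norm (Y (prod_decode i)))" using summ by (simp add: a_def)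
    fix x
    define h where "h p = s2 (F p x) (Y p)" for p
    have hn: "norm (h p) \<le> a p * norm x" for p
    proof -
      have "norm (h p) = norm (F p x) * norm (Y p)" by (simp add: h_def s2.norm_scale)
      also have "\<dots> \<le> (onorm (F p) * norm x) * norm (Y p)" by (intro mult_right_mono dual_space_bound[OF F]) auto
      finally show ?thesis by (simp add: a_def mult_ac)
    qed
    have sn: "summable (\<lambda>n. norm (h (prod_decode n)))"
      by (rule summable_comparison_test'[OF summable_mult2[OF summ, of "norm x"], of 0]) (simp add: hn)
    then have "(\<lambda>n. h (prod_decode n)) summable_on UNIV" by (rule norm_summable_imp_summable_on)
    then have "h summable_on UNIV"
      using summable_on_reindex_bij_betw[OF bij_prod_decode, of h] by simp
    then obtain t where t: "(h has_sum t) UNIV" by (auto simp: summable_on_def)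
    have "((\<lambda>m. \<Sum>i<length (L m). h (m, i)) has_sum t) UNIV"
    proof (rule has_sum_SigmaD[of h UNIV "\<lambda>_. UNIV"])
      show "(h has_sum t) (SIGMA _:UNIV. UNIV)" using t by simp
      fix m
      show "((\<lambda>i. h (m, i)) has_sum (\<Sum>i<length (L m). h (m, i))) UNIV"
        by (rule has_sum_finite_neutralI[of "{..<length (L m)}"]) (auto simp: h_def Y_def)
    qed
    then have "((\<lambda>m. \<Sum>(f, y)\<leftarrow>L m. s2 (f x) y) has_sum t) UNIV"
      unfolding h_def block[of "\<lambda>f y. s2 (f x) y"] .
    then have "(\<lambda>m. \<Sum>(f, y)\<leftarrow>L m. s2 (f x) y) sums t" by (rule has_sum_imp_sums)
    then have "t = T x" using T sums_unique2 by blast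
    moreover have "((\<lambda>n. h (prod_decode n)) has_sum t) UNIV"
      using has_sum_reindex_bij_betw[OF bij_prod_decode, of h t] t by simp
    ultimately show "(\<lambda>i. s2 (F (prod_decode i) x) (Y (prod_decode i))) sums T x"
      using has_sum_imp_sums unfolding h_def by blast
  qed
  then have "nuclear_norm s1 s2 T \<le> ennreal (\<Sum>n. a (prod_decode n))"
    unfolding nuclear_norm_def a_def by (intro INF_lower2[of "(\<lambda>n. F (prod_decode n), \<lambda>n. Y (prod_decode n))"]) auto
  also have "\<dots> \<le> ennreal S" using S by (rule ennreal_leI)
  finally show ?thesis .
qed

section \<open>Operators into and out of a Hilbert space\<close>

context hilbert_over
begin

section \<open>Inner products and finite orthonormal systems\<close>

lemma vs: "vector_space scale" ..

lemma banach: "banach_over scale" ..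

lemma ip_add_left: "ip (x + y) z = ip x z + ip y z"
  and ip_scale_left: "ip (scale c x) z = c * ip x z"
  using ip_linear[of z] by (auto simp: Vector_Spaces.linear_iff)

lemma ip_zero_left [simp]: "ip 0 z = 0"
  using ip_scale_left[of 0 0 z] by simp

lemma ip_sum_left: "ip (\<Sum>a\<in>A. F a) z = (\<Sum>a\<in>A. ip (F a) z)"
  by (induction A rule: infinite_finite_induct) (auto simp: ip_add_left)

lemma ip_diff_left: "ip (x - y) z = ip x z - ip y z"
  using ip_add_left[of "x - y" y z] by simp

text \<open>A finite set indexed by its own elements: the vector e itself serves as the index in
  \<open>l2 E\<close> and in systems over E.\<close>

definition orthonormal :: "'a set \<Rightarrow> bool"
  where "orthonormal E \<longleftrightarrow> finite E \<and> (\<forall>e\<in>E. norm e = 1) \<and> (\<forall>e\<in>E. \<forall>e'\<in>E. e \<noteq> e' \<longrightarrow> ip e e' = 0)"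

lemma orthonormal_mono: "orthonormal E \<Longrightarrow> F \<subseteq> E \<Longrightarrow> orthonormal F"
  unfolding orthonormal_def by (meson finite_subset subsetD)

lemma ip_orthonormal: "orthonormal E \<Longrightarrow> e \<in> E \<Longrightarrow> e' \<in> E \<Longrightarrow> ip e e' = (if e = e' then 1 else 0)"
  using ip_norm[of e] by (auto simp: orthonormal_def)

lemma ip_expansion:
  assumes E: "orthonormal E" and e: "e \<in> E"
  shows "ip (\<Sum>e\<in>E. scale (c e) e) e = c e"
proof -
  have "ip (\<Sum>e\<in>E. scale (c e) e) e = (\<Sum>e'\<in>E. if e' = e then c e' else 0)"
    unfolding ip_sum_left ip_scale_left using e by (intro sum.cong) (auto simp: ip_orthonormal[OF E])
  then show ?thesis using E e by (simp add: orthonormal_def)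
qed

lemma ip_expansion_left:
  "ip (\<Sum>e\<in>E. scale (c e) e) x = (\<Sum>e\<in>E. c e * kconj (ip x e))"
  unfolding ip_sum_left ip_scale_left by (intro sum.cong refl) (metis ip_conj)

lemma norm_expansion:
  assumes E: "orthonormal E"
  shows "norm (\<Sum>e\<in>E. scale (c e) e) = l2 E c"
proof -
  let ?x = "\<Sum>e\<in>E. scale (c e) e"
  have "ip ?x ?x = (\<Sum>e\<in>E. c e * kconj (ip ?x e))" by (rule ip_expansion_left)
  also have "\<dots> = (\<Sum>e\<in>E. c e * kconj (c e))"
    by (intro sum.cong refl) (simp only: ip_expansion[OF E])
  also have "\<dots> = of_real ((l2 E c)\<^sup>2)" by (simp only: mult_kconj l2_power2 of_real_sum)
  finally have "of_real ((norm ?x)\<^sup>2) = (of_real ((l2 E c)\<^sup>2) :: 'k)" by (simp only: ip_norm)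
  then have "(norm ?x)\<^sup>2 = (l2 E c)\<^sup>2" by (simp only: of_real_eq_iff)
  then show ?thesis by simp
qed

definition proj :: "'a set \<Rightarrow> 'a \<Rightarrow> 'a"
  where "proj E h = (\<Sum>e\<in>E. scale (ip h e) e)"

lemma ip_residual: "orthonormal E \<Longrightarrow> e \<in> E \<Longrightarrow> ip (h - proj E h) e = 0"
  by (simp add: ip_diff_left proj_def ip_expansion)

lemma pythagoras:
  assumes E: "orthonormal E"
  shows "(norm h)\<^sup>2 = (norm (h - proj E h))\<^sup>2 + (l2 E (\<lambda>e. ip h e))\<^sup>2"
proof -
  let ?r = "h - proj E h"
  have 0: "ip (proj E h) ?r = 0"
    unfolding proj_def ip_expansion_left using ip_residual[OF E, unfolded proj_def] by (intro sum.neutral) simp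
  then have 1: "ip ?r (proj E h) = 0" using ip_conj[of ?r "proj E h"] by simp
  have right: "ip x (?r + proj E h) = ip x ?r + ip x (proj E h)" for x
    by (metis ip_add_left ip_conj kconj_add)
  have "ip h h = ip (?r + proj E h) (?r + proj E h)" by simp
  also have "\<dots> = ip ?r ?r + ip (proj E h) (proj E h)" by (simp only: ip_add_left right 0 1 add_0_left add_0_right)
  finally have "of_real ((norm h)\<^sup>2) = (of_real ((norm ?r)\<^sup>2 + (norm (proj E h))\<^sup>2) :: 'k)"
    by (simp only: ip_norm of_real_add)
  then have "(norm h)\<^sup>2 = (norm ?r)\<^sup>2 + (norm (proj E h))\<^sup>2" by (simp only: of_real_eq_iff)
  then show ?thesis by (simp add: proj_def norm_expansion[OF E])
qed

lemma bessel: "orthonormal E \<Longrightarrow> l2 E (\<lambda>e. ip h e) \<le> norm h"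
  by (rule power2_le_imp_le) (use pythagoras[of E h] in auto)

lemma norm_residual_le: "orthonormal E \<Longrightarrow> norm (h - proj E h) \<le> norm h"
  by (rule power2_le_imp_le) (use pythagoras[of E h] in auto)

text \<open>The normalized residual is the one extra direction against which the error of a
  compression is tested: its pairing with h recovers the whole residual norm.\<close>

lemma residual_direction:
  assumes E: "orthonormal E" and h: "h - proj E h \<noteq> 0"
  obtains e where "orthonormal (E \<union> {e})" "E \<inter> {e} = {}" "orthonormal {e}"
    "ip h e = of_real (norm (h - proj E h))" "h - proj E h = scale (of_real (norm (h - proj E h))) e"
proof -
  let ?r = "h - proj E h"
  define e where "e = scale (of_real (1 / norm ?r)) ?r"
  have ne: "norm e = 1" using h by (simp add: e_def norm_scale norm_divide)
  have 0: "ip e e' = 0" if "e' \<in> E" for e'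
    using ip_residual[OF E that] by (simp only: e_def ip_scale_left mult_zero_right)
  have zr: "ip e' e = 0" if "e' \<in> E" for e' using ip_conj[of e' e] 0[OF that] by simp
  have 1: "ip e e = 1" using ip_norm[of e] ne by simp
  have nE: "e \<notin> E" using 0[of e] 1 by auto
  have r: "?r = scale (of_real (norm ?r)) e" using h by (simp add: e_def scale_of_real)
  have "ip (proj E h) e = 0" unfolding proj_def ip_sum_left ip_scale_left using zr by simp
  then have "ip h e = ip ?r e" by (simp add: ip_diff_left)
  also have "\<dots> = of_real (norm ?r) * ip e e" by (subst r) (simp only: ip_scale_left)
  finally have "ip h e = of_real (norm ?r)" using 1 by simp
  moreover have "orthonormal (E \<union> {e})" using E ne 0 zr by (auto simp: orthonormal_def)
  ultimately show ?thesis using that[of e] nE r orthonormal_mono[of "E \<union> {e}" "{e}"] by auto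
qed

text \<open>The squares of the values over orthogonal systems add up, so a system whose value is almost
  maximal leaves little over for all systems orthogonal to it.\<close>

lemma exhaustion_step:
  fixes Val :: "'a set \<Rightarrow> real set"
  assumes bound: "\<And>E r. orthonormal E \<Longrightarrow> r \<in> Val E \<Longrightarrow> r \<le> C"
    and zero: "\<And>E. 0 \<in> Val E"
    and comb: "\<And>E F r t \<alpha> \<beta>. orthonormal (E \<union> F) \<Longrightarrow> E \<inter> F = {} \<Longrightarrow> r \<in> Val E \<Longrightarrow> t \<in> Val F \<Longrightarrow>
      \<alpha> \<ge> 0 \<Longrightarrow> \<beta> \<ge> 0 \<Longrightarrow> \<alpha>\<^sup>2 + \<beta>\<^sup>2 = 1 \<Longrightarrow> \<alpha> * r + \<beta> * t \<in> Val (E \<union> F)"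
    and A: "orthonormal A" and \<delta>: "\<delta> > 0"
  obtains B where "A \<subseteq> B" "orthonormal B"
    "\<And>E r. orthonormal (B \<union> E) \<Longrightarrow> B \<inter> E = {} \<Longrightarrow> r \<in> Val E \<Longrightarrow> r \<le> \<delta>"
proof -
  \<comment> \<open>The squared values over systems orthogonal to A; the D chosen below comes within
    \<delta>^2 of their supremum.\<close>
  define Z where "Z = {r\<^sup>2 |r D. r \<ge> 0 \<and> orthonormal (A \<union> D) \<and> A \<inter> D = {} \<and> r \<in> Val D}"
  have "z \<le> C\<^sup>2" if z: "z \<in> Z" for z
  proof -
    obtain r D where "z = r\<^sup>2" "r \<ge> 0" "orthonormal (A \<union> D)" "r \<in> Val D" using z by (auto simp: Z_def)
    then show ?thesis using bound[of D r] orthonormal_mono[of "A \<union> D" D] power_mono[of r C 2] by simp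
  qed
  then have bdd: "bdd_above Z" by (rule bdd_aboveI)
  have "0\<^sup>2 \<in> Z" unfolding Z_def using A zero by (intro CollectI exI[of _ 0] exI[of _ "{}"]) auto
  then have "\<exists>z\<in>Z. Sup Z - \<delta>\<^sup>2 < z" using \<delta> bdd by (subst less_cSup_iff[symmetric]) auto
  then obtain r D where D: "r \<ge> 0" "orthonormal (A \<union> D)" "A \<inter> D = {}" "r \<in> Val D" "Sup Z - \<delta>\<^sup>2 < r\<^sup>2"
    by (auto simp: Z_def)
  show ?thesis
  proof (rule that[of "A \<union> D"])
    fix E t assume E: "orthonormal (A \<union> D \<union> E)" "(A \<union> D) \<inter> E = {}" "t \<in> Val E"
    show "t \<le> \<delta>"
    proof (rule ccontr)
      assume "\<not> t \<le> \<delta>"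
      then have t: "t > \<delta>" by simp
      define R where "R = sqrt (r\<^sup>2 + t\<^sup>2)"
      have R2: "R\<^sup>2 = r\<^sup>2 + t\<^sup>2" by (simp add: R_def)
      have R0: "R > 0" using t \<delta> by (auto simp: R_def intro: add_nonneg_pos)
      \<comment> \<open>The weights r/R and t/R form the unit vector maximizing \<alpha> r + \<beta>
        t, with maximum R. So R^2 = r^2 + t^2 is again at most the supremum, which is impossible for
        t > \<delta>.\<close>
      have "(r / R) * r + (t / R) * t \<in> Val (D \<union> E)"
      proof (rule comb)
        show "orthonormal (D \<union> E)" using E(1) by (rule orthonormal_mono) auto
        show "(r / R)\<^sup>2 + (t / R)\<^sup>2 = 1"
          unfolding power_divide add_divide_distrib[symmetric] R2[symmetric] using R0 by simp
      qed (use E D t \<delta> R0 in auto)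
      also have "(r / R) * r + (t / R) * t = (r\<^sup>2 + t\<^sup>2) / R"
        by (simp add: power2_eq_square add_divide_distrib)
      also have "\<dots> = R" unfolding R2[symmetric] using R0 by (simp add: power2_eq_square)
      finally have "R\<^sup>2 \<in> Z" unfolding Z_def using R0 E D
        by (intro CollectI exI[of _ R] exI[of _ "D \<union> E"]) (auto simp: Un_assoc)
      then have "r\<^sup>2 + t\<^sup>2 \<le> Sup Z" using bdd R2 cSup_upper by metis
      then have "t\<^sup>2 < \<delta>\<^sup>2" using D(5) by simp
      moreover have "\<delta>\<^sup>2 < t\<^sup>2" using t \<delta> by (intro power_strict_mono) auto
      ultimately show False by linarith
    qed
  qed (use D in auto)
qed

text \<open>\<open>Val E\<close> stands for the real trace values attainable over E and
  \<open>q e\<close> for the part of the operator of rank at most one at e; kept abstract, they let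
  operators into and out of the Hilbert space share the argument. \<open>block\<close> represents a
  compression at a cost close to its largest value, and \<open>conv\<close> controls the error of a
  compression by the values over systems orthogonal to it.\<close>

lemma nuclear_norm_le_exhaustion:
  fixes s1 :: "'k \<Rightarrow> 'c::banach \<Rightarrow> 'c" and s2 :: "'k \<Rightarrow> 'd::banach \<Rightarrow> 'd"
  assumes s: "banach_over s1" "banach_over s2"
    and bound: "\<And>E r. orthonormal E \<Longrightarrow> r \<in> Val E \<Longrightarrow> r \<le> C"
    and zero: "\<And>E. 0 \<in> Val E"
    and comb: "\<And>E F r t \<alpha> \<beta>. orthonormal (E \<union> F) \<Longrightarrow> E \<inter> F = {} \<Longrightarrow> r \<in> Val E \<Longrightarrow> t \<in> Val F \<Longrightarrow>
      \<alpha> \<ge> 0 \<Longrightarrow> \<beta> \<ge> 0 \<Longrightarrow> \<alpha>\<^sup>2 + \<beta>\<^sup>2 = 1 \<Longrightarrow> \<alpha> * r + \<beta> * t \<in> Val (E \<union> F)"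
    and block: "\<And>D b \<eta>. orthonormal D \<Longrightarrow> (\<And>r. r \<in> Val D \<Longrightarrow> r \<le> b) \<Longrightarrow> \<eta> > 0 \<Longrightarrow>
      \<exists>L. (\<forall>(f, y)\<in>set L. f \<in> dual_space s1) \<and> (\<Sum>(f, y)\<leftarrow>L. onorm f * norm y) \<le> b + \<eta> \<and>
        (\<forall>x. (\<Sum>(f, y)\<leftarrow>L. s2 (f x) y) = (\<Sum>e\<in>D. q e x))"
    and conv: "\<And>E b x. orthonormal E \<Longrightarrow>
      (\<And>F r. orthonormal (E \<union> F) \<Longrightarrow> E \<inter> F = {} \<Longrightarrow> r \<in> Val F \<Longrightarrow> r \<le> b) \<Longrightarrow>
      norm (T x - (\<Sum>e\<in>E. q e x)) \<le> b * norm x"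
  shows "nuclear_norm s1 s2 T \<le> ennreal C"
proof (rule ennreal_le_epsilon)
  fix \<epsilon> :: real assume \<epsilon>: "0 < \<epsilon>"
  have C0: "C \<ge> 0" using bound[of "{}" 0] zero by (simp add: orthonormal_def)
  \<comment> \<open>Total mass \<epsilon>/2, spent twice: as the bound on the values left over after
    a stage and as the slack in representing a block.\<close>
  define \<delta> where "\<delta> m = \<epsilon> * (1/2) ^ (m + 2)" for m
  have \<delta>0: "\<delta> m > 0" for m using \<epsilon> by (simp add: \<delta>_def)
  have \<delta>s: "\<delta> sums (\<epsilon> / 2)"
  proof -
    have "(\<lambda>m. (\<epsilon> / 4) * (1/2) ^ m) sums ((\<epsilon> / 4) * (1 / (1 - 1/2)))"
      by (intro sums_mult geometric_sums) simp
    then show ?thesis by (simp add: \<delta>_def[abs_def] power_add)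
  qed
  have "\<exists>A. \<forall>m. (orthonormal (A m) \<and> (m = 0 \<longrightarrow> A m = {})) \<and> (A m \<subseteq> A (Suc m) \<and>
    (\<forall>E r. orthonormal (A (Suc m) \<union> E) \<longrightarrow> A (Suc m) \<inter> E = {} \<longrightarrow> r \<in> Val E \<longrightarrow> r \<le> \<delta> m))"
  proof (rule dependent_nat_choice)
    show "\<exists>A. orthonormal A \<and> (0 = (0::nat) \<longrightarrow> A = {})" by (auto simp: orthonormal_def)
    fix A and m :: nat assume A: "orthonormal A \<and> (m = 0 \<longrightarrow> A = {})"
    obtain B where "A \<subseteq> B" "orthonormal B"
      "\<And>E r. orthonormal (B \<union> E) \<Longrightarrow> B \<inter> E = {} \<Longrightarrow> r \<in> Val E \<Longrightarrow> r \<le> \<delta> m"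
    proof (rule exhaustion_step[of Val C A "\<delta> m"])
      show "r \<le> C" if "orthonormal E" "r \<in> Val E" for E r using that by (rule bound)
      show "\<alpha> * r + \<beta> * t \<in> Val (E \<union> F)" if "orthonormal (E \<union> F)" "E \<inter> F = {}" "r \<in> Val E" "t \<in> Val F"
        "\<alpha> \<ge> 0" "\<beta> \<ge> 0" "\<alpha>\<^sup>2 + \<beta>\<^sup>2 = 1" for E F r t \<alpha> \<beta>
        using that by (rule comb)
      show "orthonormal A" using A by blast
    qed (rule zero, rule \<delta>0, rule that)
    then show "\<exists>B. (orthonormal B \<and> (Suc m = 0 \<longrightarrow> B = {})) \<and> A \<subseteq> B \<and>
        (\<forall>E r. orthonormal (B \<union> E) \<longrightarrow> B \<inter> E = {} \<longrightarrow> r \<in> Val E \<longrightarrow> r \<le> \<delta> m)" by blast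
  qed
  then obtain A where A': "\<forall>m. (orthonormal (A m) \<and> (m = 0 \<longrightarrow> A m = {})) \<and> (A m \<subseteq> A (Suc m) \<and>
      (\<forall>E r. orthonormal (A (Suc m) \<union> E) \<longrightarrow> A (Suc m) \<inter> E = {} \<longrightarrow> r \<in> Val E \<longrightarrow> r \<le> \<delta> m))"
    by (rule exE)
  have A: "A 0 = {}" "\<And>m. orthonormal (A m)" "\<And>m. A m \<subseteq> A (Suc m)"
    "\<And>m E r. orthonormal (A (Suc m) \<union> E) \<Longrightarrow> A (Suc m) \<inter> E = {} \<Longrightarrow> r \<in> Val E \<Longrightarrow> r \<le> \<delta> m"
    using A' by simp_all
  define D where "D m = A (Suc m) - A m" for m
  \<comment> \<open>Block 0 is the whole first system and is bounded by C. Block n + 1 is orthogonal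
    to \<open>A (Suc n)\<close>, hence the shifted index in its bound \<delta> n.\<close>
  define b where "b m = (case m of 0 \<Rightarrow> C | Suc n \<Rightarrow> \<delta> n)" for m
  have oD: "orthonormal (D m)" for m using A(2)[of "Suc m"] by (rule orthonormal_mono) (auto simp: D_def)
  have bD: "r \<le> b m" if "r \<in> Val (D m)" for r m
  proof (cases m)
    case 0
    then show ?thesis using bound[OF oD that] by (simp add: b_def)
  next
    case (Suc n)
    have "A (Suc n) \<union> D (Suc n) = A (Suc (Suc n))" using A(3)[of "Suc n"] by (auto simp: D_def)
    then show ?thesis using that Suc A(2)[of "Suc (Suc n)"] by (auto simp: b_def D_def intro!: A(4)[of n "D (Suc n)"])
  qed
  have "\<forall>m. \<exists>L. (\<forall>(f, y)\<in>set L. f \<in> dual_space s1) \<and> (\<Sum>(f, y)\<leftarrow>L. onorm f * norm y) \<le> b m + \<delta> m \<and>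
        (\<forall>x. (\<Sum>(f, y)\<leftarrow>L. s2 (f x) y) = (\<Sum>e\<in>D m. q e x))"
    using block[OF oD bD \<delta>0] by blast
  from choice[OF this] obtain L where L': "\<forall>m. (\<forall>(f, y)\<in>set (L m). f \<in> dual_space s1) \<and>
      (\<Sum>(f, y)\<leftarrow>L m. onorm f * norm y) \<le> b m + \<delta> m \<and>
      (\<forall>x. (\<Sum>(f, y)\<leftarrow>L m. s2 (f x) y) = (\<Sum>e\<in>D m. q e x))"
    by (rule exE)
  have L: "\<And>m f y. (f, y) \<in> set (L m) \<Longrightarrow> f \<in> dual_space s1"
    "\<And>m. (\<Sum>(f, y)\<leftarrow>L m. onorm f * norm y) \<le> b m + \<delta> m"
    "\<And>m x. (\<Sum>(f, y)\<leftarrow>L m. s2 (f x) y) = (\<Sum>e\<in>D m. q e x)"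
    using L' by blast+
  have "(\<lambda>m. b (Suc m)) sums (\<epsilon> / 2)" using \<delta>s by (simp add: b_def)
  then have "b sums (\<epsilon> / 2 + C)" using sums_Suc_iff[of b "\<epsilon> / 2"] by (simp add: b_def)
  then have c: "(\<lambda>m. b m + \<delta> m) sums (\<epsilon> / 2 + C + \<epsilon> / 2)" using \<delta>s by (rule sums_add)
  have "nuclear_norm s1 s2 T \<le> ennreal (\<epsilon> / 2 + C + \<epsilon> / 2)"
  proof (rule nuclear_norm_le_blocks[OF s L(1) L(2) c])
    fix x
    have partial: "(\<Sum>m<n. \<Sum>e\<in>D m. q e x) = (\<Sum>e\<in>A n. q e x)" for n
    proof (induction n)
      case (Suc n)
      have "(\<Sum>e\<in>A (Suc n). q e x) = (\<Sum>e\<in>D n. q e x) + (\<Sum>e\<in>A n. q e x)"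
        unfolding D_def using A(2)[of "Suc n"] A(3)[of n] by (intro sum.subset_diff) (auto simp: orthonormal_def)
      then show ?case using Suc by (simp add: add.commute)
    qed (simp add: A(1))
    have "(\<lambda>n. T x - (\<Sum>e\<in>A (Suc n). q e x)) \<longlonglongrightarrow> 0"
    proof (rule Lim_null_comparison)
      show "\<forall>\<^sub>F n in sequentially. norm (T x - (\<Sum>e\<in>A (Suc n). q e x)) \<le> \<delta> n * norm x"
        using A(2,4) by (intro always_eventually allI conv) auto
      have "(\<lambda>n. \<delta> n * norm x) \<longlonglongrightarrow> 0 * norm x"
        using summable_LIMSEQ_zero[OF sums_summable[OF \<delta>s]] by (intro tendsto_intros)
      then show "(\<lambda>n. \<delta> n * norm x) \<longlonglongrightarrow> 0" by simp
    qed
    then have "(\<lambda>n. T x - (\<Sum>e\<in>A n. q e x)) \<longlonglongrightarrow> 0" by (rule LIMSEQ_imp_Suc)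
    then have "(\<lambda>n. T x - (T x - (\<Sum>e\<in>A n. q e x))) \<longlonglongrightarrow> T x - 0" by (intro tendsto_intros)
    then show "(\<lambda>m. \<Sum>(f, y)\<leftarrow>L m. s2 (f x) y) sums T x"
      unfolding sums_def L(3) partial by simp
  qed
  also have "\<epsilon> / 2 + C + \<epsilon> / 2 = C + \<epsilon>" by simp
  finally show "nuclear_norm s1 s2 T \<le> ennreal C + ennreal \<epsilon>" using C0 \<epsilon> by simp
qed

lemma l2_Un_disjoint: "finite E \<Longrightarrow> finite F \<Longrightarrow> E \<inter> F = {} \<Longrightarrow> (l2 (E \<union> F) c)\<^sup>2 = (l2 E c)\<^sup>2 + (l2 F c)\<^sup>2"
  unfolding l2_power2 by (rule sum.union_disjoint)

text \<open>A value over E is the trace of a contraction from the Euclidean space on E into X,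
  followed by T and the coordinates along E. Contractions over disjoint systems, weighted by
  \<alpha> and \<beta>, combine to a contraction by Cauchy-Schwarz;
  \<open>dual_factorization\<close> represents the coordinate functionals of T.\<close>

lemma nuclear_norm_into:
  fixes s :: "'k \<Rightarrow> 'c::banach \<Rightarrow> 'c"
  assumes s: "banach_over s" and T: "bounded_operator s scale T"
    and C: "\<And>E x. orthonormal E \<Longrightarrow> contractive_system s E x \<Longrightarrow> norm (\<Sum>e\<in>E. ip (T (x e)) e) \<le> C"
  shows "nuclear_norm s scale T \<le> ennreal C"
proof -
  interpret s: banach_over s by fact
  interpret T: Vector_Spaces.linear s scale T using T by (simp add: bounded_operator_def)
  define Val where "Val E = {r. \<exists>x. contractive_system s E x \<and> (\<Sum>e\<in>E. ip (T (x e)) e) = of_real r}" for E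
  have lin: "Vector_Spaces.linear s (*) (\<lambda>x. ip (T x) e)" for e
    unfolding Vector_Spaces.linear_iff
    by (auto simp: T.add T.scale ip_add_left ip_scale_left vector_space_mult vector_space_banach_over[OF s])
  show ?thesis
  proof (rule nuclear_norm_le_exhaustion[OF s banach, of Val C "\<lambda>e x. scale (ip (T x) e) e" T])
    show "r \<le> C" if "orthonormal E" "r \<in> Val E" for E r
      using that C[of E] by (fastforce simp: Val_def)
    show "0 \<in> Val E" for E
      unfolding Val_def by (intro CollectI exI[of _ "\<lambda>_. 0"]) (simp add: contractive_system_def)
  next
    fix E F r t and \<alpha> \<beta> :: real
    assume EF: "orthonormal (E \<union> F)" "E \<inter> F = {}" and r: "r \<in> Val E" and t: "t \<in> Val F"
      and ab: "\<alpha> \<ge> 0" "\<beta> \<ge> 0" "\<alpha>\<^sup>2 + \<beta>\<^sup>2 = 1"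
    obtain x where x: "contractive_system s E x" "(\<Sum>e\<in>E. ip (T (x e)) e) = of_real r" using r by (auto simp: Val_def)
    obtain y where y: "contractive_system s F y" "(\<Sum>e\<in>F. ip (T (y e)) e) = of_real t" using t by (auto simp: Val_def)
    define w where "w e = (if e \<in> E then s (of_real \<alpha>) (x e) else s (of_real \<beta>) (y e))" for e
    have fin: "finite E" "finite F" using EF(1) by (auto simp: orthonormal_def)
    have wE: "(\<Sum>e\<in>E. G (w e) e) = (\<Sum>e\<in>E. G (s (of_real \<alpha>) (x e)) e)"
      and wF: "(\<Sum>e\<in>F. G (w e) e) = (\<Sum>e\<in>F. G (s (of_real \<beta>) (y e)) e)" for G :: "'c \<Rightarrow> 'a \<Rightarrow> 'e::comm_monoid_add"
      using EF(2) by (auto simp: w_def intro!: sum.cong)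
    have "contractive_system s (E \<union> F) w"
      unfolding contractive_system_def
    proof
      fix c
      have "(\<Sum>e\<in>E \<union> F. s (c e) (w e)) = (\<Sum>e\<in>E. s (c e) (w e)) + (\<Sum>e\<in>F. s (c e) (w e))"
        using fin EF(2) by (rule sum.union_disjoint)
      also have "\<dots> = s (of_real \<alpha>) (\<Sum>e\<in>E. s (c e) (x e)) + s (of_real \<beta>) (\<Sum>e\<in>F. s (c e) (y e))"
        unfolding wE[of "\<lambda>v e. s (c e) v"] wF[of "\<lambda>v e. s (c e) v"] by (simp add: s.scale_sum_right mult.commute)
      finally have "norm (\<Sum>e\<in>E \<union> F. s (c e) (w e))
          \<le> norm (s (of_real \<alpha>) (\<Sum>e\<in>E. s (c e) (x e))) + norm (s (of_real \<beta>) (\<Sum>e\<in>F. s (c e) (y e)))"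
        by (simp only: norm_triangle_ineq)
      also have "\<dots> = \<alpha> * norm (\<Sum>e\<in>E. s (c e) (x e)) + \<beta> * norm (\<Sum>e\<in>F. s (c e) (y e))"
        using ab by (simp add: s.norm_scale)
      also have "\<dots> \<le> \<alpha> * l2 E c + \<beta> * l2 F c"
        using x(1) y(1) ab by (intro add_mono mult_left_mono) (auto simp: contractive_system_def)
      also have "\<dots> \<le> l2 (E \<union> F) c"
      proof (rule power2_le_imp_le)
        \<comment> \<open>Lagrange's identity, which proves Cauchy-Schwarz for the two
          pairs.\<close>
        have "(\<alpha> * l2 E c + \<beta> * l2 F c)\<^sup>2 + (\<alpha> * l2 F c - \<beta> * l2 E c)\<^sup>2 = (\<alpha>\<^sup>2 + \<beta>\<^sup>2) * ((l2 E c)\<^sup>2 + (l2 F c)\<^sup>2)"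
          by (simp add: power2_eq_square algebra_simps)
        then show "(\<alpha> * l2 E c + \<beta> * l2 F c)\<^sup>2 \<le> (l2 (E \<union> F) c)\<^sup>2"
          using l2_Un_disjoint[OF fin EF(2), of c] ab(3) zero_le_power2[of "\<alpha> * l2 F c - \<beta> * l2 E c"]
          by (simp only: mult_1_left)
      qed simp
      finally show "norm (\<Sum>e\<in>E \<union> F. s (c e) (w e)) \<le> l2 (E \<union> F) c" .
    qed
    moreover have "(\<Sum>e\<in>E \<union> F. ip (T (w e)) e) = of_real (\<alpha> * r + \<beta> * t)"
    proof -
      have "(\<Sum>e\<in>E \<union> F. ip (T (w e)) e) = (\<Sum>e\<in>E. ip (T (w e)) e) + (\<Sum>e\<in>F. ip (T (w e)) e)"
        using fin EF(2) by (rule sum.union_disjoint)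
      also have "\<dots> = of_real \<alpha> * (\<Sum>e\<in>E. ip (T (x e)) e) + of_real \<beta> * (\<Sum>e\<in>F. ip (T (y e)) e)"
        unfolding wE[of "\<lambda>v e. ip (T v) e"] wF[of "\<lambda>v e. ip (T v) e"]
        by (simp add: T.scale ip_scale_left sum_distrib_left)
      finally show ?thesis by (simp add: x y)
    qed
    ultimately show "\<alpha> * r + \<beta> * t \<in> Val (E \<union> F)" unfolding Val_def by blast
  next
    fix D b and \<eta> :: real
    assume D: "orthonormal D" and b: "\<And>r. r \<in> Val D \<Longrightarrow> r \<le> b" and \<eta>: "\<eta> > 0"
    have finD: "finite D" using D by (simp add: orthonormal_def)
    obtain V \<xi> where V: "finite V" "\<And>v. v \<in> V \<Longrightarrow> l2 D v \<le> 1" "\<And>v. \<xi> v \<in> dual_space s"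
      "(\<Sum>v\<in>V. onorm (\<xi> v)) \<le> b + \<eta>" "\<And>e x. e \<in> D \<Longrightarrow> ip (T x) e = (\<Sum>v\<in>V. v e * \<xi> v x)"
    proof (rule dual_factorization[OF s finD, of "\<lambda>e x. ip (T x) e" b \<eta>])
      show "r \<le> b" if "contractive_system s D x" "(\<Sum>e\<in>D. ip (T (x e)) e) = of_real r" for x r
        using that by (intro b) (auto simp: Val_def)
    qed (use \<eta> lin that in auto)
    obtain vs where vs: "set vs = V" "distinct vs" using V(1) finite_distinct_list by blast
    let ?y = "\<lambda>v. \<Sum>e\<in>D. scale (v e) e"
    let ?L = "map (\<lambda>v. (\<xi> v, ?y v)) vs"
    have onn: "onorm (\<xi> v) \<ge> 0" for v
      using V(3)[of v] by (auto simp: dual_space_def bounded_operator_def intro: onorm_pos_le)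
    have "(\<Sum>(f, y)\<leftarrow>?L. onorm f * norm y) = (\<Sum>v\<in>V. onorm (\<xi> v) * l2 D v)"
      using vs by (simp add: o_def sum_list_distinct_conv_sum_set norm_expansion[OF D])
    also have "\<dots> \<le> (\<Sum>v\<in>V. onorm (\<xi> v) * 1)" using V(2) onn by (intro sum_mono mult_left_mono) auto
    finally have "(\<Sum>(f, y)\<leftarrow>?L. onorm f * norm y) \<le> b + \<eta>" using V(4) by simp
    moreover have "(\<Sum>(f, y)\<leftarrow>?L. scale (f x) y) = (\<Sum>e\<in>D. scale (ip (T x) e) e)" for x
    proof -
      have "(\<Sum>(f, y)\<leftarrow>?L. scale (f x) y) = (\<Sum>v\<in>V. \<Sum>e\<in>D. scale (v e * \<xi> v x) e)"
        using vs by (simp add: o_def sum_list_distinct_conv_sum_set scale_sum_right mult.commute)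
      also have "\<dots> = (\<Sum>e\<in>D. scale (\<Sum>v\<in>V. v e * \<xi> v x) e)"
        by (subst sum.swap) (simp add: scale_sum_left)
      finally show ?thesis using V(5) by simp
    qed
    ultimately show "\<exists>L. (\<forall>(f, y)\<in>set L. f \<in> dual_space s) \<and> (\<Sum>(f, y)\<leftarrow>L. onorm f * norm y) \<le> b + \<eta> \<and>
        (\<forall>x. (\<Sum>(f, y)\<leftarrow>L. scale (f x) y) = (\<Sum>e\<in>D. scale (ip (T x) e) e))"
      using V(3) by (intro exI[of _ ?L]) auto
  next
    fix E b x
    assume E: "orthonormal E"
      and b: "\<And>F r. orthonormal (E \<union> F) \<Longrightarrow> E \<inter> F = {} \<Longrightarrow> r \<in> Val F \<Longrightarrow> r \<le> b"
    have b0: "b \<ge> 0" using b[of "{}" 0] E unfolding Val_def by (auto simp: contractive_system_def)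
    let ?h = "T x - proj E (T x)"
    have "norm ?h \<le> b * norm x"
    proof (cases "?h = 0")
      case True
      then show ?thesis using b0 by simp
    next
      case False
      then obtain e where e: "orthonormal (E \<union> {e})" "E \<inter> {e} = {}" "ip (T x) e = of_real (norm ?h)"
        using residual_direction[OF E] by metis
      have x0: "x \<noteq> 0"
      proof
        assume "x = 0"
        then have "?h = 0" by (simp add: proj_def)
        then show False using False by simp
      qed
      \<comment> \<open>On \<open>{e}\<close> the system with single member x / |x| is contractive,
        and its value is the residual norm divided by |x|.\<close>
      let ?c = "of_real (1 / norm x) :: 'k"
      have "contractive_system s {e} (\<lambda>_. s ?c x)"
        using x0 by (simp add: contractive_system_def s.norm_scale norm_divide)
      moreover have "ip (T (s ?c x)) e = of_real (norm ?h / norm x)"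
        by (simp only: T.scale ip_scale_left e(3)) simp
      ultimately have "norm ?h / norm x \<in> Val {e}" unfolding Val_def by (intro CollectI exI[of _ "\<lambda>_. s ?c x"]) auto
      then have "norm ?h / norm x \<le> b" by (rule b[OF e(1,2)])
      then show ?thesis using x0 by (simp add: divide_le_eq)
    qed
    then show "norm (T x - (\<Sum>e\<in>E. scale (ip (T x) e) e)) \<le> b * norm x" by (simp add: proj_def)
  qed
qed

text \<open>Here the orthonormal vectors are fixed and the functionals vary: a value over E is the
  trace of S on the span of E followed by a contraction from X to the Euclidean space. Weighted
  contractions over disjoint systems combine because \<alpha>^2 |y|^2 + \<beta>^2 |y|^2 =
  |y|^2.\<close>

lemma nuclear_norm_out_of:
  fixes s :: "'k \<Rightarrow> 'c::banach \<Rightarrow> 'c"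
  assumes s: "banach_over s" and S: "bounded_operator scale s S"
    and C: "\<And>E g. orthonormal E \<Longrightarrow> (\<And>e. e \<in> E \<Longrightarrow> Vector_Spaces.linear s (*) (g e)) \<Longrightarrow>
      (\<And>y. l2 E (\<lambda>e. g e y) \<le> norm y) \<Longrightarrow> norm (\<Sum>e\<in>E. g e (S e)) \<le> C"
  shows "nuclear_norm scale s S \<le> ennreal C"
proof -
  interpret s: banach_over s by fact
  interpret S: Vector_Spaces.linear scale s S using S by (simp add: bounded_operator_def)
  define admissible where "admissible E g \<longleftrightarrow>
    (\<forall>e\<in>E. Vector_Spaces.linear s (*) (g e)) \<and> (\<forall>y. l2 E (\<lambda>e. g e y) \<le> norm y)" for E and g :: "'a \<Rightarrow> 'c \<Rightarrow> 'k"
  define Val where "Val E = {r. \<exists>g. admissible E g \<and> (\<Sum>e\<in>E. g e (S e)) = of_real r}" for E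
  have lin_scale: "Vector_Spaces.linear s (*) (\<lambda>y. c * f y)" if "Vector_Spaces.linear s (*) f" for c f
    using that by (auto simp: Vector_Spaces.linear_iff algebra_simps)
  have zero: "0 \<in> Val E" for E
  proof -
    have "admissible E (\<lambda>_ _. 0)"
      by (auto simp: admissible_def L2_set_def Vector_Spaces.linear_iff vector_space_mult vector_space_banach_over[OF s])
    then show ?thesis unfolding Val_def by (intro CollectI exI[of _ "\<lambda>_ _. 0"]) simp
  qed
  show ?thesis
  proof (rule nuclear_norm_le_exhaustion[OF banach s, of Val C "\<lambda>e x. s (ip x e) (S e)" S])
    show "r \<le> C" if E: "orthonormal E" and r: "r \<in> Val E" for E r
    proof -
      obtain g where g: "admissible E g" "(\<Sum>e\<in>E. g e (S e)) = of_real r" using r by (auto simp: Val_def)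
      then have "norm (of_real r :: 'k) \<le> C" using C[OF E, of g] by (simp add: admissible_def)
      then show ?thesis by simp
    qed
    show "0 \<in> Val E" for E by (rule zero)
  next
    fix E F r t and \<alpha> \<beta> :: real
    assume EF: "orthonormal (E \<union> F)" "E \<inter> F = {}" and r: "r \<in> Val E" and t: "t \<in> Val F"
      and ab: "\<alpha> \<ge> 0" "\<beta> \<ge> 0" "\<alpha>\<^sup>2 + \<beta>\<^sup>2 = 1"
    obtain f where f: "admissible E f" "(\<Sum>e\<in>E. f e (S e)) = of_real r" using r by (auto simp: Val_def)
    obtain g where g: "admissible F g" "(\<Sum>e\<in>F. g e (S e)) = of_real t" using t by (auto simp: Val_def)
    define w where "w e y = (if e \<in> E then of_real \<alpha> * f e y else of_real \<beta> * g e y)" for e y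
    have fin: "finite E" "finite F" using EF(1) by (auto simp: orthonormal_def)
    have wE: "w e = (\<lambda>y. of_real \<alpha> * f e y)" if "e \<in> E" for e using that by (auto simp: w_def fun_eq_iff)
    have wF: "w e = (\<lambda>y. of_real \<beta> * g e y)" if "e \<in> F" for e using that EF(2) by (auto simp: w_def fun_eq_iff)
    have "admissible (E \<union> F) w"
      unfolding admissible_def
    proof (intro conjI ballI allI)
      show "Vector_Spaces.linear s (*) (w e)" if "e \<in> E \<union> F" for e
        using that f(1) g(1) lin_scale[where f = "f e"] lin_scale[where f = "g e"]
        by (auto simp: wE wF admissible_def)
      fix y
      have le: "l2 E (\<lambda>e. f e y) \<le> norm y" "l2 F (\<lambda>e. g e y) \<le> norm y" using f(1) g(1) by (auto simp: admissible_def)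
      have lE: "l2 E (\<lambda>e. w e y) = \<alpha> * l2 E (\<lambda>e. f e y)"
      proof -
        have "l2 E (\<lambda>e. w e y) = l2 E (\<lambda>e. of_real \<alpha> * f e y)" by (rule L2_set_cong) (auto simp: wE)
        then show ?thesis using ab by (simp only: l2_scale) simp
      qed
      have lF: "l2 F (\<lambda>e. w e y) = \<beta> * l2 F (\<lambda>e. g e y)"
      proof -
        have "l2 F (\<lambda>e. w e y) = l2 F (\<lambda>e. of_real \<beta> * g e y)" by (rule L2_set_cong) (auto simp: wF)
        then show ?thesis using ab by (simp only: l2_scale) simp
      qed
      have "(l2 (E \<union> F) (\<lambda>e. w e y))\<^sup>2 = \<alpha>\<^sup>2 * (l2 E (\<lambda>e. f e y))\<^sup>2 + \<beta>\<^sup>2 * (l2 F (\<lambda>e. g e y))\<^sup>2"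
        unfolding l2_Un_disjoint[OF fin EF(2)] lE lF power_mult_distrib ..
      also have "\<dots> \<le> \<alpha>\<^sup>2 * (norm y)\<^sup>2 + \<beta>\<^sup>2 * (norm y)\<^sup>2"
        using le by (intro add_mono mult_left_mono power_mono) auto
      also have "\<dots> = (norm y)\<^sup>2" using ab(3) by (simp flip: distrib_right)
      finally show "l2 (E \<union> F) (\<lambda>e. w e y) \<le> norm y" by (rule power2_le_imp_le) simp
    qed
    moreover have "(\<Sum>e\<in>E \<union> F. w e (S e)) = of_real (\<alpha> * r + \<beta> * t)"
    proof -
      have "(\<Sum>e\<in>E \<union> F. w e (S e)) = (\<Sum>e\<in>E. w e (S e)) + (\<Sum>e\<in>F. w e (S e))"
        using fin EF(2) by (rule sum.union_disjoint)
      also have "\<dots> = of_real \<alpha> * (\<Sum>e\<in>E. f e (S e)) + of_real \<beta> * (\<Sum>e\<in>F. g e (S e))"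
        by (simp add: wE wF sum_distrib_left)
      finally show ?thesis by (simp add: f g)
    qed
    ultimately show "\<alpha> * r + \<beta> * t \<in> Val (E \<union> F)" unfolding Val_def by blast
  next
    fix D b and \<eta> :: real
    assume D: "orthonormal D" and b: "\<And>r. r \<in> Val D \<Longrightarrow> r \<le> b" and \<eta>: "\<eta> > 0"
    have finD: "finite D" using D by (simp add: orthonormal_def)
    obtain K where K: "\<And>e. e \<in> D \<Longrightarrow> S e = (\<Sum>(c, x)\<leftarrow>K. s (c e) x)" "(\<Sum>(c, x)\<leftarrow>K. l2 D c * norm x) \<le> b + \<eta>"
    proof (rule predual_factorization[OF s finD _ \<eta>, of S b])
      show "r \<le> b" if "\<And>e. e \<in> D \<Longrightarrow> Vector_Spaces.linear s (*) (g e)" "\<And>y. l2 D (\<lambda>e. g e y) \<le> norm y"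
        "(\<Sum>e\<in>D. g e (S e)) = of_real r" for g r
        using that by (intro b) (auto simp: Val_def admissible_def)
    qed (rule that)
    \<comment> \<open>A coefficient vector c on D becomes a functional on the Hilbert space through
      the coordinates; Bessel's inequality bounds its norm by that of c.\<close>
    define f where "f c h = (\<Sum>e\<in>D. ip h e * c e)" for c h
    have f_le: "norm (f c h) \<le> l2 D c * norm h" for c h
    proof -
      have "norm (f c h) \<le> l2 D (\<lambda>e. ip h e) * l2 D c" unfolding f_def by (rule norm_sum_mult_le)
      also have "\<dots> \<le> norm h * l2 D c" by (intro mult_right_mono bessel[OF D]) simp
      finally show ?thesis by (simp add: mult.commute)
    qed
    have f_lin: "Vector_Spaces.linear scale (*) (f c)" for c
      unfolding Vector_Spaces.linear_iff
      by (auto simp: f_def ip_add_left ip_scale_left sum.distrib sum_distrib_left algebra_simps vector_space_mult vs)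
    have f: "f c \<in> dual_space scale" for c by (rule dual_spaceI[OF banach f_lin f_le])
    have fo: "onorm (f c) \<le> l2 D c" for c using f_le by (intro onorm_bound) auto
    let ?L = "map (\<lambda>(c, x). (f c, x)) K"
    have "(\<Sum>(f, y)\<leftarrow>?L. onorm f * norm y) = (\<Sum>(c, x)\<leftarrow>K. onorm (f c) * norm x)"
      by (simp add: o_def case_prod_unfold)
    also have "\<dots> \<le> (\<Sum>(c, x)\<leftarrow>K. l2 D c * norm x)"
      using fo by (intro sum_list_mono) (auto intro: mult_right_mono)
    finally have "(\<Sum>(f, y)\<leftarrow>?L. onorm f * norm y) \<le> b + \<eta>" using K(2) by simp
    moreover have "(\<Sum>(f, y)\<leftarrow>?L. s (f x) y) = (\<Sum>e\<in>D. s (ip x e) (S e))" for x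
    proof -
      have "(\<Sum>e\<in>D. s (ip x e) (\<Sum>(c, y)\<leftarrow>K. s (c e) y)) = (\<Sum>(c, y)\<leftarrow>K. s (f c x) y)"
        by (induction K) (auto simp: s.scale_right_distrib sum.distrib f_def s.scale_sum_left)
      then show ?thesis using K(1) by (simp add: o_def case_prod_unfold)
    qed
    ultimately show "\<exists>L. (\<forall>(f, y)\<in>set L. f \<in> dual_space scale) \<and> (\<Sum>(f, y)\<leftarrow>L. onorm f * norm y) \<le> b + \<eta> \<and>
        (\<forall>x. (\<Sum>(f, y)\<leftarrow>L. s (f x) y) = (\<Sum>e\<in>D. s (ip x e) (S e)))"
      using f by (intro exI[of _ ?L]) auto
  next
    fix E b x
    assume E: "orthonormal E"
      and b: "\<And>F r. orthonormal (E \<union> F) \<Longrightarrow> E \<inter> F = {} \<Longrightarrow> r \<in> Val F \<Longrightarrow> r \<le> b"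
    have b0: "b \<ge> 0" using b[of "{}" 0] E zero by simp
    let ?h = "x - proj E x"
    have eq: "S x - (\<Sum>e\<in>E. s (ip x e) (S e)) = S ?h" by (simp add: S.diff proj_def S.sum S.scale)
    have "norm (S ?h) \<le> b * norm x"
    proof (cases "?h = 0")
      case True
      then show ?thesis using b0 by simp
    next
      case False
      then obtain e where e: "orthonormal (E \<union> {e})" "E \<inter> {e} = {}" "?h = scale (of_real (norm ?h)) e"
        using residual_direction[OF E] by metis
      \<comment> \<open>A norming functional of \<open>S e\<close> is admissible over the single
        direction e, so the norm of \<open>S e\<close> is itself a value and at most b.\<close>
      obtain G where G: "Vector_Spaces.linear s (*) G" "\<And>y. norm (G y) \<le> norm y" "G (S e) = of_real (norm (S e))"
        using banach_norming_functional[OF s] by blast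
      have "norm (S e) \<in> Val {e}" unfolding Val_def admissible_def
        using G by (intro CollectI exI[of _ "\<lambda>_. G"]) auto
      then have Se: "norm (S e) \<le> b" by (rule b[OF e(1,2)])
      have "S ?h = s (of_real (norm ?h)) (S e)" by (subst e(3)) (rule S.scale)
      then have "norm (S ?h) = norm ?h * norm (S e)" by (simp add: s.norm_scale)
      also have "\<dots> \<le> norm x * b" using norm_residual_le[OF E, of x] Se by (intro mult_mono) auto
      finally show ?thesis by (simp add: mult.commute)
    qed
    then show "norm (S x - (\<Sum>e\<in>E. s (ip x e) (S e))) \<le> b * norm x" unfolding eq .
  qed
qed

end

section \<open>Passage to the limit\<close>

text \<open>A value a < N is finite. If f did not eventually exceed it, f would be at most a
  infinitely often, and \<open>low\<close> would give N \<le> a. With the upper bound from index 1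
  on, this also yields existence of the limit.\<close>

lemma tendsto_ennreal_of_frequently:
  fixes f :: "nat \<Rightarrow> ennreal"
  assumes up: "\<And>k. k \<ge> 1 \<Longrightarrow> f k \<le> N"
    and low: "\<And>C. C \<ge> 0 \<Longrightarrow> \<exists>\<^sub>F k in sequentially. f k \<le> ennreal C \<Longrightarrow> N \<le> ennreal C"
  shows "f \<longlonglongrightarrow> N"
proof (rule order_tendstoI)
  fix a assume a: "a < N"
  then obtain C where C: "a = ennreal C" "C \<ge> 0" by (cases a) auto
  show "\<forall>\<^sub>F k in sequentially. a < f k"
  proof (rule ccontr)
    assume "\<not> ?thesis"
    then have "\<exists>\<^sub>F k in sequentially. f k \<le> ennreal C" by (simp add: not_eventually not_less C)
    then have "N \<le> ennreal C" by (rule low[OF C(2)])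
    then show False using a C by simp
  qed
next
  fix a assume a: "N < a"
  show "\<forall>\<^sub>F k in sequentially. f k < a"
    using eventually_ge_at_top[of 1] by (rule eventually_mono) (use up a in \<open>auto intro: le_less_trans\<close>)
qed

text \<open>Convergence is stated along with the values because \<open>lim\<close> of a divergent
  sequence would be an unspecified value.\<close>

theorem theorem7p1:
  fixes scaleH :: "'k::rc_field \<Rightarrow> 'h::banach \<Rightarrow> 'h"
    and ip :: "'h \<Rightarrow> 'h \<Rightarrow> 'k"
    and scaleX :: "'k \<Rightarrow> 'x::banach \<Rightarrow> 'x"
    and T :: "'x \<Rightarrow> 'h"
    and S :: "'h \<Rightarrow> 'x"
  assumes "hilbert_over scaleH ip"
    and "banach_over scaleX"
    and "bounded_operator scaleX scaleH T"
    and "bounded_operator scaleH scaleX S"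
  shows "convergent (tau scaleX scaleH T) \<and> tau_infinity scaleX scaleH T = nuclear_norm scaleX scaleH T
    \<and> convergent (tau scaleH scaleX S) \<and> tau_infinity scaleH scaleX S = nuclear_norm scaleH scaleX S"
proof -
  interpret H: hilbert_over scaleH ip by fact
  note X = \<open>banach_over scaleX\<close> and T = \<open>bounded_operator scaleX scaleH T\<close>
    and S = \<open>bounded_operator scaleH scaleX S\<close>
  have "tau scaleX scaleH T \<longlonglongrightarrow> nuclear_norm scaleX scaleH T"
  proof (rule tendsto_ennreal_of_frequently)
    show "tau scaleX scaleH T k \<le> nuclear_norm scaleX scaleH T" if "k \<ge> 1" for k
      by (rule tau_le_nuclear_norm[OF X H.banach T that])
    fix C :: real assume C: "C \<ge> 0" "\<exists>\<^sub>F k in sequentially. tau scaleX scaleH T k \<le> ennreal C"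
    show "nuclear_norm scaleX scaleH T \<le> ennreal C"
    proof (rule H.nuclear_norm_into[OF X T])
      fix E x assume E: "H.orthonormal E" and x: "contractive_system scaleX E x"
      have "finite E" using E by (simp add: H.orthonormal_def)
      \<comment> \<open>The coordinate functionals of E are weakly 2-summable with constant 1 by
        Bessel's inequality.\<close>
      then show "norm (\<Sum>e\<in>E. ip (T (x e)) e) \<le> C"
        using H.ip_linear H.bessel[OF E] by (intro trace_le_frequently_tau[OF X H.banach T _ x _ _ C]) auto
    qed
  qed
  moreover have "tau scaleH scaleX S \<longlonglongrightarrow> nuclear_norm scaleH scaleX S"
  proof (rule tendsto_ennreal_of_frequently)
    show "tau scaleH scaleX S k \<le> nuclear_norm scaleH scaleX S" if "k \<ge> 1" for k
      by (rule tau_le_nuclear_norm[OF H.banach X S that])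
    fix C :: real assume C: "C \<ge> 0" "\<exists>\<^sub>F k in sequentially. tau scaleH scaleX S k \<le> ennreal C"
    show "nuclear_norm scaleH scaleX S \<le> ennreal C"
    proof (rule H.nuclear_norm_out_of[OF X S])
      fix E and g :: "'h \<Rightarrow> 'x \<Rightarrow> 'k"
      assume E: "H.orthonormal E" and g: "\<And>e. e \<in> E \<Longrightarrow> Vector_Spaces.linear scaleX (*) (g e)"
        "\<And>y. l2 E (\<lambda>e. g e y) \<le> norm y"
      have fin: "finite E" using E by (simp add: H.orthonormal_def)
      \<comment> \<open>Dually to the case of T, the orthonormal vectors are now the weakly
        2-summable system, and their combinations even have norm equal to that of c.\<close>
      have "contractive_system scaleH E (\<lambda>e. e)"
        unfolding contractive_system_def H.norm_expansion[OF E] by simp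
      then show "norm (\<Sum>e\<in>E. g e (S e)) \<le> C"
        by (rule trace_le_frequently_tau[OF H.banach X S fin _ g C])
    qed
  qed
  ultimately show ?thesis
    unfolding tau_infinity_def by (auto simp: convergent_def intro!: limI)
qed

end
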